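(* Let $\mathfrak g$ be a finite-dimensional Lie algebra over a field of characteristic zero, and let $\mathcal W:\mathfrak g=\bigoplus_{n\in\mathbb Z^k}W_n$ be a maximal grading of $\mathfrak g$ with set of weights $\Omega\subset\mathbb Z^k$. For $\mathbf a=(a_1,\dots,a_k)\in\mathbb R^k$ let $\pi^{\mathbf a}:\mathbb Z^k\to\mathbb R$ be the homomorphism with $\pi^{\mathbf a}(e_i)=a_i$, where $e_1,\dots,e_k$ is the standard basis of $\mathbb Z^k$, and let $$\mathbf A_+=\{\mathbf a\in\mathbb R^k:\pi^{\mathbf a}(n)>0\ \ \forall n\in\Omega\}.$$ Then the push-forward grading $\pi^{\mathbf a}_*(\mathcal W)$ is a positive grading if and only if $\mathbf a\in\mathbf A_+$, and every positive grading of $\mathfrak g$ is equivalent to $\pi^{\mathbf a}_*(\mathcal W)$ for some $\mathbf a\in\mathbf A_+$.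
   Context: A grading of a Lie algebra $\mathfrak g$ over an abelian group $A$ (an $A$-grading) is a direct sum decomposition $\mathcal V:\mathfrak g=\bigoplus_{\alpha\in A}V_\alpha$ into subspaces (layers) with $[V_\alpha,V_\beta]\subset V_{\alpha+\beta}$ for all $\alpha,\beta\in A$; its weights are the $\alpha$ with $V_\alpha\ne0$. An $\mathbb R$-grading is positive if all its weights are $>0$. For $\Phi\in\operatorname{Aut}(\mathfrak g)$ and a homomorphism $f:A\to B$ of abelian groups, the push-forward $f_*\Phi(\mathcal V)$ is the $B$-grading with layers $\bigoplus_{\alpha\in f^{-1}(\beta)}\Phi(V_\alpha)$, $\beta\in B$; write $f_*\mathcal V$ when $\Phi=\mathrm{Id}$. An $A$-grading $\mathcal V$ and a $B$-grading $\mathcal W$ are equivalent if $\mathcal W=f_*\Phi(\mathcal V)$ for some $\Phi\in\operatorname{Aut}(\mathfrak g)$ and some group isomorphism $f:A\to B$. A realization of an $A$-grading $\mathcal V$ with set of weights $\Omega$ is a grading $\mathcal W$ over an abelian group $B$ such that, for some injective map $f:\Omega\to B$, $W_{f(\alpha)}=V_\alpha$ for all $\alpha\in\Omega$ (and all other layers are zero). A universal realization of $\mathcal V$ is a realization $\widetilde{\mathcal V}$ over some abelian group $A$ such that for every realization of $\mathcal V$ as a $B$-grading there is a unique homomorphism $f:A\to B$ such that this $B$-grading equals $f_*\widetilde{\mathcal V}$. A split torus of $\operatorname{der}(\mathfrak g)$ is an abelian subalgebra of $\operatorname{der}(\mathfrak g)$ that is simultaneously diagonalizable over the base field of $\mathfrak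 g$. The grading induced by a split torus $\mathfrak t$ is the $\mathfrak t^*$-grading with layers $V_\alpha=\{X\in\mathfrak g:\delta(X)=\alpha(\delta)X\ \forall\delta\in\mathfrak t\}$, $\alpha\in\mathfrak t^*$. A maximal grading of $\mathfrak g$ is the universal realization of the grading induced by a maximal split torus of $\operatorname{der}(\mathfrak g)$. *)

theory Defs
  imports Complex_Main "HOL-Algebra.Product_Groups"
begin

(* The grading groups are HOL-Algebra groups with explicit carriers, because Z^k for a variable
   number k (possibly 0) and the dual of a torus are not types.  HOL-Algebra writes groups
   multiplicatively, so the sum of weights alpha + beta appears as a product. *)

section \<open>The groups\<close>

definition real_group :: "real monoid" where
  "real_group = \<lparr>carrier = UNIV, monoid.mult = (+), one = 0\<rparr>"

(* Integer vectors of length k, as functions on {..<k} that are undefined elsewhere. *)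
abbreviation int_lattice :: "nat \<Rightarrow> (nat \<Rightarrow> int) monoid" where
  "int_lattice k \<equiv> product_group {..<k} (\<lambda>_. integer_group)"

abbreviation real_vectors :: "nat \<Rightarrow> (nat \<Rightarrow> real) set" where
  "real_vectors k \<equiv> {..<k} \<rightarrow>\<^sub>E UNIV"

definition unit_vec :: "nat \<Rightarrow> nat \<Rightarrow> nat \<Rightarrow> int" where
  "unit_vec k i = (\<lambda>j\<in>{..<k}. if j = i then 1 else 0)"

definition lattice_proj :: "nat \<Rightarrow> (nat \<Rightarrow> real) \<Rightarrow> (nat \<Rightarrow> int) \<Rightarrow> real" where
  "lattice_proj k a n = (\<Sum>i<k. a i * of_int (n i))"

definition positive_cone :: "nat \<Rightarrow> (nat \<Rightarrow> int) set \<Rightarrow> (nat \<Rightarrow> real) set" where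
  "positive_cone k \<Omega> = {a \<in> real_vectors k. \<forall>n\<in>\<Omega>. lattice_proj k a n > 0}"

lemma comm_group_real_group: "comm_group real_group"
  by (rule comm_groupI) (auto simp: real_group_def intro: exI[of _ "- x" for x])

lemma comm_group_int_lattice: "comm_group (int_lattice k)"
proof -
  interpret G: group "int_lattice k"
    by (simp add: group_integer_group)
  show ?thesis
    by (rule G.group_comm_groupI) (auto simp: add.commute)
qed

lemma unit_vec_in_lattice: "unit_vec k i \<in> carrier (int_lattice k)"
  by (auto simp: unit_vec_def)

lemma lattice_proj_hom: "lattice_proj k a \<in> hom (int_lattice k) real_group"
  by (auto simp: hom_def lattice_proj_def real_group_def algebra_simps sum.distrib
           intro!: sum.cong)

lemma lattice_proj_unit_vec: "i < k \<Longrightarrow> lattice_proj k a (unit_vec k i) = a i"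
proof -
  assume "i < k"
  have "lattice_proj k a (unit_vec k i) = (\<Sum>j<k. if j = i then a j else 0)"
    unfolding lattice_proj_def unit_vec_def by (rule sum.cong) auto
  with \<open>i < k\<close> show ?thesis by simp
qed

section \<open>Lie algebras\<close>

locale lie_algebra = vector_space scale
  for scale :: "'k::field \<Rightarrow> 'g::ab_group_add \<Rightarrow> 'g" (infixr \<open>*s\<close> 75) +
  fixes bracket :: "'g \<Rightarrow> 'g \<Rightarrow> 'g"
  assumes linear_bracket_right: "Vector_Spaces.linear scale scale (\<lambda>y. bracket x y)"
    and linear_bracket_left: "Vector_Spaces.linear scale scale (\<lambda>x. bracket x y)"
    and bracket_self: "bracket x x = 0"
    and jacobi: "bracket x (bracket y z) + bracket y (bracket z x) + bracket z (bracket x y) = 0"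
begin

definition automorphisms :: "('g \<Rightarrow> 'g) set" where
  "automorphisms = {\<Phi>. Vector_Spaces.linear scale scale \<Phi> \<and> bij \<Phi> \<and>
     (\<forall>x y. \<Phi> (bracket x y) = bracket (\<Phi> x) (\<Phi> y))}"

definition derivations :: "('g \<Rightarrow> 'g) set" where
  "derivations = {\<delta>. Vector_Spaces.linear scale scale \<delta> \<and>
     (\<forall>x y. \<delta> (bracket x y) = bracket (\<delta> x) y + bracket x (\<delta> y))}"

section \<open>Gradings\<close>

(* Only the layers over the carrier of the grading group are meaningful. *)
definition is_direct_sum :: "'a set \<Rightarrow> ('a \<Rightarrow> 'g set) \<Rightarrow> bool" where
  "is_direct_sum I V \<longleftrightarrow> (\<forall>\<alpha>\<in>I. subspace (V \<alpha>)) \<and>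
     (\<forall>x. \<exists>!c. (\<forall>\<alpha>\<in>I. c \<alpha> \<in> V \<alpha>) \<and> (\<forall>\<alpha>. \<alpha> \<notin> I \<longrightarrow> c \<alpha> = 0) \<and>
               finite {\<alpha>. c \<alpha> \<noteq> 0} \<and> x = (\<Sum>\<alpha> | c \<alpha> \<noteq> 0. c \<alpha>))"

definition is_grading :: "'a monoid \<Rightarrow> ('a \<Rightarrow> 'g set) \<Rightarrow> bool" where
  "is_grading A V \<longleftrightarrow> comm_group A \<and> is_direct_sum (carrier A) V \<and>
     (\<forall>\<alpha>\<in>carrier A. \<forall>\<beta>\<in>carrier A. \<forall>x\<in>V \<alpha>. \<forall>y\<in>V \<beta>. bracket x y \<in> V (\<alpha> \<otimes>\<^bsub>A\<^esub> \<beta>))"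

definition weights :: "'a monoid \<Rightarrow> ('a \<Rightarrow> 'g set) \<Rightarrow> 'a set" where
  "weights A V = {\<alpha> \<in> carrier A. V \<alpha> \<noteq> {0}}"

definition is_positive_grading :: "(real \<Rightarrow> 'g set) \<Rightarrow> bool" where
  "is_positive_grading V \<longleftrightarrow> is_grading real_group V \<and> (\<forall>r\<in>weights real_group V. r > 0)"

definition push_forward ::
    "'a monoid \<Rightarrow> ('a \<Rightarrow> 'b) \<Rightarrow> ('g \<Rightarrow> 'g) \<Rightarrow> ('a \<Rightarrow> 'g set) \<Rightarrow> 'b \<Rightarrow> 'g set" where
  "push_forward A f \<Phi> V \<beta> = span (\<Union>\<alpha>\<in>{\<alpha> \<in> carrier A. f \<alpha> = \<beta>}. \<Phi> ` V \<alpha>)"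

definition equivalent_gradings ::
    "'a monoid \<Rightarrow> ('a \<Rightarrow> 'g set) \<Rightarrow> 'b monoid \<Rightarrow> ('b \<Rightarrow> 'g set) \<Rightarrow> bool" where
  "equivalent_gradings A V B W \<longleftrightarrow>
     (\<exists>\<Phi>\<in>automorphisms. \<exists>f\<in>iso A B. \<forall>\<beta>\<in>carrier B. W \<beta> = push_forward A f \<Phi> V \<beta>)"

definition is_realization ::
    "'a monoid \<Rightarrow> ('a \<Rightarrow> 'g set) \<Rightarrow> 'b monoid \<Rightarrow> ('b \<Rightarrow> 'g set) \<Rightarrow> bool" where
  "is_realization A V B W \<longleftrightarrow> is_grading B W \<and>
     (\<exists>f. inj_on f (weights A V) \<and> f ` weights A V \<subseteq> carrier B \<and>
          (\<forall>\<alpha>\<in>weights A V. W (f \<alpha>) = V \<alpha>) \<and>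
          (\<forall>\<beta>\<in>carrier B - f ` weights A V. W \<beta> = {0}))"

(* HOL cannot quantify over the types of all grading groups inside a formula.  The type 'u is
   the universe from which the elements of the test groups B are taken.  When weights A V is finite
   and C is countable, the property is the same for every infinite 'u: the test groups that matter
   are then countable, so they have copies inside 'u. *)
definition is_universal_realization ::
    "'u itself \<Rightarrow> 'a monoid \<Rightarrow> ('a \<Rightarrow> 'g set) \<Rightarrow> 'c monoid \<Rightarrow> ('c \<Rightarrow> 'g set) \<Rightarrow> bool" where
  "is_universal_realization TYPE('u) A V C U \<longleftrightarrow> is_realization A V C U \<and>
     (\<forall>(B :: 'u monoid) W. is_realization A V B W \<longrightarrow>
        (\<exists>!f. f \<in> hom C B \<and> f \<in> extensional (carrier C) \<and>
              (\<forall>\<beta>\<in>carrier B. W \<beta> = push_forward C f id U \<beta>)))"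

section \<open>Split tori and maximal gradings\<close>

definition simultaneously_diagonalizable :: "('g \<Rightarrow> 'g) set \<Rightarrow> bool" where
  "simultaneously_diagonalizable t \<longleftrightarrow>
     (\<exists>E. independent E \<and> span E = UNIV \<and> (\<forall>e\<in>E. \<forall>\<delta>\<in>t. \<exists>c. \<delta> e = c *s e))"

(* Closure under the commutator bracket is implied: the commutator vanishes on t and 0 is in t. *)
definition is_split_torus :: "('g \<Rightarrow> 'g) set \<Rightarrow> bool" where
  "is_split_torus t \<longleftrightarrow> t \<subseteq> derivations \<and>
     (\<lambda>x. 0) \<in> t \<and>
     (\<forall>\<delta>\<in>t. \<forall>\<epsilon>\<in>t. (\<lambda>x. \<delta> x + \<epsilon> x) \<in> t) \<and>
     (\<forall>c. \<forall>\<delta>\<in>t. (\<lambda>x. c *s \<delta> x) \<in> t) \<and>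
     (\<forall>\<delta>\<in>t. \<forall>\<epsilon>\<in>t. (\<lambda>x. \<delta> (\<epsilon> x) - \<epsilon> (\<delta> x)) = (\<lambda>x. 0)) \<and>
     simultaneously_diagonalizable t"

definition is_maximal_split_torus :: "('g \<Rightarrow> 'g) set \<Rightarrow> bool" where
  "is_maximal_split_torus t \<longleftrightarrow> is_split_torus t \<and>
     (\<forall>t'. is_split_torus t' \<and> t \<subseteq> t' \<longrightarrow> t' = t)"

definition dual_group :: "('g \<Rightarrow> 'g) set \<Rightarrow> (('g \<Rightarrow> 'g) \<Rightarrow> 'k) monoid" where
  "dual_group t =
     \<lparr>carrier = {\<alpha> \<in> extensional t.
        (\<forall>\<delta>\<in>t. \<forall>\<epsilon>\<in>t. \<alpha> (\<lambda>x. \<delta> x + \<epsilon> x) = \<alpha> \<delta> + \<alpha> \<epsilon>) \<and>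
        (\<forall>c. \<forall>\<delta>\<in>t. \<alpha> (\<lambda>x. c *s \<delta> x) = c * \<alpha> \<delta>)},
      monoid.mult = (\<lambda>\<alpha> \<beta>. \<lambda>\<delta>\<in>t. \<alpha> \<delta> + \<beta> \<delta>),
      one = (\<lambda>\<delta>\<in>t. 0)\<rparr>"

definition torus_grading :: "('g \<Rightarrow> 'g) set \<Rightarrow> (('g \<Rightarrow> 'g) \<Rightarrow> 'k) \<Rightarrow> 'g set" where
  "torus_grading t \<alpha> = {x. \<forall>\<delta>\<in>t. \<delta> x = \<alpha> \<delta> *s x}"

definition is_maximal_grading :: "'u itself \<Rightarrow> 'c monoid \<Rightarrow> ('c \<Rightarrow> 'g set) \<Rightarrow> bool" where
  "is_maximal_grading TYPE('u) C U \<longleftrightarrow>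
     (\<exists>t. is_maximal_split_torus t \<and>
          is_universal_realization TYPE('u) (dual_group t) (torus_grading t) C U)"

lemma comm_group_dual_group:
  assumes "is_split_torus t"
  shows "comm_group (dual_group t)"
proof (rule comm_groupI)
  have add: "\<And>\<delta> \<epsilon>. \<delta> \<in> t \<Longrightarrow> \<epsilon> \<in> t \<Longrightarrow> (\<lambda>x. \<delta> x + \<epsilon> x) \<in> t"
    and smult: "\<And>c \<delta>. \<delta> \<in> t \<Longrightarrow> (\<lambda>x. c *s \<delta> x) \<in> t"
    using assms by (auto simp: is_split_torus_def)
  show "\<exists>\<beta>\<in>carrier (dual_group t). \<beta> \<otimes>\<^bsub>dual_group t\<^esub> \<alpha> = \<one>\<^bsub>dual_group t\<^esub>"
    if "\<alpha> \<in> carrier (dual_group t)" for \<alpha>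
    using that add smult
    by (intro bexI[of _ "\<lambda>\<delta>\<in>t. - \<alpha> \<delta>"]) (auto simp: dual_group_def fun_eq_iff restrict_def extensional_def)
qed (use assms in \<open>auto simp: dual_group_def is_split_torus_def fun_eq_iff algebra_simps
       extensional_def restrict_def\<close>)

end

locale finite_dimensional_lie_algebra =
  lie_algebra scale bracket + finite_dimensional_vector_space scale Basis
  for scale :: "'k::field \<Rightarrow> 'g::ab_group_add \<Rightarrow> 'g" (infixr \<open>*s\<close> 75)
    and bracket :: "'g \<Rightarrow> 'g \<Rightarrow> 'g" and Basis :: "'g set"

end

(* Every positive grading is the eigenspace decomposition of a derivation h with integer eigenvalues:
   compose its weights with an additive map from the reals to the rationals that is injective on the
   finitely many weights, and clear denominators. The maximal grading is likewise refined by the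
   eigenspaces of such a derivation h'. The main point is that h can be conjugated by an automorphism
   so that it commutes with h' (for algebraic groups: any two parabolic subgroups share a maximal
   split torus). The radical R of the trace form on the derivation algebra D consists of nilpotent
   operators, because D is algebraic: over an algebraic closure one tests against derivations acting
   by rational scalars on generalized eigenspaces. By Engel's theorem R acts nilpotently, and duality
   for the trace form gives h = n + q + r, where n has positive h-degree, q has nonnegative
   h'-degree and r is in R. Since n + r lies in an h-stable nilpotent Lie algebra, exponentials
   conjugate q to h plus a commuting nilpotent, so a conjugate of h preserves the h'-filtration;
   a second conjugation makes it commute with h'. By maximality it then lies in the torus, so each
   layer of the maximal grading lies in one layer of the conjugated positive grading, and
   universality extends the resulting map of weights to a homomorphism from the lattice to the
   reals. *)

theory Submission
  imports Defs "HOL-Algebra.Algebraic_Closure_Type" "HOL-Library.Function_Algebras"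
begin

text \<open>Real weights need not lie in the base field, whereas integers do in characteristic zero;
  this is why both gradings are regraded by integers with the same layers. The regrading maps are
  additive only where a bracket of layers forces it, and coarsenings accept such maps. The trace
  form on all derivations may be degenerate, so pairings determine h only up to the radical; that is
  where the summand r comes from. A subspace stable under h plus a commuting nilpotent is graded,
  because h is a polynomial in that sum; this turns the conjugation of q into a statement about
  filtrations. The second conjugation does not act on h directly. Along the h'-filtration it
  normalizes the part of h' that commutes with the conjugated h, whose difference from h' is
  strictly triangular. This part becomes h' plus a commuting nilpotent, and whatever commutes with
  that sum commutes with h'. The map of weights may identify weights, so by itself it gives no
  realization; pairing it with the inclusion of the weights into Z^k restores injectivity before
  universality is applied.\<close>

section \<open>Traces\<close>

(* A copy of vector_space: definitions made in vector_space itself are also interpreted for real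
   vector spaces, without a mandatory name prefix, which would shadow them. *)
locale vspace = vector_space scale
  for scale :: "'a::field \<Rightarrow> 'b::ab_group_add \<Rightarrow> 'b" (infixr \<open>*s\<close> 75)
begin

abbreviation lin :: "('b \<Rightarrow> 'b) \<Rightarrow> bool" where
  "lin f \<equiv> Vector_Spaces.linear scale scale f"

lemma linI:
  assumes "\<And>x y. f (x + y) = f x + f y" "\<And>c x. f (c *s x) = c *s f x"
  shows "lin f"
  using assms by unfold_locales auto

lemma lin_imp_module_hom: "lin f \<Longrightarrow> module_hom scale scale f"
  by (simp add: module_hom_eq_linear)

lemma lin_add: "lin f \<Longrightarrow> f (x + y) = f x + f y"
  by (rule module_hom.add[OF lin_imp_module_hom]) 

lemma lin_scale: "lin f \<Longrightarrow> f (c *s x) = c *s f x"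
  by (rule module_hom.scale[OF lin_imp_module_hom]) 

lemma lin_zero: "lin f \<Longrightarrow> f 0 = 0"
  by (rule module_hom.zero[OF lin_imp_module_hom]) 

lemma lin_diff: "lin f \<Longrightarrow> f (x - y) = f x - f y"
  by (rule module_hom.diff[OF lin_imp_module_hom]) 

lemma lin_neg: "lin f \<Longrightarrow> f (- x) = - f x"
  by (rule module_hom.neg[OF lin_imp_module_hom]) 

lemma lin_sum: "lin f \<Longrightarrow> f (sum g A) = (\<Sum>a\<in>A. f (g a))"
  by (rule module_hom.sum[OF lin_imp_module_hom]) 

lemma lin_comp: "lin f \<Longrightarrow> lin g \<Longrightarrow> lin (\<lambda>x. f (g x))"
  by (rule linI) (simp_all add: lin_add lin_scale)

lemma lin_plus: "lin f \<Longrightarrow> lin g \<Longrightarrow> lin (\<lambda>x. f x + g x)"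
  by (rule linI) (simp_all add: lin_add lin_scale scale_right_distrib)

lemma lin_minus: "lin f \<Longrightarrow> lin g \<Longrightarrow> lin (\<lambda>x. f x - g x)"
  by (rule linI) (simp_all add: lin_add lin_scale scale_right_diff_distrib)

lemma lin_smult: "lin f \<Longrightarrow> lin (\<lambda>x. c *s f x)"
  by (rule linI) (simp_all add: lin_add lin_scale scale_right_distrib scale_left_commute)

lemma lin_id: "lin (\<lambda>x. x)" and lin_const_zero: "lin (\<lambda>x. 0)"
  by (rule linI; simp)+

lemma lin_sums: "(\<And>a. a \<in> A \<Longrightarrow> lin (f a)) \<Longrightarrow> lin (\<lambda>x. \<Sum>a\<in>A. f a x)"
  by (rule linI) (simp_all add: lin_add lin_scale sum.distrib scale_sum_right)

lemma lin_funpow: "lin f \<Longrightarrow> lin (f ^^ n)"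
  by (induction n) (auto simp: comp_def lin_comp lin_id id_def)

lemma subspace_lin_image: "lin f \<Longrightarrow> subspace S \<Longrightarrow> subspace (f ` S)"
  by (rule module_hom.subspace_image[OF lin_imp_module_hom])

lemma subspace_plus:
  assumes S: "subspace S" and T: "subspace T"
  shows "subspace {x + y |x y. x \<in> S \<and> y \<in> T}" (is "subspace ?U")
proof (rule subspaceI)
  show "0 \<in> ?U" using subspace_0[OF S] subspace_0[OF T] by (intro CollectI exI[of _ 0]) simp
  show "a + b \<in> ?U" if ab: "a \<in> ?U" "b \<in> ?U" for a b
  proof -
    obtain x y x' y' where *: "x \<in> S" "y \<in> T" "a = x + y" "x' \<in> S" "y' \<in> T" "b = x' + y'"
      using ab by blast
    then have "a + b = (x + x') + (y + y')" by (simp add: ac_simps)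
    then show ?thesis using subspace_add[OF S *(1,4)] subspace_add[OF T *(2,5)] by blast
  qed
  show "c *s a \<in> ?U" if "a \<in> ?U" for c a
    using that subspace_scale[OF S] subspace_scale[OF T] scale_right_distrib by blast
qed

text \<open>For independent \<open>B\<close> this is the trace of an operator on
  \<open>span B\<close>. The base change relies on this generality, since it sits inside a larger
  function space.\<close>

definition trace_on :: "'b set \<Rightarrow> ('b \<Rightarrow> 'b) \<Rightarrow> 'a" where
  "trace_on B f = (\<Sum>b\<in>B. representation B (f b) b)"

lemma sum_representation:
  assumes "finite B" "independent B" "v \<in> span B"
  shows "(\<Sum>b\<in>B. representation B v b *s b) = v"
  using sum_representation_eq[OF assms(2,3) assms(1) order_refl] .

lemma representation_sum_scale:
  assumes "finite B" "independent B" "finite A" "\<And>a. a \<in> A \<Longrightarrow> g a \<in> span B"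
  shows "representation B (\<Sum>a\<in>A. c a *s g a) b = (\<Sum>a\<in>A. c a * representation B (g a) b)"
  using assms(3,4) assms(1,2)
  by (induction A rule: finite_induct)
    (auto simp: representation_add representation_scale span_sum span_scale representation_zero)

lemma representation_lin:
  assumes B: "finite B" "independent B" and C: "finite C" "independent C"
    and f: "lin f" "f ` span C \<subseteq> span B" and v: "v \<in> span C"
  shows "representation B (f v) b = (\<Sum>c\<in>C. representation C v c * representation B (f c) b)"
proof -
  have "f v = f (\<Sum>c\<in>C. representation C v c *s c)"
    using sum_representation[OF C v] by simp
  also have "\<dots> = (\<Sum>c\<in>C. representation C v c *s f c)"
    by (simp add: lin_sum[OF f(1)] lin_scale[OF f(1)])
  finally have "representation B (f v) b = representation B (\<Sum>c\<in>C. representation C v c *s f c) b"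
    by simp
  also have "\<dots> = (\<Sum>c\<in>C. representation C v c * representation B (f c) b)"
    by (rule representation_sum_scale[OF B C(1)]) (use f(2) span_base in blast)
  finally show ?thesis .
qed

text \<open>Both sides are the same double sum of matrix entries. Allowing two bases gives
  independence of the basis, with \<open>g\<close> the identity, as well as the cyclic
  property.\<close>

lemma trace_on_commute_gen:
  assumes B: "finite B" "independent B" and C: "finite C" "independent C"
    and f: "lin f" "f ` span C \<subseteq> span B" and g: "lin g" "g ` span B \<subseteq> span C"
  shows "trace_on B (\<lambda>x. f (g x)) = trace_on C (\<lambda>x. g (f x))"
proof -
  have "trace_on B (\<lambda>x. f (g x)) =
      (\<Sum>b\<in>B. \<Sum>c\<in>C. representation C (g b) c * representation B (f c) b)"
    unfolding trace_on_def
    by (intro sum.cong refl representation_lin[OF B C f]) (use g(2) span_base in blast)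
  also have "\<dots> = (\<Sum>c\<in>C. \<Sum>b\<in>B. representation B (f c) b * representation C (g b) c)"
    by (subst sum.swap) (simp add: mult.commute)
  also have "\<dots> = trace_on C (\<lambda>x. g (f x))"
    unfolding trace_on_def
    by (intro sum.cong refl representation_lin[OF C B g, symmetric]) (use f(2) span_base in blast)
  finally show ?thesis .
qed

lemma trace_on_basis_change:
  assumes "finite B" "independent B" "finite C" "independent C" "span B = span C"
    and "lin f" "f ` span B \<subseteq> span B"
  shows "trace_on B f = trace_on C f"
  using trace_on_commute_gen[OF assms(1-4,6) _ lin_id] assms(5,7) by auto

lemma trace_on_commute:
  assumes "finite B" "independent B"
    and "lin f" "f ` span B \<subseteq> span B" and "lin g" "g ` span B \<subseteq> span B"
  shows "trace_on B (\<lambda>x. f (g x)) = trace_on B (\<lambda>x. g (f x))"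
  by (rule trace_on_commute_gen) (use assms in auto)

lemma trace_on_cong: "(\<And>x. x \<in> B \<Longrightarrow> f x = g x) \<Longrightarrow> trace_on B f = trace_on B g"
  by (simp add: trace_on_def)

lemma trace_on_add:
  assumes "finite B" "independent B" "f ` span B \<subseteq> span B" "g ` span B \<subseteq> span B"
  shows "trace_on B (\<lambda>x. f x + g x) = trace_on B f + trace_on B g"
  unfolding trace_on_def sum.distrib[symmetric]
proof (intro sum.cong refl)
  fix b assume "b \<in> B"
  then have "f b \<in> span B" "g b \<in> span B" using assms(3,4) span_base by blast+
  then show "representation B (f b + g b) b = representation B (f b) b + representation B (g b) b"
    using assms(2) by (simp add: representation_add)
qed

lemma trace_on_scale:
  assumes "finite B" "independent B" "f ` span B \<subseteq> span B"
  shows "trace_on B (\<lambda>x. c *s f x) = c * trace_on B f"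
  unfolding trace_on_def sum_distrib_left
proof (intro sum.cong refl)
  fix b assume "b \<in> B"
  then have "f b \<in> span B" using assms(3) span_base by blast+
  then show "representation B (c *s f b) b = c * representation B (f b) b"
    using assms(2) by (simp add: representation_scale)
qed

lemma trace_on_nilpotent:
  assumes B: "finite B" "independent B"
    and f: "lin f" "f ` span B \<subseteq> span B" and n: "\<And>x. x \<in> span B \<Longrightarrow> (f ^^ n) x = 0"
  shows "trace_on B f = 0"
  using f n
proof (induction n arbitrary: f)
  case 0
  then have "f b = 0" if "b \<in> B" for b using that span_base[of b B] lin_zero[of f] by fastforce
  then show ?case by (simp add: trace_on_def representation_zero)
next
  case (Suc n)
  note f = Suc.prems(1,2)
  show ?case
  \<comment> \<open>The \<open>n\<close>-th power of \<open>f'\<close> is \<open>f ^^ Suc n\<close>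
    after \<open>g\<close> only for positive \<open>n\<close>, so the case that \<open>f\<close>
    itself vanishes on the span is treated apart.\<close>
  proof (cases "n = 0")
    case True
    then have "f b = 0" if "b \<in> B" for b using that span_base[of b B] Suc.prems(3) by fastforce
    then show ?thesis by (simp add: trace_on_def representation_zero)
  next
    case nz: False
  interpret p: vector_space_pair scale scale by unfold_locales
  obtain g where g: "range g \<subseteq> span B" "lin g" "\<And>v. v \<in> f ` span B \<Longrightarrow> f (g v) = v"
    using p.linear_exists_right_inverse_on[OF f(1) subspace_span[of B]] by blast
  txt \<open>\<open>f g\<close> is a projection onto the image of \<open>f\<close>, so \<open>f\<close> has the same trace as \<open>f f g\<close>,
    whose nilpotency order is smaller.\<close>
  define f' where "f' = (\<lambda>x. f (f (g x)))"
  have gB: "g ` span B \<subseteq> span B" using g(1) by blast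
  have fg: "lin (\<lambda>x. f (g x))" "(\<lambda>x. f (g x)) ` span B \<subseteq> span B"
    using f(2) gB lin_comp[OF f(1) g(2)] by auto
  have "trace_on B f = trace_on B (\<lambda>x. f (g (f x)))"
    by (rule trace_on_cong) (use g(3) span_base in auto)
  also have "\<dots> = trace_on B f'"
    unfolding f'_def by (rule trace_on_commute[OF B fg f])
  also have "\<dots> = 0"
  proof (rule Suc.IH)
    show "lin f'" unfolding f'_def by (rule lin_comp[OF f(1) fg(1)])
    show "f' ` span B \<subseteq> span B" using f gB by (auto simp: f'_def)
    fix x assume x: "x \<in> span B"
    \<comment> \<open>On the image of \<open>f\<close> the map \<open>g\<close> is a right inverse,
      so \<open>f'\<close> and \<open>f\<close> agree there.\<close>
    have *: "(f' ^^ m) (f w) = (f ^^ m) (f w)" if "w \<in> span B" for m w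
      using that
    proof (induction m arbitrary: w)
      case (Suc m)
      have "f' (f w) = f (f w)" unfolding f'_def using g(3) Suc.prems by auto
      moreover have "f w \<in> span B" using Suc.prems f by auto
      ultimately show ?case using Suc.IH[of "f w"] by (simp add: funpow_Suc_right del: funpow.simps)
    qed simp
    show "(f' ^^ n) x = 0"
    proof (cases n)
      case 0
      with nz show ?thesis by simp
    next
      case (Suc m)
      have "(f' ^^ n) x = (f ^^ m) (f (f (g x)))"
        using *[of "f (g x)" m] f gB x Suc
        by (simp add: funpow_Suc_right f'_def image_subset_iff del: funpow.simps)
      also have "\<dots> = (f ^^ Suc n) (g x)"
        using Suc by (simp add: funpow_Suc_right del: funpow.simps)
      also have "\<dots> = 0" using Suc.prems(3) gB x by auto
      finally show ?thesis .
    qed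
  qed
  finally show ?thesis .
  qed
qed

end

section \<open>Generalized eigenspaces\<close>

text \<open>The field is a vector space over its prime field, where the independent set
  \<open>{x}\<close> extends to a basis. The functional is in general not multiplicative.\<close>

lemma rational_functional_exists:
  fixes x :: "'r::field_char_0"
  assumes "x \<noteq> 0"
  obtains \<phi> :: "'r \<Rightarrow> rat" where "\<And>a b. \<phi> (a + b) = \<phi> a + \<phi> b"
    "\<And>q a. \<phi> (of_rat q * a) = q * \<phi> a" "\<phi> x = 1"
proof -
  interpret Q: vector_space_pair "\<lambda>q (a::'r). of_rat q * a" "(*) :: rat \<Rightarrow> rat \<Rightarrow> rat"
    by unfold_locales (simp_all add: algebra_simps of_rat_add of_rat_mult)
  have "Q.vs1.independent {x}"
    using assms by (simp add: Q.vs1.dependent_single)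
  then obtain \<phi> where \<phi>: "Vector_Spaces.linear (\<lambda>q (a::'r). of_rat q * a) (*) \<phi>" "\<phi> x = (1::rat)"
    using Q.linear_independent_extend[of "{x}" "\<lambda>_. 1"] by auto
  show thesis
    using that[of \<phi>] \<phi> Q.linear_add[OF \<phi>(1)] Q.linear_scale[OF \<phi>(1)] by blast
qed

section \<open>Eigenvectors from annihilating polynomials\<close>

locale vspace_alg_closed = vspace scale
  for scale :: "'a::{alg_closed_field,field_char_0} \<Rightarrow> 'b::ab_group_add \<Rightarrow> 'b" (infixr \<open>*s\<close> 75)
begin

text \<open>Evaluation of \<open>p\<close> at the operator \<open>T\<close>, applied to a single
  vector, so that a polynomial annihilating that one vector is enough.\<close>

definition poly_op :: "('b \<Rightarrow> 'b) \<Rightarrow> 'a poly \<Rightarrow> 'b \<Rightarrow> 'b" where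
  "poly_op T p v = (\<Sum>i\<le>Polynomial.degree p. Polynomial.coeff p i *s (T ^^ i) v)"

lemma poly_op_bound:
  "Polynomial.degree p \<le> N \<Longrightarrow> poly_op T p v = (\<Sum>i\<le>N. Polynomial.coeff p i *s (T ^^ i) v)"
  unfolding poly_op_def by (rule sum.mono_neutral_left) (auto simp: Polynomial.coeff_eq_0)

lemma poly_op_linear_factor:
  assumes T: "lin T"
  shows "poly_op T ([:- l, 1:] * q) v = poly_op T q (T v - l *s v)"
proof -
  let ?N = "Polynomial.degree q" and ?c = "Polynomial.coeff q"
  have eq: "[:- l, 1:] * q = pCons 0 q - Polynomial.smult l q" by simp
  have deg: "Polynomial.degree ([:- l, 1:] * q) \<le> Suc ?N"
    using degree_mult_le[of "[:- l, 1:]" q] by simp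
  have "poly_op T ([:- l, 1:] * q) v =
      (\<Sum>i\<le>Suc ?N. (Polynomial.coeff (pCons 0 q) i - l * ?c i) *s (T ^^ i) v)"
    by (subst poly_op_bound[OF deg], unfold eq) simp
  also have "\<dots> = (\<Sum>i\<le>Suc ?N. Polynomial.coeff (pCons 0 q) i *s (T ^^ i) v)
      - (\<Sum>i\<le>Suc ?N. (l * ?c i) *s (T ^^ i) v)"
    by (simp only: scale_left_diff_distrib sum_subtractf)
  also have "(\<Sum>i\<le>Suc ?N. Polynomial.coeff (pCons 0 q) i *s (T ^^ i) v)
      = (\<Sum>i\<le>?N. ?c i *s (T ^^ i) (T v))"
    by (subst sum.atMost_Suc_shift) (simp add: funpow_swap1)
  also have "(\<Sum>i\<le>Suc ?N. (l * ?c i) *s (T ^^ i) v) = (\<Sum>i\<le>?N. ?c i *s (T ^^ i) (l *s v))"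
    by (simp add: Polynomial.coeff_eq_0 lin_scale[OF lin_funpow[OF T]] mult.commute)
  finally show ?thesis
    by (simp add: poly_op_def lin_diff[OF lin_funpow[OF T]] scale_right_diff_distrib sum_subtractf)
qed

lemma annihilating_poly_exists:
  assumes B: "finite B" and T: "T ` span B \<subseteq> span B" and v: "v \<in> span B"
  obtains p where "p \<noteq> 0" "poly_op T p v = 0"
proof -
  define n where "n = card B"
  define w where "w i = (T ^^ i) v" for i
  have w: "w i \<in> span B" for i
    unfolding w_def by (induction i) (use v T in auto)
  obtain c where c: "\<exists>i\<le>n. c i \<noteq> 0" "(\<Sum>i\<le>n. c i *s w i) = 0"
  \<comment> \<open>If two iterates coincide, the set of iterates is too small for the dimension
    count; the relation is then the difference of the two.\<close>
  proof (cases "inj_on w {..n}")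
    case True
    then have "card (w ` {..n}) = Suc n" by (simp add: card_image)
    then have "\<not> independent (w ` {..n})"
      using independent_span_bound[OF B, of "w ` {..n}"] w n_def by auto
    then obtain u x where u: "x \<in> w ` {..n}" "u x \<noteq> 0" "(\<Sum>x\<in>w ` {..n}. u x *s x) = 0"
      using dependent_finite[of "w ` {..n}"] by auto
    show thesis
      using that[of "\<lambda>i. u (w i)"] u by (auto simp: sum.reindex[OF True])
  next
    case False
    then obtain i j where ij: "i \<le> n" "j \<le> n" "i \<noteq> j" "w i = w j" by (auto simp: inj_on_def)
    let ?c = "\<lambda>k. (if k = i then 1 else 0) - (if k = j then 1 else 0)"
    have "(\<Sum>k\<le>n. ?c k *s w k) = (\<Sum>k\<le>n. if k = i then w k else 0) - (\<Sum>k\<le>n. if k = j then w k else 0)"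
      unfolding sum_subtractf[symmetric] by (rule sum.cong) (auto simp: scale_left_diff_distrib)
    also have "\<dots> = 0" using ij by simp
    finally show thesis using that[of ?c] ij by force
  qed
  define p where "p = (\<Sum>i\<le>n. Polynomial.monom (c i) i)"
  have coeff: "Polynomial.coeff p i = (if i \<le> n then c i else 0)" for i
    by (auto simp: p_def Polynomial.coeff_sum)
  have deg: "Polynomial.degree p \<le> n" by (rule Polynomial.degree_le) (simp add: coeff)
  show thesis
  proof
    show "p \<noteq> 0" using c(1) coeff by (metis Polynomial.coeff_0)
    show "poly_op T p v = 0"
      by (simp add: poly_op_bound[OF deg] coeff c(2) w_def[symmetric])
  qed
qed

text \<open>An eigenvector in the quotient of \<open>S\<close> by \<open>W\<close>, found without
  forming the quotient: roots are peeled off \<open>p\<close> one at a time, replacing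
  \<open>v\<close> by \<open>T v - l *s v\<close>, until that vector first lands in
  \<open>W\<close>.\<close>

lemma eigenvector_modulo:
  assumes T: "lin T" "T ` S \<subseteq> S" and S: "subspace S" and W: "subspace W"
    and "p \<noteq> 0" "poly_op T p v \<in> W" "v \<in> S" "v \<notin> W"
  shows "\<exists>u\<in>S. \<exists>l. u \<notin> W \<and> T u - l *s u \<in> W"
  using assms(5-8)
proof (induction "Polynomial.degree p" arbitrary: p v)
  case 0
  then obtain c where "p = [:c:]" "c \<noteq> 0"
    by (metis Polynomial.degree_eq_zeroE Polynomial.pCons_0_0)
  then have "c *s v \<in> W" using 0 by (simp add: poly_op_def)
  then have "inverse c *s c *s v \<in> W" by (rule subspace_scale[OF W])
  then show ?case using \<open>c \<noteq> 0\<close> 0 by simp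
next
  case (Suc n)
  obtain l where "poly p l = 0" using alg_closed_imp_poly_has_root[of p] Suc.hyps(2) by auto
  then obtain q where q: "p = [:- l, 1:] * q" using poly_eq_0_iff_dvd by blast
  show ?case
  proof (cases "T v - l *s v \<in> W")
    case True then show ?thesis using Suc.prems by blast
  next
    case False
    have "q \<noteq> 0" using q Suc.prems by auto
    moreover from this have "Polynomial.degree q = n"
      using Suc.hyps(2) q by (simp add: Polynomial.degree_mult_eq del: mult_pCons_left)
    moreover have "poly_op T q (T v - l *s v) \<in> W"
      using Suc.prems(2) poly_op_linear_factor[OF T(1)] q by simp
    moreover have "T v - l *s v \<in> S"
      using Suc.prems(3) T(2) S by (auto intro!: subspace_diff subspace_scale)
    ultimately show ?thesis using Suc.hyps(1) False by blast
  qed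
qed

end

section \<open>Decomposition of a space into generalized eigenspaces of an operator\<close>

locale operator_on_subspace = vspace_alg_closed scale
  for scale :: "'a::{alg_closed_field,field_char_0} \<Rightarrow> 'b::ab_group_add \<Rightarrow> 'b" (infixr \<open>*s\<close> 75) +
  fixes T :: "'b \<Rightarrow> 'b" and B :: "'b set"
  assumes T: "lin T" "T ` span B \<subseteq> span B" and B: "finite B" "independent B"
begin

definition shift :: "'a \<Rightarrow> 'b \<Rightarrow> 'b" where
  "shift l = (\<lambda>x. T x - l *s x)"

definition gen_eigenspace :: "'a \<Rightarrow> 'b set" where
  "gen_eigenspace l = {v \<in> span B. \<exists>n. (shift l ^^ n) v = 0}"

lemma lin_shift: "lin (shift l)"
  unfolding shift_def by (intro lin_minus T lin_smult lin_id)

lemma shift_stable: "x \<in> span B \<Longrightarrow> shift l x \<in> span B"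
  using T by (auto simp: shift_def intro!: span_diff span_scale)

lemma shift_commute: "shift l (shift m x) = shift m (shift l x)"
  by (simp add: shift_def lin_diff[OF T(1)] lin_scale[OF T(1)] algebra_simps)

lemma shift_funpow_commute: "(shift l ^^ n) (shift m x) = shift m ((shift l ^^ n) x)"
  by (induction n) (simp_all add: shift_commute)

lemma funpow_zero_mono: "lin f \<Longrightarrow> (f ^^ n) v = 0 \<Longrightarrow> n \<le> m \<Longrightarrow> (f ^^ m) v = 0"
  by (metis comp_apply funpow_add le_Suc_ex add.commute lin_zero lin_funpow)

lemma subspace_gen_eigenspace: "subspace (gen_eigenspace l)"
proof (rule subspaceI)
  show "0 \<in> gen_eigenspace l"
    by (auto simp: gen_eigenspace_def span_zero intro: exI[of _ 0])
next
  fix x y assume "x \<in> gen_eigenspace l" "y \<in> gen_eigenspace l"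
  then obtain m n where *: "(shift l ^^ m) x = 0" "(shift l ^^ n) y = 0" "x \<in> span B" "y \<in> span B"
    by (auto simp: gen_eigenspace_def)
  then have "(shift l ^^ max m n) (x + y) = 0"
    using funpow_zero_mono[OF lin_shift]
    by (simp add: lin_add[OF lin_funpow[OF lin_shift]])
  then show "x + y \<in> gen_eigenspace l"
    using * by (auto simp: gen_eigenspace_def span_add)
next
  fix c x assume "x \<in> gen_eigenspace l"
  then show "c *s x \<in> gen_eigenspace l"
    by (auto simp: gen_eigenspace_def span_scale lin_scale[OF lin_funpow[OF lin_shift]])
qed

lemma shift_gen_eigenspace: "x \<in> gen_eigenspace l \<Longrightarrow> shift m x \<in> gen_eigenspace l"
  by (auto simp: gen_eigenspace_def shift_stable shift_funpow_commute)
    (metis lin_zero[OF lin_shift])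

lemma gen_eigenspaceI:
  assumes "shift l x \<in> gen_eigenspace l" "x \<in> span B"
  shows "x \<in> gen_eigenspace l"
proof -
  obtain n where "(shift l ^^ n) (shift l x) = 0" using assms by (auto simp: gen_eigenspace_def)
  then have "(shift l ^^ Suc n) x = 0" by (simp add: shift_funpow_commute)
  then show ?thesis using assms by (auto simp: gen_eigenspace_def simp del: funpow.simps)
qed

lemma shift_injective:
  assumes "x \<in> gen_eigenspace l" "shift m x = 0" "m \<noteq> l"
  shows "x = 0"
proof -
  obtain n where n: "(shift l ^^ n) x = 0" using assms by (auto simp: gen_eigenspace_def)
  have "shift l x = (m - l) *s x"
    using assms(2) by (simp add: shift_def algebra_simps)
  then have "(shift l ^^ k) x = (m - l) ^ k *s x" for k
    by (induction k) (simp_all add: lin_scale[OF lin_shift] mult.commute)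
  with n assms(3) show ?thesis by simp
qed

lemma shift_funpow_injective:
  assumes "x \<in> gen_eigenspace l" "(shift m ^^ n) x = 0" "m \<noteq> l"
  shows "x = 0"
  using assms(1,2)
proof (induction n)
  case (Suc n)
  have "(shift m ^^ n) x \<in> gen_eigenspace l"
    using Suc.prems(1) by (induction n) (auto simp: shift_gen_eigenspace)
  then show ?case using Suc shift_injective assms(3) by auto
qed simp

text \<open>On this space \<open>shift m\<close> is the nonzero scalar \<open>l - m\<close> plus the
  nilpotent \<open>shift l\<close>. The induction solves \<open>shift m y = shift l x\<close>, since
  \<open>shift l x\<close> dies one step earlier than \<open>x\<close>; a multiple of
  \<open>x - y\<close> is then mapped to \<open>x\<close>.\<close>

lemma shift_surjective:
  assumes "x \<in> gen_eigenspace l" "m \<noteq> l"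
  shows "\<exists>y\<in>gen_eigenspace l. shift m y = x"
proof -
  obtain n where "(shift l ^^ n) x = 0" using assms by (auto simp: gen_eigenspace_def)
  with assms(1) show ?thesis
  proof (induction n arbitrary: x)
    case 0
    then have "x = 0" by simp
    then show ?case
      using subspace_0[OF subspace_gen_eigenspace] lin_zero[OF lin_shift] by blast
  next
    case (Suc n)
    define c where "c = inverse (l - m)"
    have c: "c * (l - m) = 1" using assms(2) by (simp add: c_def)
    have "(shift l ^^ n) (shift l x) = 0" using Suc.prems(2) by (simp add: shift_funpow_commute)
    then obtain y where y: "y \<in> gen_eigenspace l" "shift m y = shift l x"
      using Suc.IH shift_gen_eigenspace Suc.prems(1) by blast
    have "shift m (c *s (x - y)) = c *s (shift m x - shift l x)"
      by (simp add: lin_scale[OF lin_shift] lin_diff[OF lin_shift] y)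
    also have "\<dots> = (c * (l - m)) *s x"
      by (simp add: shift_def algebra_simps)
    finally have "shift m (c *s (x - y)) = x" using c by simp
    moreover have "c *s (x - y) \<in> gen_eigenspace l"
      using subspace_scale[OF subspace_gen_eigenspace] subspace_diff[OF subspace_gen_eigenspace]
        y(1) Suc.prems(1) by blast
    ultimately show ?case by blast
  qed
qed

text \<open>A power of \<open>shift m\<close> kills the summand for \<open>m\<close> and is
  injective on every other generalized eigenspace, so one summand is removed at a time.\<close>

lemma gen_eigenspace_independent:
  assumes "finite F" "\<And>l. l \<in> F \<Longrightarrow> v l \<in> gen_eigenspace l" "(\<Sum>l\<in>F. v l) = 0" "l \<in> F"
  shows "v l = 0"
  using assms
proof (induction F arbitrary: v l rule: finite_induct)
  case (insert m F)
  obtain n where n: "(shift m ^^ n) (v m) = 0" using insert.prems(1)[of m] by (auto simp: gen_eigenspace_def)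
  have "(shift m ^^ n) (v m + (\<Sum>l\<in>F. v l)) = 0"
    using insert by (simp add: lin_zero[OF lin_funpow[OF lin_shift]])
  then have sum: "(\<Sum>l\<in>F. (shift m ^^ n) (v l)) = 0"
    by (simp add: lin_add[OF lin_funpow[OF lin_shift]] n lin_sum[OF lin_funpow[OF lin_shift]])
  have mem: "(shift m ^^ n) (v l) \<in> gen_eigenspace l" if "l \<in> F" for l
  proof (induction n)
    case 0 show ?case using insert.prems(1) that by simp
  qed (auto simp: shift_gen_eigenspace)
  have F: "v l = 0" if "l \<in> F" for l
    using insert.IH[OF mem sum that] shift_funpow_injective insert.prems(1) insert.hyps(2) that
    by blast
  then have "v m = 0" using insert by simp
  then show ?case using F insert.prems by auto
qed simp

text \<open>A vector outside the sum \<open>W\<close> would yield some \<open>u\<close> outside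
  \<open>W\<close> with \<open>shift l u\<close> in \<open>W\<close>. Subtracting a suitable element
  of \<open>W\<close> turns \<open>u\<close> into a generalized eigenvector, a
  contradiction.\<close>

lemma span_gen_eigenspaces: "span B = span (\<Union>l. gen_eigenspace l)"
proof (rule antisym)
  define W where "W = span (\<Union>l. gen_eigenspace l)"
  have W: "subspace W" by (simp add: W_def)
  have WE: "x \<in> W" if "x \<in> gen_eigenspace l" for x l
    using that unfolding W_def by (intro span_base) blast
  show "span (\<Union>l. gen_eigenspace l) \<subseteq> span B"
    by (rule span_minimal) (auto simp: gen_eigenspace_def)
  then have WB: "W \<subseteq> span B" by (simp add: W_def)
  \<comment> \<open>Modulo \<open>gen_eigenspace l\<close> the operator \<open>shift l\<close> maps
    onto \<open>W\<close>: it is invertible on the other eigenspaces, and \<open>y = 0\<close>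
    serves for its own.\<close>
  have solve: "\<exists>y\<in>W. x - shift l y \<in> gen_eigenspace l" if "x \<in> W" for x l
    using that unfolding W_def
  proof (induction rule: span_induct)
    case base
    let ?P = "{x. \<exists>y\<in>span (\<Union>l. gen_eigenspace l). x - shift l y \<in> gen_eigenspace l}"
    show ?case
    proof (rule subspaceI)
      show "0 \<in> ?P"
        using subspace_0[OF subspace_gen_eigenspace] span_zero lin_zero[OF lin_shift]
        by (auto intro!: bexI[of _ 0])
    next
      fix x y assume "x \<in> ?P" "y \<in> ?P"
      then obtain x' y' where *: "x' \<in> W" "y' \<in> W" "x - shift l x' \<in> gen_eigenspace l"
        "y - shift l y' \<in> gen_eigenspace l" by (auto simp: W_def)
      then have "x' + y' \<in> W" "x + y - shift l (x' + y') \<in> gen_eigenspace l"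
        using subspace_add[OF W] subspace_add[OF subspace_gen_eigenspace *(3,4)]
        by (auto simp: lin_add[OF lin_shift] algebra_simps)
      then show "x + y \<in> ?P" by (auto simp: W_def)
    next
      fix c x assume "x \<in> ?P"
      then obtain x' where *: "x' \<in> W" "x - shift l x' \<in> gen_eigenspace l" by (auto simp: W_def)
      then have "c *s x' \<in> W" "c *s x - shift l (c *s x') \<in> gen_eigenspace l"
        using subspace_scale[OF W] subspace_scale[OF subspace_gen_eigenspace *(2)]
        by (auto simp: lin_scale[OF lin_shift] scale_right_diff_distrib)
      then show "c *s x \<in> ?P" by (auto simp: W_def)
    qed
  next
    case (step x)
    then obtain m where m: "x \<in> gen_eigenspace m" by blast
    show ?case
    proof (cases "m = l")
      case True
      then show ?thesis using m span_zero lin_zero[OF lin_shift] by (auto intro!: bexI[of _ 0])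
    next
      case False
      then obtain y where "y \<in> gen_eigenspace m" "shift l y = x"
        using shift_surjective[OF m, of l] by auto
      then show ?thesis
        using WE subspace_0[OF subspace_gen_eigenspace] by (auto simp: W_def intro!: bexI[of _ y])
    qed
  qed
  show "span B \<subseteq> span (\<Union>l. gen_eigenspace l)"
  proof (rule ccontr)
    assume "\<not> span B \<subseteq> span (\<Union>l. gen_eigenspace l)"
    then obtain v where v: "v \<in> span B" "v \<notin> W" by (auto simp: W_def)
    obtain p where p: "p \<noteq> 0" "poly_op T p v = 0" using annihilating_poly_exists[OF B(1) T(2) v(1)] .
    have "poly_op T p v \<in> W" by (subst p(2)) (rule subspace_0[OF W])
    then have "\<exists>u\<in>span B. \<exists>l. u \<notin> W \<and> T u - l *s u \<in> W"
      by (rule eigenvector_modulo[OF T subspace_span W p(1) _ v])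
    then obtain u l where u: "u \<in> span B" "u \<notin> W" "shift l u \<in> W"
      unfolding shift_def by blast
    obtain y where y: "y \<in> W" "shift l u - shift l y \<in> gen_eigenspace l" using solve[OF u(3)] by blast
    then have "u - y \<in> span B" using span_diff[OF u(1)] WB by blast
    then have "u - y \<in> gen_eigenspace l"
      using y(2) by (rule_tac gen_eigenspaceI) (simp_all add: lin_diff[OF lin_shift])
    then have "y + (u - y) \<in> W" using WE y subspace_add[OF W] by blast
    with u(2) show False by simp
  qed
qed

text \<open>\<open>shift (l + m)\<close> obeys the Leibniz rule with \<open>shift l\<close> on the
  left factor and \<open>shift m\<close> on the right, so the induction runs over the sum of the two
  nilpotency orders.\<close>

lemma gen_eigenspace_bracket:
  assumes bil: "\<And>x. lin (br x)" "\<And>y. lin (\<lambda>x. br x y)"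
    and closed: "\<And>v w. v \<in> span B \<Longrightarrow> w \<in> span B \<Longrightarrow> br v w \<in> span B"
    and der: "\<And>v w. v \<in> span B \<Longrightarrow> w \<in> span B \<Longrightarrow> T (br v w) = br (T v) w + br v (T w)"
    and v: "v \<in> gen_eigenspace l" and w: "w \<in> gen_eigenspace m"
  shows "br v w \<in> gen_eigenspace (l + m)"
proof -
  have *: "(shift (l + m) ^^ k) (br v w) = 0"
    if "(shift l ^^ a) v = 0" "(shift m ^^ b) w = 0" "a + b = k" "v \<in> span B" "w \<in> span B"
    for a b k v w
    using that
  proof (induction k arbitrary: a b v w)
    case 0 then show ?case by (simp add: lin_zero[OF bil(1)])
  next
    case (Suc k)
    show ?case
    proof (cases "a = 0 \<or> b = 0")
      case True
      then have "br v w = 0" using Suc.prems by (auto simp: lin_zero[OF bil(1)] lin_zero[OF bil(2)])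
      then show ?thesis using lin_zero[OF lin_funpow[OF lin_shift]] by metis
    next
      case False
      then obtain a' b' where ab: "a = Suc a'" "b = Suc b'" by (meson not0_implies_Suc)
      have 1: "(shift (l + m) ^^ k) (br (shift l v) w) = 0"
        by (rule Suc.IH[of a' _ b]) (use Suc.prems ab shift_stable in \<open>auto simp: shift_funpow_commute\<close>)
      have 2: "(shift (l + m) ^^ k) (br v (shift m w)) = 0"
        by (rule Suc.IH[of a _ b']) (use Suc.prems ab shift_stable in \<open>auto simp: shift_funpow_commute\<close>)
      have "shift (l + m) (br v w) = br (shift l v) w + br v (shift m w)"
        using Suc.prems(4,5)
        by (simp add: shift_def der lin_diff[OF bil(1)] lin_diff[OF bil(2)] lin_scale[OF bil(1)]
            lin_scale[OF bil(2)] scale_left_distrib algebra_simps)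
      then have "(shift (l + m) ^^ Suc k) (br v w)
          = (shift (l + m) ^^ k) (br (shift l v) w + br v (shift m w))"
        by (simp add: funpow_Suc_right del: funpow.simps)
      also have "\<dots> = 0" by (simp add: lin_add[OF lin_funpow[OF lin_shift]] 1 2)
      finally show ?thesis .
    qed
  qed
  show ?thesis
    using v w closed * unfolding gen_eigenspace_def by blast
qed

text \<open>The derivation \<open>y\<close> acts on the generalized eigenspace of \<open>l\<close> by a scalar \<open>\<phi> l\<close>, where
  \<open>\<phi>\<close> is additive with rational values; if \<open>tr (T y)\<close> were zero, then applying \<open>\<phi>\<close> to
  \<open>tr (T y) = (\<Sum>l. dim l * l * \<phi> l)\<close> would make a sum of squares zero.\<close>

lemma derivation_with_nonzero_trace_exists:
  assumes bil: "\<And>x. lin (br x)" "\<And>y. lin (\<lambda>x. br x y)"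
    and closed: "\<And>v w. v \<in> span B \<Longrightarrow> w \<in> span B \<Longrightarrow> br v w \<in> span B"
    and der: "\<And>v w. v \<in> span B \<Longrightarrow> w \<in> span B \<Longrightarrow> T (br v w) = br (T v) w + br v (T w)"
    and nn: "\<not> (\<exists>n. \<forall>v\<in>span B. (T ^^ n) v = 0)"
  shows "\<exists>y. lin y \<and> y ` span B \<subseteq> span B \<and>
    (\<forall>v\<in>span B. \<forall>w\<in>span B. y (br v w) = br (y v) w + br v (y w)) \<and>
    trace_on B (\<lambda>x. T (y x)) \<noteq> 0"
proof -
  interpret p: vector_space_pair scale scale by unfold_locales
  obtain C where C: "C \<subseteq> (\<Union>l. gen_eigenspace l)" "independent C"
      "(\<Union>l. gen_eigenspace l) \<subseteq> span C"
    using maximal_independent_subset .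
  have spC: "span C = span B"
    unfolding span_gen_eigenspaces using C(1,3)
    by (simp add: span_minimal span_mono subset_antisym)
  have "C \<subseteq> span B" using spC span_superset by blast
  then have finC: "finite C" using independent_span_bound[OF B(1) C(2)] by simp
  have "\<exists>l. c \<in> gen_eigenspace l" if "c \<in> C" for c using C(1) that by blast
  then obtain lam where lam: "\<And>c. c \<in> C \<Longrightarrow> c \<in> gen_eigenspace (lam c)" by metis
  \<comment> \<open>If all eigenvalues were zero, one power of \<open>T\<close> would kill the whole
    finite basis \<open>C\<close>.\<close>
  have nz: "\<exists>c\<in>C. lam c \<noteq> 0"
  proof (rule ccontr)
    assume "\<not> (\<exists>c\<in>C. lam c \<noteq> 0)"
    then have "\<exists>n. (T ^^ n) c = 0" if "c \<in> C" for c
      using lam[OF that] that by (auto simp: gen_eigenspace_def shift_def)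
    then obtain n where n: "\<And>c. c \<in> C \<Longrightarrow> (T ^^ n c) c = 0" by metis
    define N where "N = Max (n ` C)"
    have "(T ^^ N) c = 0" if "c \<in> C" for c
      using funpow_zero_mono[OF T(1) n[OF that], of N] finC that by (simp add: N_def)
    then have "(T ^^ N) v = 0" if "v \<in> span C" for v
      using p.linear_eq_0_on_span[OF lin_funpow[OF T(1)] _ that] by blast
    then show False using nn spC by blast
  qed
  then obtain c0 where c0: "c0 \<in> C" "lam c0 \<noteq> 0" by blast
  obtain \<phi> :: "'a \<Rightarrow> rat" where \<phi>: "\<And>a b. \<phi> (a + b) = \<phi> a + \<phi> b"
      "\<And>q a. \<phi> (of_rat q * a) = q * \<phi> a" "\<phi> (lam c0) = 1"
    by (rule rational_functional_exists[OF c0(2)]) (rule that)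
  have diagonal: "\<exists>y. lin y \<and> y ` span B \<subseteq> span B \<and> (\<forall>l. \<forall>v\<in>gen_eigenspace l. y v = f l *s v)"
    for f
  proof -
    obtain y where y: "lin y" "\<And>c. c \<in> C \<Longrightarrow> y c = f (lam c) *s c"
      "range y = span ((\<lambda>c. f (lam c) *s c) ` C)"
      using p.linear_independent_extend_subspace[OF C(2), of "\<lambda>c. f (lam c) *s c"] by blast
    have "range y \<subseteq> span B"
      unfolding y(3) spC[symmetric] by (rule span_minimal) (auto intro: span_scale span_base)
    moreover have "y v = f l *s v" if v: "v \<in> gen_eigenspace l" for l v
    proof -
      have vC: "v \<in> span C" using v spC by (simp add: gen_eigenspace_def)
      define r where "r = representation C v"
      have rv: "(\<Sum>c\<in>C. r c *s c) = v" unfolding r_def by (rule sum_representation[OF finC C(2) vC])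
      define F where "F = insert l (lam ` C)"
      \<comment> \<open>\<open>g\<close> compares the expansion of \<open>v\<close>, grouped by
        eigenvalue, with \<open>v\<close> itself placed at \<open>l\<close>. Independence makes it
        vanish, so the basis vectors with eigenvalue \<open>l\<close> already account for
        \<open>v\<close>.\<close>
      define g where "g m = (\<Sum>c\<in>{c\<in>C. lam c = m}. r c *s c) - (if m = l then v else 0)" for m
      have "(\<Sum>m\<in>F. g m) = (\<Sum>m\<in>F. \<Sum>c\<in>{c\<in>C. lam c = m}. r c *s c) - v"
        using finC by (simp add: g_def sum_subtractf F_def)
      also have "(\<Sum>m\<in>F. \<Sum>c\<in>{c\<in>C. lam c = m}. r c *s c) = v"
        unfolding rv[symmetric] by (rule sum.group) (use finC F_def in auto)
      finally have sum: "(\<Sum>m\<in>F. g m) = 0" by simp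
      have "(\<Sum>c\<in>{c\<in>C. lam c = m}. r c *s c) \<in> gen_eigenspace m" for m
        by (intro subspace_sum subspace_gen_eigenspace subspace_scale) (use lam in auto)
      then have "g m \<in> gen_eigenspace m" for m
        using v by (auto simp: g_def intro!: subspace_diff subspace_gen_eigenspace subspace_0)
      then have "g l = 0"
        by (intro gen_eigenspace_independent[OF _ _ sum]) (use finC in \<open>auto simp: F_def\<close>)
      then have vl: "(\<Sum>c\<in>{c\<in>C. lam c = l}. r c *s c) = v" by (simp add: g_def)
      have "y (\<Sum>c\<in>{c\<in>C. lam c = l}. r c *s c) = (\<Sum>c\<in>{c\<in>C. lam c = l}. f l *s r c *s c)"
        unfolding lin_sum[OF y(1)] lin_scale[OF y(1)]
        by (rule sum.cong) (auto simp: y(2) mult.commute)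
      then show ?thesis by (simp only: scale_sum_right[symmetric] vl)
    qed
    ultimately show ?thesis using y(1) by blast
  qed
  obtain y where y: "lin y" "y ` span B \<subseteq> span B"
    and yE: "\<And>l v. v \<in> gen_eigenspace l \<Longrightarrow> y v = of_rat (\<phi> l) *s v"
    using diagonal[of "\<lambda>l. of_rat (\<phi> l)"] by blast
  obtain S where S: "lin S" "S ` span B \<subseteq> span B"
    and SE: "\<And>l v. v \<in> gen_eigenspace l \<Longrightarrow> S v = l *s v"
    using diagonal[of "\<lambda>l. l"] by blast
  have lin_combination_eq: "f v = g v" if "lin f" "lin g" "\<And>c. c \<in> C \<Longrightarrow> f c = g c" "v \<in> span B" for f g v
    using p.linear_eq_on_span[OF that(1,2), of C v] that(3,4) spC by blast
  have ybr: "y (br v w) = br (y v) w + br v (y w)" if "v \<in> span B" "w \<in> span B" for v w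
  proof -
    have C1: "y (br c d) = br (y c) d + br c (y d)" if "c \<in> C" "d \<in> C" for c d
      using yE[OF gen_eigenspace_bracket[OF bil closed der lam[OF that(1)] lam[OF that(2)]]]
        yE[OF lam[OF that(1)]] yE[OF lam[OF that(2)]] \<phi>(1)
      by (simp add: lin_scale[OF bil(1)] lin_scale[OF bil(2)] scale_left_distrib of_rat_add)
    have C2: "y (br c w) = br (y c) w + br c (y w)" if "c \<in> C" for c
      by (rule lin_combination_eq[OF _ _ C1[OF that] \<open>w \<in> span B\<close>])
        (intro lin_comp[OF y(1) bil(1)] lin_plus bil lin_comp[OF bil(1) y(1)])+
    show ?thesis
      by (rule lin_combination_eq[OF _ _ C2 \<open>v \<in> span B\<close>])
        (intro lin_comp[OF y(1) bil(2)] lin_plus bil lin_comp[OF bil(2) y(1)])+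
  qed
  \<comment> \<open>On the span, \<open>S\<close> and \<open>Z\<close> are the semisimple and
    nilpotent parts of \<open>T\<close>. Since \<open>y\<close> is a scalar on each generalized
    eigenspace, \<open>Z\<close> after \<open>y\<close> is nilpotent and contributes no
    trace.\<close>
  define Z where "Z = (\<lambda>x. T x - S x)"
  have Z: "lin Z" unfolding Z_def by (intro lin_minus T S)
  have Zst: "Z ` span B \<subseteq> span B" using T(2) S(2) by (auto simp: Z_def intro!: span_diff)
  have ZE: "Z v = shift l v" if "v \<in> gen_eigenspace l" for v l
    using SE[OF that] by (simp add: Z_def shift_def)
  have Zy: "lin (\<lambda>x. Z (y x))" "(\<lambda>x. Z (y x)) ` span B \<subseteq> span B"
    using lin_comp[OF Z y(1)] Zst y(2) by auto
  have Sy: "lin (\<lambda>x. S (y x))" "(\<lambda>x. S (y x)) ` span B \<subseteq> span B"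
    using lin_comp[OF S(1) y(1)] S(2) y(2) by auto
  have nilZ: "\<exists>n. \<forall>x\<in>span B. ((\<lambda>x. Z (y x)) ^^ n) x = 0"
  proof -
    have "\<exists>n. ((\<lambda>x. Z (y x)) ^^ n) c = 0" if c: "c \<in> C" for c
    proof -
      let ?l = "lam c"
      obtain n where n: "(shift ?l ^^ n) c = 0" using lam[OF c] by (auto simp: gen_eigenspace_def)
      have E: "(shift ?l ^^ k) c \<in> gen_eigenspace ?l" for k
        by (induction k) (auto simp: shift_gen_eigenspace lam c)
      have "((\<lambda>x. Z (y x)) ^^ k) c = of_rat (\<phi> ?l) ^ k *s (shift ?l ^^ k) c" for k
      proof (induction k)
        case (Suc k)
        then show ?case
          using yE[OF E[of k]] ZE[OF E[of k]]
          by (simp add: lin_scale[OF Z] lin_scale[OF y(1)] mult.commute)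
      qed simp
      with n show ?thesis by (intro exI[of _ n]) simp
    qed
    then obtain n where n: "\<And>c. c \<in> C \<Longrightarrow> ((\<lambda>x. Z (y x)) ^^ n c) c = 0" by metis
    define N where "N = Max (n ` C)"
    have "((\<lambda>x. Z (y x)) ^^ N) c = 0" if "c \<in> C" for c
      using funpow_zero_mono[OF Zy(1) n[OF that], of N] finC that by (simp add: N_def)
    then have "((\<lambda>x. Z (y x)) ^^ N) v = 0" if "v \<in> span C" for v
      using p.linear_eq_0_on_span[OF lin_funpow[OF Zy(1)] _ that] by blast
    then show ?thesis using spC by auto
  qed
  have "trace_on B (\<lambda>x. T (y x)) = trace_on B (\<lambda>x. S (y x) + Z (y x))"
    by (simp add: Z_def)
  also have "\<dots> = trace_on B (\<lambda>x. S (y x))"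
    using trace_on_add[OF B Sy(2) Zy(2)] nilZ trace_on_nilpotent[OF B Zy] by auto
  also have "\<dots> = trace_on C (\<lambda>x. S (y x))"
    by (rule trace_on_basis_change[OF B finC C(2) spC[symmetric] Sy])
  also have "\<dots> = (\<Sum>c\<in>C. of_rat (\<phi> (lam c)) * lam c)"
    unfolding trace_on_def
    by (rule sum.cong) (auto simp: yE[OF lam] SE[OF lam] lin_scale[OF S(1)] representation_scale
        representation_basis C(2) span_base span_scale)
  finally have tr: "trace_on B (\<lambda>x. T (y x)) = (\<Sum>c\<in>C. of_rat (\<phi> (lam c)) * lam c)" .
  have "trace_on B (\<lambda>x. T (y x)) \<noteq> 0"
  proof
    assume "trace_on B (\<lambda>x. T (y x)) = 0"
    then have "\<phi> (\<Sum>c\<in>C. of_rat (\<phi> (lam c)) * lam c) = \<phi> 0" using tr by simp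
    moreover have "\<phi> 0 = 0" using \<phi>(1)[of 0 0] by simp
    moreover have "\<phi> (sum h A) = (\<Sum>c\<in>A. \<phi> (h c))" if "finite A" for h and A :: "'b set"
      using that by (induction A rule: finite_induct) (auto simp: \<phi>(1) \<open>\<phi> 0 = 0\<close>)
    ultimately have "(\<Sum>c\<in>C. \<phi> (lam c) * \<phi> (lam c)) = 0" using finC by (simp add: \<phi>(2))
    then have "\<phi> (lam c0) * \<phi> (lam c0) = 0"
      using finC c0(1) by (subst (asm) sum_nonneg_eq_0_iff) auto
    with \<phi>(3) show False by simp
  qed
  with y ybr show ?thesis by blast
qed

end

section \<open>The radical of the trace form\<close>

locale fd_lie = finite_dimensional_lie_algebra scale bracket Basis + vspace scale
  for scale :: "'k::field_char_0 \<Rightarrow> 'g::ab_group_add \<Rightarrow> 'g" (infixr \<open>*s\<close> 75)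
    and bracket :: "'g \<Rightarrow> 'g \<Rightarrow> 'g" and Basis :: "'g set"
begin

lemmas bracket_lin = linear_bracket_right linear_bracket_left

lemma bracket_add_right: "bracket x (y + z) = bracket x y + bracket x z"
  and bracket_add_left: "bracket (x + y) z = bracket x z + bracket y z"
  and bracket_scale_right: "bracket x (c *s y) = c *s bracket x y"
  and bracket_scale_left: "bracket (c *s x) y = c *s bracket x y"
  and bracket_diff_right: "bracket x (y - z) = bracket x y - bracket x z"
  and bracket_diff_left: "bracket (x - y) z = bracket x z - bracket y z"
  and bracket_zero_right: "bracket x 0 = 0"
  and bracket_zero_left: "bracket 0 y = 0"
  and bracket_sum_right: "bracket x (sum f A) = (\<Sum>a\<in>A. bracket x (f a))"
  and bracket_sum_left: "bracket (sum f A) y = (\<Sum>a\<in>A. bracket (f a) y)"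
  by (rule lin_add[OF bracket_lin(1)], rule lin_add[OF bracket_lin(2)], rule lin_scale[OF bracket_lin(1)], rule lin_scale[OF bracket_lin(2)], rule lin_diff[OF bracket_lin(1)], rule lin_diff[OF bracket_lin(2)], rule lin_zero[OF bracket_lin(1)], rule lin_zero[OF bracket_lin(2)], rule lin_sum[OF bracket_lin(1)], rule lin_sum[OF bracket_lin(2)])

lemmas bracket_simps = bracket_add_right bracket_add_left bracket_scale_right bracket_scale_left
  bracket_diff_right bracket_diff_left bracket_zero_right bracket_zero_left

abbreviation tr :: "('g \<Rightarrow> 'g) \<Rightarrow> 'k" where "tr \<equiv> trace_on Basis"

lemma tr_commute: "lin f \<Longrightarrow> lin g \<Longrightarrow> tr (\<lambda>x. f (g x)) = tr (\<lambda>x. g (f x))"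
  by (rule trace_on_commute[OF finite_Basis independent_Basis]) (auto simp: span_Basis)

lemma tr_add: "tr (\<lambda>x. f x + g x) = tr f + tr g"
  by (rule trace_on_add[OF finite_Basis independent_Basis]) (auto simp: span_Basis)

lemma tr_scale: "tr (\<lambda>x. c *s f x) = c * tr f"
  by (rule trace_on_scale[OF finite_Basis independent_Basis]) (auto simp: span_Basis)

lemma tr_diff: "tr (\<lambda>x. f x - g x) = tr f - tr g"
  using tr_add[of f "\<lambda>x. (- 1) *s g x"] tr_scale[of "- 1" g] by simp

lemma tr_nilpotent: "lin f \<Longrightarrow> (\<And>x. (f ^^ n) x = 0) \<Longrightarrow> tr f = 0"
  by (rule trace_on_nilpotent[OF finite_Basis independent_Basis]) (auto simp: span_Basis)

lemma sum_coordinates: "(\<Sum>b\<in>Basis. representation Basis v b *s b) = v"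
  by (rule sum_representation[OF finite_Basis independent_Basis]) (simp add: span_Basis)

lemma derivation_lin: "x \<in> derivations \<Longrightarrow> lin x"
  and derivation_bracket: "x \<in> derivations \<Longrightarrow> x (bracket v w) = bracket (x v) w + bracket v (x w)"
  by (auto simp: derivations_def)

definition trace_radical :: "('g \<Rightarrow> 'g) set" where
  "trace_radical = {x \<in> derivations. \<forall>y\<in>derivations. tr (\<lambda>v. x (y v)) = 0}"

text \<open>The base change of \<open>'g\<close> to an algebraic closure is the space of functions supported on
  \<open>Basis\<close>. A linear functional \<open>\<chi>\<close> from the closure to \<open>'k\<close> turns derivations of the base
  change into derivations of \<open>'g\<close>.\<close>

definition embed :: "'g \<Rightarrow> 'g \<Rightarrow> 'k alg_closure" where
  "embed v = (\<lambda>d. to_ac (representation Basis v d))"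

definition extend_map :: "('g \<Rightarrow> 'g) \<Rightarrow> ('g \<Rightarrow> 'k alg_closure) \<Rightarrow> 'g \<Rightarrow> 'k alg_closure" where
  "extend_map f u = (\<lambda>d. \<Sum>b\<in>Basis. u b * embed (f b) d)"

definition extend_bracket ::
    "('g \<Rightarrow> 'k alg_closure) \<Rightarrow> ('g \<Rightarrow> 'k alg_closure) \<Rightarrow> 'g \<Rightarrow> 'k alg_closure" where
  "extend_bracket u w = (\<lambda>d. \<Sum>b\<in>Basis. \<Sum>c\<in>Basis. u b * w c * embed (bracket b c) d)"

definition point :: "'g \<Rightarrow> 'g \<Rightarrow> 'k alg_closure" where
  "point b = (\<lambda>d. if d = b then 1 else 0)"

lemma embed_add: "embed (v + w) = (\<lambda>d. embed v d + embed w d)"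
  by (simp add: embed_def representation_add independent_Basis span_Basis)

lemma embed_scale: "embed (c *s v) = (\<lambda>d. to_ac c * embed v d)"
  by (simp add: embed_def representation_scale independent_Basis span_Basis)

lemma embed_zero: "embed 0 = (\<lambda>d. 0)"
  by (simp add: embed_def representation_zero)

lemma embed_sum: "embed (sum f A) d = (\<Sum>a\<in>A. embed (f a) d)"
  by (induction A rule: infinite_finite_induct) (simp_all add: embed_add embed_zero)

lemma embed_Basis: "b \<in> Basis \<Longrightarrow> embed b = point b"
  by (auto simp: embed_def point_def representation_basis independent_Basis)

lemma embed_outside: "d \<notin> Basis \<Longrightarrow> embed v d = 0"
  using representation_ne_zero[of Basis v d] by (auto simp: embed_def)

lemma embed_inj: "embed v = embed w \<Longrightarrow> v = w"
proof -
  assume "embed v = embed w"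
  then have "representation Basis v = representation Basis w" by (simp add: embed_def fun_eq_iff)
  then show ?thesis by (metis sum_coordinates)
qed

lemma extend_map_embed: "lin f \<Longrightarrow> extend_map f (embed v) = embed (f v)"
proof
  fix d assume f: "lin f"
  have "embed (f v) d = embed (f (\<Sum>b\<in>Basis. representation Basis v b *s b)) d"
    by (simp add: sum_coordinates)
  also have "\<dots> = extend_map f (embed v) d"
    by (simp add: lin_sum[OF f] lin_scale[OF f] embed_sum embed_scale extend_map_def embed_def[of v])
  finally show "extend_map f (embed v) d = embed (f v) d" by simp
qed

lemma extend_bracket_embed: "extend_bracket (embed v) (embed w) = embed (bracket v w)"
proof
  fix d
  have "embed (bracket v w) d = embed (bracket (\<Sum>b\<in>Basis. representation Basis v b *s b)
      (\<Sum>c\<in>Basis. representation Basis w c *s c)) d"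
    by (simp add: sum_coordinates)
  also have "\<dots> = extend_bracket (embed v) (embed w) d"
    unfolding bracket_sum_left bracket_scale_left bracket_sum_right bracket_scale_right
    by (simp add: embed_sum embed_scale extend_bracket_def embed_def[of v] embed_def[of w]
        sum_distrib_left mult.assoc mult.left_commute) (rule sum.swap)
  finally show "extend_bracket (embed v) (embed w) d = embed (bracket v w) d" by simp
qed

sublocale K: vspace_alg_closed "\<lambda>(c::'k alg_closure) (u::'g \<Rightarrow> 'k alg_closure) d. c * u d"
  by unfold_locales (simp_all add: fun_eq_iff algebra_simps)

lemma sum_fun_apply: "(\<Sum>a\<in>A. f a) d = (\<Sum>a\<in>A. f a d)"
  for f :: "'x \<Rightarrow> 'y \<Rightarrow> 'z::comm_monoid_add"
  by (induction A rule: infinite_finite_induct) simp_all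

lemma eq_sum_points:
  fixes u :: "'g \<Rightarrow> 'k alg_closure"
  assumes "\<And>d. d \<notin> Basis \<Longrightarrow> u d = 0"
  shows "u = (\<Sum>b\<in>Basis. (\<lambda>d. u b * point b d))"
proof
  fix d
  have "(\<Sum>b\<in>Basis. u b * point b d) = (\<Sum>b\<in>Basis. if d = b then u b else 0)"
    by (rule sum.cong) (auto simp: point_def)
  also have "\<dots> = u d" using finite_Basis assms by auto
  finally show "u d = (\<Sum>b\<in>Basis. (\<lambda>d. u b * point b d)) d" by (simp add: sum_fun_apply)
qed

text \<open>The space of all functions is larger than the base change; this identifies the subspace
  on which the extended operators are studied.\<close>

lemma span_points: "K.span (point ` Basis) = {u. \<forall>d. d \<notin> Basis \<longrightarrow> u d = 0}"
proof
  show "K.span (point ` Basis) \<subseteq> {u. \<forall>d. d \<notin> Basis \<longrightarrow> u d = 0}"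
    by (rule K.span_minimal) (auto simp: point_def intro!: K.subspaceI)
  show "{u. \<forall>d. d \<notin> Basis \<longrightarrow> u d = 0} \<subseteq> K.span (point ` Basis)"
  proof
    fix u :: "'g \<Rightarrow> 'k alg_closure"
    assume "u \<in> {u. \<forall>d. d \<notin> Basis \<longrightarrow> u d = 0}"
    then have "u = (\<Sum>b\<in>Basis. (\<lambda>d. u b * point b d))" by (intro eq_sum_points) simp
    moreover have "(\<Sum>b\<in>Basis. (\<lambda>d. u b * point b d)) \<in> K.span (point ` Basis)"
      by (intro K.span_sum K.span_scale K.span_base) simp
    ultimately show "u \<in> K.span (point ` Basis)" by (simp only:)
  qed
qed

lemma inj_point: "inj point"
  by (auto simp: inj_def point_def fun_eq_iff split: if_splits)

lemma sum_points:
  "u \<in> K.span (point ` Basis) \<Longrightarrow> u = (\<Sum>b\<in>Basis. (\<lambda>d. u b * point b d))"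
  by (rule eq_sum_points) (simp add: span_points)

lemma finite_points: "finite (point ` Basis)"
  using finite_Basis by simp

lemma independent_points: "K.independent (point ` Basis)"
proof (rule K.independent_if_scalars_zero[OF finite_points])
  fix f x assume *: "(\<Sum>x\<in>point ` Basis. (\<lambda>d. f x * x d)) = 0" "x \<in> point ` Basis"
  then obtain b where b: "b \<in> Basis" "x = point b" by blast
  have "(\<Sum>x\<in>point ` Basis. (\<lambda>d. f x * x d)) b = (\<Sum>c\<in>Basis. f (point c) * point c b)"
    by (simp add: sum_fun_apply sum.reindex[OF inj_on_subset[OF inj_point]])
  also have "\<dots> = (\<Sum>c\<in>Basis. if c = b then f (point c) else 0)"
    by (rule sum.cong) (auto simp: point_def)
  also have "\<dots> = f x" using b finite_Basis by simp
  finally show "f x = 0" using *(1) by simp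
qed

lemma representation_points:
  assumes "u \<in> K.span (point ` Basis)" "b \<in> Basis"
  shows "K.representation (point ` Basis) u (point b) = u b"
proof -
  have "K.representation (point ` Basis) u (point b) =
      K.representation (point ` Basis) (\<Sum>c\<in>Basis. (\<lambda>d. u c * point c d)) (point b)"
    using sum_points[OF assms(1)] by simp
  also have "\<dots> = (\<Sum>c\<in>Basis. u c * K.representation (point ` Basis) (point c) (point b))"
    by (rule K.representation_sum_scale[OF finite_points independent_points finite_Basis])
      (auto intro: K.span_base)
  also have "\<dots> = (\<Sum>c\<in>Basis. if c = b then u c else 0)"
    by (rule sum.cong)
      (auto simp: K.representation_basis[OF independent_points] inj_eq[OF inj_point])
  also have "\<dots> = u b" using assms(2) finite_Basis by simp
  finally show ?thesis .
qed

lemma lin_extend_map: "K.lin (extend_map f)"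
  by (rule K.linI) (simp_all add: extend_map_def fun_eq_iff algebra_simps sum.distrib sum_distrib_left)

lemma lin_extend_bracket: "K.lin (extend_bracket u)" "K.lin (\<lambda>u. extend_bracket u w)"
  by (rule K.linI; simp add: extend_bracket_def fun_eq_iff algebra_simps sum.distrib sum_distrib_left)+

lemma extend_map_mem: "extend_map f u \<in> K.span (point ` Basis)"
  by (auto simp: span_points extend_map_def embed_outside)

lemma extend_bracket_mem: "extend_bracket u w \<in> K.span (point ` Basis)"
  by (auto simp: span_points extend_bracket_def embed_outside)

lemma extend_map_derivation:
  assumes x: "x \<in> derivations"
    and v: "v \<in> K.span (point ` Basis)" and w: "w \<in> K.span (point ` Basis)"
  shows "extend_map x (extend_bracket v w) =
    extend_bracket (extend_map x v) w + extend_bracket v (extend_map x w)"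
proof -
  interpret p: vector_space_pair "\<lambda>(c::'k alg_closure) (u::'g \<Rightarrow> 'k alg_closure) d. c * u d"
    "\<lambda>(c::'k alg_closure) (u::'g \<Rightarrow> 'k alg_closure) d. c * u d"
    by unfold_locales
  have 1: "extend_map x (extend_bracket (point b) (point c)) =
      extend_bracket (extend_map x (point b)) (point c) + extend_bracket (point b) (extend_map x (point c))"
    if "b \<in> Basis" "c \<in> Basis" for b c
    unfolding embed_Basis[OF that(1), symmetric] embed_Basis[OF that(2), symmetric]
      extend_bracket_embed extend_map_embed[OF derivation_lin[OF x]] derivation_bracket[OF x]
    by (simp add: embed_add fun_eq_iff)
  have 2: "extend_map x (extend_bracket (point b) w) =
      extend_bracket (extend_map x (point b)) w + extend_bracket (point b) (extend_map x w)"
    if b: "b \<in> Basis" for b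
  proof (rule p.linear_eq_on_span[OF _ _ _ w])
    show "K.lin (\<lambda>w. extend_map x (extend_bracket (point b) w))"
      by (rule K.lin_comp[OF lin_extend_map lin_extend_bracket(1)])
    show "K.lin (\<lambda>w. extend_bracket (extend_map x (point b)) w + extend_bracket (point b) (extend_map x w))"
      by (rule K.lin_plus[OF lin_extend_bracket(1) K.lin_comp[OF lin_extend_bracket(1) lin_extend_map]])
  qed (use 1[OF b] in blast)
  show ?thesis
  proof (rule p.linear_eq_on_span[OF _ _ _ v])
    show "K.lin (\<lambda>v. extend_map x (extend_bracket v w))"
      by (rule K.lin_comp[OF lin_extend_map lin_extend_bracket(2)])
    show "K.lin (\<lambda>v. extend_bracket (extend_map x v) w + extend_bracket v (extend_map x w))"
      by (rule K.lin_plus[OF K.lin_comp[OF lin_extend_bracket(2) lin_extend_map] lin_extend_bracket(2)])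
  qed (use 2 in blast)
qed

lemma linear_functional_exists:
  fixes t :: "'k alg_closure"
  assumes "t \<noteq> 0"
  obtains \<chi> :: "'k alg_closure \<Rightarrow> 'k" where "\<And>a b. \<chi> (a + b) = \<chi> a + \<chi> b"
    "\<And>c a. \<chi> (to_ac c * a) = c * \<chi> a" "\<chi> t = 1"
proof -
  interpret Q: vector_space_pair "\<lambda>c (a::'k alg_closure). to_ac c * a" "(*) :: 'k \<Rightarrow> 'k \<Rightarrow> 'k"
    by unfold_locales (simp_all add: algebra_simps)
  have "Q.vs1.independent {t}"
    using assms by (simp add: Q.vs1.dependent_single)
  then obtain \<chi> where \<chi>: "Vector_Spaces.linear (\<lambda>c (a::'k alg_closure). to_ac c * a) (*) \<chi>" "\<chi> t = (1::'k)"
    using Q.linear_independent_extend[of "{t}" "\<lambda>_. 1"] by auto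
  show thesis
    using that[of \<chi>] \<chi> Q.linear_add[OF \<chi>(1)] Q.linear_scale[OF \<chi>(1)] by blast
qed

text \<open>If the base change of \<open>x\<close> were not nilpotent, some derivation
  \<open>y\<close> of the extended algebra would pair with it to a nonzero trace. A functional
  \<open>\<chi>\<close> with value 1 at this trace turns \<open>y\<close> into a derivation
  \<open>z\<close> of the original algebra whose pairing with \<open>x\<close> is 1.\<close>

lemma trace_radical_nilpotent:
  assumes x: "x \<in> trace_radical"
  shows "\<exists>n. \<forall>v. (x ^^ n) v = 0"
proof -
  let ?B = "point ` Basis"
  have xD: "x \<in> derivations" and xtr: "\<And>y. y \<in> derivations \<Longrightarrow> tr (\<lambda>v. x (y v)) = 0"
    using x by (auto simp: trace_radical_def)
  note xl = derivation_lin[OF xD]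
  interpret O: operator_on_subspace "\<lambda>(c::'k alg_closure) (u::'g \<Rightarrow> 'k alg_closure) d. c * u d"
    "extend_map x" ?B
    by (intro operator_on_subspace.intro K.vspace_alg_closed_axioms operator_on_subspace_axioms.intro
        lin_extend_map finite_points independent_points) (auto simp: extend_map_mem)
  have "\<exists>n. \<forall>v\<in>K.span ?B. (extend_map x ^^ n) v = 0"
  proof (rule ccontr)
    assume nn: "\<not> ?thesis"
    obtain y where y: "K.lin y" "y ` K.span ?B \<subseteq> K.span ?B"
      "\<And>v w. v \<in> K.span ?B \<Longrightarrow> w \<in> K.span ?B \<Longrightarrow>
        y (extend_bracket v w) = extend_bracket (y v) w + extend_bracket v (y w)"
      and t: "K.trace_on ?B (\<lambda>u. extend_map x (y u)) \<noteq> 0"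
      using O.derivation_with_nonzero_trace_exists[OF lin_extend_bracket extend_bracket_mem
        extend_map_derivation[OF xD] nn] by blast
    obtain \<chi> where \<chi>: "\<And>a b. \<chi> (a + b) = \<chi> a + \<chi> b" "\<And>c a. \<chi> (to_ac c * a) = c * \<chi> a"
      "\<chi> (K.trace_on ?B (\<lambda>u. extend_map x (y u))) = 1"
      by (rule linear_functional_exists[OF t]) (rule that)
    have \<chi>0: "\<chi> 0 = 0" using \<chi>(1)[of 0 0] by simp
    have \<chi>sum: "\<chi> (sum h A) = (\<Sum>a\<in>A. \<chi> (h a))" for h and A :: "'g set"
      by (induction A rule: infinite_finite_induct) (simp_all add: \<chi> \<chi>0)
    define pr where "pr u = (\<Sum>d\<in>Basis. \<chi> (u d) *s d)" for u
    have pr_add: "pr (u + w) = pr u + pr w" for u w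
      by (simp add: pr_def \<chi>(1) scale_left_distrib sum.distrib)
    have pr_scale: "pr (\<lambda>d. to_ac c * u d) = c *s pr u" for c u
      by (simp add: pr_def \<chi>(2) scale_sum_right)
    have pr_zero: "pr 0 = 0" by (simp add: pr_def \<chi>0)
    have pr_sum: "pr (sum h A) = (\<Sum>a\<in>A. pr (h a))" for h and A :: "'g set"
      by (induction A rule: infinite_finite_induct)
        (simp_all only: sum.infinite sum.empty sum.insert pr_add pr_zero not_False_eq_True)
    have pr_embed: "pr (\<lambda>d. a * embed v d) = \<chi> a *s v" for a v
    proof -
      have "\<chi> (a * to_ac r) = r * \<chi> a" for r by (subst mult.commute) (rule \<chi>(2))
      then have "pr (\<lambda>d. a * embed v d) = (\<Sum>d\<in>Basis. (representation Basis v d * \<chi> a) *s d)"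
        by (simp add: pr_def embed_def)
      also have "\<dots> = \<chi> a *s (\<Sum>d\<in>Basis. representation Basis v d *s d)"
        by (simp add: scale_sum_right mult.commute)
      finally show ?thesis by (simp only: sum_coordinates)
    qed
    \<comment> \<open>\<open>pr\<close> commutes with maps defined over the base field, such as
      \<open>x\<close>; for \<open>y\<close> this can fail.\<close>
    have pr_map: "pr (extend_map f u) = f (pr u)" if "lin f" for f u
    proof -
      have "extend_map f u = (\<Sum>b\<in>Basis. (\<lambda>d. u b * embed (f b) d))"
        by (simp add: extend_map_def fun_eq_iff sum_fun_apply)
      then show ?thesis by (simp add: pr_sum pr_embed pr_def[of u] lin_sum[OF that] lin_scale[OF that])
    qed
    \<comment> \<open>\<open>\<chi>\<close> need not be multiplicative, so one factor has to come
      from the original algebra. In the Leibniz rule for \<open>y\<close> on embedded vectors both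
      terms have such a factor.\<close>
    have pr_bracket: "pr (extend_bracket u (embed w)) = bracket (pr u) w"
      "pr (extend_bracket (embed w) u) = bracket w (pr u)" if "u \<in> K.span ?B" for u w
    proof -
      have "extend_bracket u (embed w) = extend_bracket (\<Sum>b\<in>Basis. (\<lambda>d. u b * embed b d)) (embed w)"
        using sum_points[OF that] by (simp add: embed_Basis cong: sum.cong)
      also have "\<dots> = (\<Sum>b\<in>Basis. (\<lambda>d. u b * embed (bracket b w) d))"
        by (simp add: K.lin_sum[OF lin_extend_bracket(2)] K.lin_scale[OF lin_extend_bracket(2)]
            extend_bracket_embed)
      finally show "pr (extend_bracket u (embed w)) = bracket (pr u) w"
        by (simp add: pr_sum pr_embed pr_def[of u] bracket_sum_left bracket_scale_left)
      have "extend_bracket (embed w) u = extend_bracket (embed w) (\<Sum>b\<in>Basis. (\<lambda>d. u b * embed b d))"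
        using sum_points[OF that] by (simp add: embed_Basis cong: sum.cong)
      also have "\<dots> = (\<Sum>b\<in>Basis. (\<lambda>d. u b * embed (bracket w b) d))"
        by (simp add: K.lin_sum[OF lin_extend_bracket(1)] K.lin_scale[OF lin_extend_bracket(1)]
            extend_bracket_embed)
      finally show "pr (extend_bracket (embed w) u) = bracket w (pr u)"
        by (simp add: pr_sum pr_embed pr_def[of u] bracket_sum_right bracket_scale_right)
    qed
    have emb: "embed v \<in> K.span ?B" for v by (auto simp: span_points embed_outside)
    have yemb: "y (embed v) \<in> K.span ?B" for v using y(2) emb by blast
    define z where "z v = pr (y (embed v))" for v
    have z: "z \<in> derivations"
    proof -
      have "lin z"
        by (rule linI) (simp_all add: z_def embed_add embed_scale K.lin_add[OF y(1), unfolded plus_fun_def]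
            pr_add[unfolded plus_fun_def] K.lin_scale[OF y(1)] pr_scale)
      moreover have "z (bracket v w) = bracket (z v) w + bracket v (z w)" for v w
        unfolding z_def extend_bracket_embed[symmetric] y(3)[OF emb emb] pr_add pr_bracket[OF yemb] ..
      ultimately show ?thesis by (simp add: derivations_def)
    qed
    have "tr (\<lambda>v. x (z v)) = (\<Sum>b\<in>Basis. \<chi> (extend_map x (y (point b)) b))"
      unfolding trace_on_def
    proof (rule sum.cong)
      fix b assume b: "b \<in> Basis"
      define u where "u = extend_map x (y (embed b))"
      have "representation Basis (pr u) b = (\<Sum>d\<in>Basis. \<chi> (u d) * representation Basis d b)"
        unfolding pr_def by (rule representation_sum_scale[OF finite_Basis independent_Basis finite_Basis])
          (simp add: span_Basis)
      also have "\<dots> = (\<Sum>d\<in>Basis. if d = b then \<chi> (u d) else 0)"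
        by (rule sum.cong) (auto simp: representation_basis[OF independent_Basis])
      also have "\<dots> = \<chi> (u b)" using b finite_Basis by simp
      finally show "representation Basis (x (z b)) b = \<chi> (extend_map x (y (point b)) b)"
        by (simp add: z_def u_def pr_map[OF xl] embed_Basis[OF b])
    qed simp
    also have "\<dots> = \<chi> (\<Sum>b\<in>Basis. extend_map x (y (point b)) b)" by (simp add: \<chi>sum)
    also have "(\<Sum>b\<in>Basis. extend_map x (y (point b)) b) = K.trace_on ?B (\<lambda>u. extend_map x (y u))"
      unfolding K.trace_on_def
      by (simp add: sum.reindex[OF inj_on_subset[OF inj_point]] representation_points extend_map_mem)
    finally have "tr (\<lambda>v. x (z v)) = 1" using \<chi>(3) by simp
    with xtr[OF z] show False by simp
  qed
  then obtain n where n: "\<And>v. v \<in> K.span ?B \<Longrightarrow> (extend_map x ^^ n) v = 0" by blast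
  have "(extend_map x ^^ n) (embed v) = embed ((x ^^ n) v)" for v
    by (induction n) (simp_all add: extend_map_embed[OF xl])
  then have "embed ((x ^^ n) v) = embed 0" for v
    using n[of "embed v"] by (auto simp: span_points embed_outside embed_zero zero_fun_def)
  then show ?thesis using embed_inj by blast
qed

end

section \<open>Engel's theorem\<close>

context vspace
begin

definition commutator :: "('b \<Rightarrow> 'b) \<Rightarrow> ('b \<Rightarrow> 'b) \<Rightarrow> 'b \<Rightarrow> 'b" where
  "commutator x y = (\<lambda>v. x (y v) - y (x v))"

lemma lin_commutator: "lin x \<Longrightarrow> lin y \<Longrightarrow> lin (commutator x y)"
  unfolding commutator_def by (intro lin_minus) (rule lin_comp; assumption)+

definition act :: "('b \<Rightarrow> 'b) set \<Rightarrow> 'b set \<Rightarrow> 'b set" where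
  "act M U = span {m u |m u. m \<in> M \<and> u \<in> U}"

text \<open>For linear maps, \<open>flag M q \<subseteq> {0}\<close> says that every product of
  \<open>q\<close> members of \<open>M\<close> vanishes, which is the uniform nilpotency that
  Engel's theorem provides.\<close>

definition flag :: "('b \<Rightarrow> 'b) set \<Rightarrow> nat \<Rightarrow> 'b set" where
  "flag M n = (act M ^^ n) UNIV"

lemma flag_0 [simp]: "flag M 0 = UNIV"
  by (simp add: flag_def)

lemma flag_Suc: "flag M (Suc n) = act M (flag M n)"
  by (simp add: flag_def)

lemma subspace_flag: "subspace (flag M n)"
  by (cases n) (auto simp: flag_Suc act_def)

lemma zero_in_flag: "0 \<in> flag M n"
  by (rule subspace_0[OF subspace_flag])

lemma act_mono: "U \<subseteq> V \<Longrightarrow> act M U \<subseteq> act M V"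
  unfolding act_def by (rule span_mono) blast

lemma flag_Suc_subset: "flag M (Suc n) \<subseteq> flag M n"
  by (induction n) (auto simp: flag_Suc dest: act_mono)

lemma flag_antimono: "m \<le> n \<Longrightarrow> flag M n \<subseteq> flag M m"
  by (rule lift_Suc_antimono_le[of "flag M", OF flag_Suc_subset])

lemma flag_step: "m \<in> M \<Longrightarrow> v \<in> flag M n \<Longrightarrow> m v \<in> flag M (Suc n)"
  unfolding flag_Suc act_def by (rule span_base) blast

lemma lin_image_span_subset:
  assumes "lin x" "subspace V" "\<And>u. u \<in> S \<Longrightarrow> x u \<in> V" "v \<in> span S"
  shows "x v \<in> V"
proof -
  have "subspace {v. x v \<in> V}"
    using assms(2) by (auto intro!: subspaceI simp: lin_zero[OF assms(1)] lin_add[OF assms(1)]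
        lin_scale[OF assms(1)] subspace_0 subspace_add subspace_scale)
  then have "span S \<subseteq> {v. x v \<in> V}" using assms(3) by (intro span_minimal) auto
  then show ?thesis using assms(4) by blast
qed

lemma flag_normalized:
  assumes x: "lin x" and M: "\<And>m. m \<in> M \<Longrightarrow> commutator x m \<in> M" and "v \<in> flag M n"
  shows "x v \<in> flag M n"
  using assms(3)
proof (induction n arbitrary: v)
  case (Suc n)
  show ?case
  proof (rule lin_image_span_subset[OF x subspace_flag _ Suc.prems[unfolded flag_Suc act_def]])
    fix w assume "w \<in> {m u |m u. m \<in> M \<and> u \<in> flag M n}"
    then obtain m u where w: "w = m u" "m \<in> M" "u \<in> flag M n" by blast
    have "x (m u) = commutator x m u + m (x u)" by (simp add: commutator_def)
    also have "\<dots> \<in> flag M (Suc n)"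
      by (intro subspace_add[OF subspace_flag] flag_step M w Suc.IH)
    finally show "x w \<in> flag M (Suc n)" using w by simp
  qed
qed simp

text \<open>The operator \<open>r\<close> maps each level of \<open>flag R\<close> into the next, so
  modulo the next level \<open>x + r\<close> has the same powers as \<open>x\<close>. Hence
  \<open>m\<close> factors descend one level, and \<open>m * q\<close> factors reach zero.\<close>

lemma nilpotent_plus_ideal:
  assumes R: "flag R q \<subseteq> {0}" and x: "lin x" "\<And>v. (x ^^ m) v = 0"
    and xR: "\<And>r. r \<in> R \<Longrightarrow> commutator x r \<in> R" and r: "r \<in> R" "lin r"
  shows "\<exists>N. \<forall>v. ((\<lambda>v. x v + r v) ^^ N) v = 0"
proof -
  let ?y = "\<lambda>v. x v + r v"
  have stable: "x v \<in> flag R j" if "v \<in> flag R j" for v j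
    by (rule flag_normalized[OF x(1) xR that])
  have pow: "(x ^^ i) v \<in> flag R j" if "v \<in> flag R j" for v i j
    using that by (induction i) (auto intro: stable)
  have inner: "(?y ^^ i) v - (x ^^ i) v \<in> flag R (Suc j)" if "v \<in> flag R j" for v i j
  proof (induction i)
    case 0 show ?case by (simp add: zero_in_flag)
  next
    case (Suc i)
    let ?d = "(?y ^^ i) v - (x ^^ i) v"
    have "(?y ^^ Suc i) v - (x ^^ Suc i) v = x ?d + (r ?d + r ((x ^^ i) v))"
      by (simp add: lin_diff[OF x(1)] lin_diff[OF r(2)])
    also have "\<dots> \<in> flag R (Suc j)"
      using stable[OF Suc] flag_step[OF r(1) Suc] flag_step[OF r(1) pow[OF that]]
        flag_Suc_subset[of R "Suc j"]
      by (meson subsetD subspace_add subspace_flag)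
    finally show ?case .
  qed
  have "(?y ^^ (m * j)) v \<in> flag R j" for j v
  proof (induction j)
    case (Suc j)
    from inner[OF Suc, of m] x(2) show ?case by (simp add: funpow_add)
  qed simp
  then show ?thesis using R by blast
qed

end

context fd_lie
begin

sublocale Op: vspace "\<lambda>c (f::'g \<Rightarrow> 'g) v. c *s f v"
  by unfold_locales (simp_all add: fun_eq_iff scale_right_distrib scale_left_distrib)

definition elementary_map :: "'g \<times> 'g \<Rightarrow> 'g \<Rightarrow> 'g" where
  "elementary_map = (\<lambda>(b, c) v. representation Basis v b *s c)"

lemma lin_in_span_elementary: "lin f \<Longrightarrow> f \<in> Op.span (elementary_map ` (Basis \<times> Basis))"
proof -
  assume f: "lin f"
  have *: "f v = (\<Sum>b\<in>Basis. \<Sum>c\<in>Basis. representation Basis (f b) c *s elementary_map (b, c) v)" for v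
  proof -
    have "f v = f (\<Sum>b\<in>Basis. representation Basis v b *s b)" by (simp only: sum_coordinates)
    also have "\<dots> = (\<Sum>b\<in>Basis. representation Basis v b *s f b)"
      by (simp only: lin_sum[OF f] lin_scale[OF f])
    also have "\<dots> = (\<Sum>b\<in>Basis. representation Basis v b *s
        (\<Sum>c\<in>Basis. representation Basis (f b) c *s c))"
      by (simp only: sum_coordinates[of "f b" for b])
    also have "\<dots> = (\<Sum>b\<in>Basis. \<Sum>c\<in>Basis. representation Basis (f b) c *s elementary_map (b, c) v)"
      by (simp only: scale_sum_right scale_left_commute elementary_map_def case_prod_conv)
    finally show ?thesis .
  qed
  have "f = (\<Sum>b\<in>Basis. \<Sum>c\<in>Basis. (\<lambda>v. representation Basis (f b) c *s elementary_map (b, c) v))"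
    by (intro ext, unfold sum_fun_apply) (rule *)
  moreover have "(\<Sum>b\<in>Basis. \<Sum>c\<in>Basis. (\<lambda>v. representation Basis (f b) c *s elementary_map (b, c) v))
      \<in> Op.span (elementary_map ` (Basis \<times> Basis))"
    by (intro Op.span_sum Op.span_scale Op.span_base) auto
  ultimately show ?thesis by (simp only:)
qed

text \<open>The matrix units span the linear maps, which bounds independent families of them
  although the vector space \<open>Op\<close> consists of all functions.\<close>

lemma independent_lin_bound:
  assumes "Op.independent C" "\<And>f. f \<in> C \<Longrightarrow> lin f"
  shows "finite C \<and> card C \<le> card (elementary_map ` (Basis \<times> Basis))"
  by (rule Op.independent_span_bound) (use assms lin_in_span_elementary finite_Basis in auto)

lemma commutator_add_scale:
  assumes "lin k1" "lin k2" "lin x"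
  shows "commutator (\<lambda>v. k1 v + c1 *s x v) (\<lambda>v. k2 v + c2 *s x v) =
    (\<lambda>v. commutator k1 k2 v + (c2 *s commutator k1 x v - c1 *s commutator k2 x v))"
  by (simp add: commutator_def fun_eq_iff lin_add[OF assms(1)] lin_add[OF assms(2)]
      lin_add[OF assms(3)] lin_scale[OF assms(1)] lin_scale[OF assms(2)] lin_scale[OF assms(3)]
      scale_right_distrib scale_right_diff_distrib mult.commute)

text \<open>A word of length \<open>i\<close> in \<open>K'\<close> sends \<open>flag K j\<close>
  into its image under \<open>x ^^ i\<close> plus the next level. As \<open>x ^^ m\<close> is zero,
  every \<open>m\<close> factors descend one level of the flag of \<open>K\<close>.\<close>

lemma flag_span_insert:
  assumes K: "Op.subspace K" "\<And>k. k \<in> K \<Longrightarrow> lin k" and q: "flag K q \<subseteq> {0}"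
    and x: "lin x" "\<And>v. (x ^^ m) v = 0" "\<And>k. k \<in> K \<Longrightarrow> commutator x k \<in> K"
    and K': "\<And>f. f \<in> K' \<Longrightarrow> \<exists>k\<in>K. \<exists>c. f = (\<lambda>v. k v + c *s x v)"
  shows "\<exists>q. flag K' q \<subseteq> {0}"
proof -
  have stable: "x v \<in> flag K j" if "v \<in> flag K j" for v j
    by (rule flag_normalized[OF x(1) x(3) that])
  have pow: "(x ^^ i) v \<in> flag K j" if "v \<in> flag K j" for v i j
    using that by (induction i) (auto intro: stable)
  have "flag K' (m * j) \<subseteq> flag K j" for j
  proof (induction j)
    case (Suc j)
    define Q where "Q i = {a + w |a w. a \<in> (x ^^ i) ` flag K j \<and> w \<in> flag K (Suc j)}" for i
    have Q: "subspace (Q i)" for i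
      unfolding Q_def by (intro subspace_plus subspace_lin_image lin_funpow x(1) subspace_flag)
    have "flag K' (i + m * j) \<subseteq> Q i" for i
    proof (induction i)
      case 0
      have "flag K j \<subseteq> Q 0" unfolding Q_def using zero_in_flag by force
      then show ?case using Suc.IH by auto
    next
      case (Suc i)
      have "f u \<in> Q (Suc i)" if f: "f \<in> K'" and u: "u \<in> flag K' (i + m * j)" for f u
      proof -
        obtain k c where k: "k \<in> K" "f = (\<lambda>v. k v + c *s x v)" using K'[OF f] by blast
        obtain v w where vw: "v \<in> flag K j" "w \<in> flag K (Suc j)" "u = (x ^^ i) v + w"
          using Suc.IH u unfolding Q_def by blast
        have "f u = (x ^^ Suc i) (c *s v) + (k ((x ^^ i) v) + (k w + c *s x w))"
          by (simp add: k(2) vw(3) lin_add[OF K(2)[OF k(1)]] lin_add[OF x(1)]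
              lin_scale[OF lin_funpow[OF x(1)]] lin_scale[OF x(1)] scale_right_distrib)
        moreover have "k ((x ^^ i) v) + (k w + c *s x w) \<in> flag K (Suc j)"
          using flag_step[OF k(1) pow[OF vw(1)]] flag_step[OF k(1) vw(2)] stable[OF vw(2)]
            flag_Suc_subset[of K "Suc j"]
          by (meson subsetD subspace_add subspace_flag subspace_scale)
        moreover have "c *s v \<in> flag K j" using vw(1) subspace_flag subspace_scale by blast
        ultimately show ?thesis unfolding Q_def by blast
      qed
      then have "flag K' (Suc (i + m * j)) \<subseteq> Q (Suc i)"
        unfolding flag_Suc act_def by (intro span_minimal Q) blast
      then show ?case by simp
    qed
    from this[of m] have "flag K' (m * Suc j) \<subseteq> Q m" by simp
    also have "Q m \<subseteq> flag K (Suc j)" unfolding Q_def using x(2) by auto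
    finally show ?case .
  qed simp
  then show ?thesis using q by blast
qed

text \<open>Among the subalgebras of \<open>M\<close> that satisfy the conclusion, one of largest
  dimension is taken. If it were proper, an element outside that normalizes it could be adjoined by
  \<open>flag_span_insert\<close>.\<close>

theorem engel:
  assumes M: "Op.subspace M" "\<And>m. m \<in> M \<Longrightarrow> lin m"
    and closed: "\<And>x y. x \<in> M \<Longrightarrow> y \<in> M \<Longrightarrow> commutator x y \<in> M"
    and nil: "\<And>m. m \<in> M \<Longrightarrow> \<exists>n. \<forall>v. (m ^^ n) v = 0"
  shows "\<exists>q. flag M q \<subseteq> {0}"
proof -
  \<comment> \<open>Subalgebras are represented by bases \<open>C\<close>, so that the bound on
    independent families yields a maximal one.\<close>
  define P where "P C \<longleftrightarrow> C \<subseteq> M \<and> Op.independent C \<and>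
    (\<forall>x\<in>Op.span C. \<forall>y\<in>Op.span C. commutator x y \<in> Op.span C) \<and> (\<exists>q. flag (Op.span C) q \<subseteq> {0})" for C
  have "flag {0} 1 \<subseteq> {0}"
  proof -
    have "{m u |m u. m \<in> {0 :: 'g \<Rightarrow> 'g} \<and> u \<in> (UNIV :: 'g set)} \<subseteq> {0}" by auto
    then have "span {m u |m u. m \<in> {0 :: 'g \<Rightarrow> 'g} \<and> u \<in> (UNIV :: 'g set)} \<subseteq> {0}"
      by (rule span_minimal) (rule subspace_single_0)
    then show ?thesis by (simp add: flag_Suc act_def)
  qed
  then have "P {}"
    unfolding P_def by (auto simp: Op.independent_empty commutator_def zero_fun_def)
  moreover have "\<forall>C. P C \<longrightarrow> card C < Suc (card (elementary_map ` (Basis \<times> Basis)))"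
    using independent_lin_bound M(2) by (auto simp: P_def less_Suc_eq_le)
  ultimately have "\<exists>C. P C \<and> (\<forall>C'. P C' \<longrightarrow> card C' \<le> card C)"
    by (rule ex_has_greatest_nat)
  then obtain C where C: "P C" and max: "\<And>C'. P C' \<Longrightarrow> card C' \<le> card C"
    by blast
  define K where "K = Op.span C"
  have K: "Op.subspace K" by (simp add: K_def)
  have KM: "K \<subseteq> M" unfolding K_def using C M(1) by (intro Op.span_minimal) (auto simp: P_def)
  have Klin: "lin k" if "k \<in> K" for k using that KM M(2) by blast
  have Kcl: "commutator x y \<in> K" if "x \<in> K" "y \<in> K" for x y using that C by (auto simp: P_def K_def)
  obtain q where q: "flag K q \<subseteq> {0}" using C by (auto simp: P_def K_def)
  have "M \<subseteq> K"
  proof (rule ccontr)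
    assume "\<not> M \<subseteq> K"
    have "\<exists>x\<in>M - K. \<forall>k\<in>K. commutator k x \<in> K"
    proof (rule ccontr)
      assume no: "\<not> ?thesis"
      \<comment> \<open>Without a normalizing element, \<open>x\<close> can always be replaced by a
        commutator that is still outside \<open>K\<close> and raises the flag by one level more. At
        the start at most \<open>q\<close> levels are lost, because deeper ones are zero and the
        subtraction is truncated; after \<open>q + q\<close> rounds all values lie in
        \<open>flag K q\<close>, so \<open>x = 0\<close>.\<close>
      have "\<exists>x\<in>M - K. \<forall>j. \<forall>v\<in>flag K j. x v \<in> flag K (j + n - q)" for n
      proof (induction n)
        case 0
        obtain x where x: "x \<in> M - K" using \<open>\<not> M \<subseteq> K\<close> by blast
        have "x v \<in> flag K (j - q)" if "v \<in> flag K j" for v j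
        proof (cases "j \<le> q")
          case False
          then have "v = 0" using that flag_antimono[of q j K] q by auto
          then show ?thesis using x M(2) lin_zero zero_in_flag by force
        qed simp
        then show ?case using x by auto
      next
        case (Suc n)
        then obtain x where x: "x \<in> M - K" "\<And>j v. v \<in> flag K j \<Longrightarrow> x v \<in> flag K (j + n - q)" by blast
        obtain k where k: "k \<in> K" "commutator k x \<notin> K" using no x(1) by blast
        have "commutator k x v \<in> flag K (j + Suc n - q)" if v: "v \<in> flag K j" for j v
        proof -
          have "k (x v) \<in> flag K (Suc (j + n - q))" by (rule flag_step[OF k(1) x(2)[OF v]])
          then have "k (x v) \<in> flag K (j + Suc n - q)"
            using flag_antimono[of "j + Suc n - q" "Suc (j + n - q)" K] by fastforce
          moreover have "x (k v) \<in> flag K (j + Suc n - q)" using x(2)[OF flag_step[OF k(1) v]] by simp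
          ultimately show ?thesis unfolding commutator_def using subspace_diff[OF subspace_flag] by blast
        qed
        moreover have "commutator k x \<in> M - K" using k x(1) KM closed by blast
        ultimately show ?case by blast
      qed
      from this[of "q + q"] obtain x where x: "x \<in> M - K" "\<And>v. x v \<in> flag K q"
        by (metis add.left_neutral add_diff_cancel_right' flag_0 UNIV_I)
      then have "x = 0" using q by (auto simp: fun_eq_iff)
      then show False using x(1) Op.subspace_0[OF K] by blast
    qed
    then obtain x where x: "x \<in> M" "x \<notin> K" "\<And>k. k \<in> K \<Longrightarrow> commutator k x \<in> K" by blast
    have xl: "lin x" using M(2) x(1) .
    obtain m where m: "\<And>v. (x ^^ m) v = 0" using nil[OF x(1)] by blast
    define C' where "C' = insert x C"
    have K': "\<exists>k\<in>K. \<exists>c. f = (\<lambda>v. k v + c *s x v)" if "f \<in> Op.span C'" for f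
    proof -
      obtain c where "f - (\<lambda>v. c *s x v) \<in> K"
        using \<open>f \<in> Op.span C'\<close> unfolding C'_def Op.span_insert K_def by blast
      then show ?thesis by (intro bexI[of _ "f - (\<lambda>v. c *s x v)"] exI[of _ c]) (auto simp: fun_eq_iff)
    qed
    have neg: "commutator x k \<in> K" if "k \<in> K" for k
    proof -
      have "commutator x k = - commutator k x" by (simp add: commutator_def fun_eq_iff)
      then show ?thesis using Op.subspace_neg[OF K x(3)[OF that]] by simp
    qed
    have inK': "(\<lambda>v. k v + c *s x v) \<in> Op.span C'" if "k \<in> K" for k c
    proof -
      have "k \<in> Op.span C'" using that Op.span_mono[of C C'] unfolding K_def C'_def by blast
      moreover have "(\<lambda>v. c *s x v) \<in> Op.span C'"
        by (intro Op.span_scale Op.span_base) (simp add: C'_def)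
      ultimately have "k + (\<lambda>v. c *s x v) \<in> Op.span C'" by (rule Op.span_add)
      then show ?thesis by (simp add: plus_fun_def)
    qed
    have "P C'"
      unfolding P_def
    proof (intro conjI ballI)
      show "C' \<subseteq> M" using C x(1) by (auto simp: P_def C'_def)
      show "Op.independent C'"
        unfolding C'_def using C x(2) by (simp add: P_def K_def Op.independent_insert)
      show "\<exists>q. flag (Op.span C') q \<subseteq> {0}"
        by (rule flag_span_insert[OF K Klin q xl m neg K'])
      fix f g assume "f \<in> Op.span C'" "g \<in> Op.span C'"
      then obtain k1 c1 k2 c2 where fg: "k1 \<in> K" "k2 \<in> K" "f = (\<lambda>v. k1 v + c1 *s x v)"
        "g = (\<lambda>v. k2 v + c2 *s x v)" using K' by metis
      have "commutator f g = commutator k1 k2 + ((\<lambda>v. c2 *s commutator k1 x v) - (\<lambda>v. c1 *s commutator k2 x v))"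
        unfolding fg(3,4) commutator_add_scale[OF Klin[OF fg(1)] Klin[OF fg(2)] xl]
        by (simp add: fun_eq_iff)
      also have "\<dots> \<in> K"
        by (intro Op.subspace_add[OF K] Op.subspace_diff[OF K] Op.subspace_scale[OF K] Kcl fg x(3))
      finally have "(\<lambda>v. commutator f g v + 0 *s x v) \<in> Op.span C'" by (rule inK')
      then show "commutator f g \<in> Op.span C'" by simp
    qed
    then have "card C' \<le> card C" by (rule max)
    moreover have "x \<notin> C" using x(2) Op.span_base unfolding K_def by blast
    moreover have "finite C" using independent_lin_bound[of C] C M(2) by (auto simp: P_def)
    ultimately show False by (simp add: C'_def)
  qed
  then show ?thesis using q KM by (metis subset_antisym)
qed

end

section \<open>Integer gradings\<close>

context fd_lie
begin

lemma subspace_derivations: "Op.subspace derivations"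
proof (rule Op.subspaceI)
  show "0 \<in> derivations" by (auto simp: derivations_def bracket_simps zero_fun_def intro: lin_const_zero)
  fix x y and c :: 'k
  assume x: "x \<in> derivations" and y: "y \<in> derivations"
  show "(x + y) \<in> derivations"
    using lin_plus[OF derivation_lin[OF x] derivation_lin[OF y]]
    by (auto simp: derivations_def plus_fun_def bracket_simps derivation_bracket[OF x] derivation_bracket[OF y])
  show "(\<lambda>v. c *s x v) \<in> derivations"
    using lin_smult[OF derivation_lin[OF x], of c]
    by (auto simp: derivations_def bracket_simps derivation_bracket[OF x] scale_right_distrib)
qed

lemma derivation_plus: "x \<in> derivations \<Longrightarrow> y \<in> derivations \<Longrightarrow> (\<lambda>v. x v + y v) \<in> derivations"
  using Op.subspace_add[OF subspace_derivations] by (simp add: plus_fun_def)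

lemma derivation_minus: "x \<in> derivations \<Longrightarrow> y \<in> derivations \<Longrightarrow> (\<lambda>v. x v - y v) \<in> derivations"
  using Op.subspace_diff[OF subspace_derivations] by (simp add: fun_diff_def)

lemma derivation_smult: "x \<in> derivations \<Longrightarrow> (\<lambda>v. c *s x v) \<in> derivations"
  by (rule Op.subspace_scale[OF subspace_derivations])

lemma derivation_sum:
  "(\<And>a. a \<in> A \<Longrightarrow> f a \<in> derivations) \<Longrightarrow> (\<lambda>v. \<Sum>a\<in>A. f a v) \<in> derivations"
  using Op.subspace_sum[OF subspace_derivations, of A f] by (simp add: sum_fun_apply[abs_def])

lemma derivation_commutator:
  assumes "x \<in> derivations" "y \<in> derivations"
  shows "commutator x y \<in> derivations"
  using lin_commutator[OF derivation_lin[OF assms(1)] derivation_lin[OF assms(2)]]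
  by (auto simp: derivations_def commutator_def bracket_simps derivation_bracket[OF assms(1)]
      derivation_bracket[OF assms(2)] lin_add[OF derivation_lin[OF assms(1)]]
      lin_add[OF derivation_lin[OF assms(2)]])

lemma tr_sum: "tr (\<lambda>v. \<Sum>a\<in>A. f a v) = (\<Sum>a\<in>A. tr (f a))"
proof (induction A rule: infinite_finite_induct)
  case (insert a A) then show ?case by (simp add: tr_add)
qed (use tr_scale[of 0] in simp_all)

lemma trace_radical_D: "r \<in> trace_radical \<Longrightarrow> r \<in> derivations"
  "r \<in> trace_radical \<Longrightarrow> y \<in> derivations \<Longrightarrow> tr (\<lambda>v. r (y v)) = 0"
  by (auto simp: trace_radical_def)

lemma subspace_trace_radical: "Op.subspace trace_radical"
proof (rule Op.subspaceI)
  show "0 \<in> trace_radical"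
    using Op.subspace_0[OF subspace_derivations] tr_scale[of 0] by (simp add: trace_radical_def)
  fix x y and c :: 'k
  assume x: "x \<in> trace_radical" and y: "y \<in> trace_radical"
  show "(x + y) \<in> trace_radical"
    using derivation_plus[OF trace_radical_D(1)[OF x] trace_radical_D(1)[OF y]]
      trace_radical_D(2)[OF x] trace_radical_D(2)[OF y]
    by (simp add: trace_radical_def plus_fun_def tr_add)
  show "(\<lambda>v. c *s x v) \<in> trace_radical"
    using derivation_smult[OF trace_radical_D(1)[OF x]] trace_radical_D(2)[OF x]
    by (simp add: trace_radical_def tr_scale)
qed

text \<open>The trace form is invariant: cyclicity moves the commutator with \<open>x\<close> from
  \<open>r\<close> to \<open>y\<close>.\<close>

lemma trace_radical_ideal:
  assumes x: "x \<in> derivations" and r: "r \<in> trace_radical"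
  shows "commutator x r \<in> trace_radical"
  unfolding trace_radical_def
proof (intro CollectI conjI ballI)
  note rD = trace_radical_D(1)[OF r]
  note lin = derivation_lin[OF x] derivation_lin[OF rD]
  show "commutator x r \<in> derivations" by (rule derivation_commutator[OF x rD])
  fix y assume y: "y \<in> derivations"
  note ly = derivation_lin[OF y]
  have "tr (\<lambda>v. x (r (y v))) = tr (\<lambda>v. r (y (x v)))"
    using tr_commute[OF lin(1) lin_comp[OF lin(2) ly]] .
  then have "tr (\<lambda>v. commutator x r (y v)) = tr (\<lambda>v. r (y (x v)) - r (x (y v)))"
    by (simp add: commutator_def tr_diff)
  also have "\<dots> = tr (\<lambda>v. r (commutator y x v))"
    by (simp add: commutator_def lin_diff[OF lin(2)])
  also have "\<dots> = 0" by (rule trace_radical_D(2)[OF r derivation_commutator[OF y x]])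
  finally show "tr (\<lambda>v. commutator x r (y v)) = 0" .
qed

lemma trace_radical_flag: "\<exists>q. flag trace_radical q \<subseteq> {0}"
  by (rule engel[OF subspace_trace_radical])
    (simp_all add: trace_radical_D derivation_lin trace_radical_ideal trace_radical_nilpotent)

text \<open>Induction over \<open>C\<close>, passing to the kernel of one functional
  \<open>f u\<close> in \<open>D\<close>. This is the duality that turns orthogonality for the trace
  form into membership modulo the radical.\<close>

lemma functional_in_span:
  fixes f :: "'c \<Rightarrow> ('g \<Rightarrow> 'g) \<Rightarrow> 'k"
  assumes "finite C" and D: "Op.subspace D"
    and f: "\<And>u x y. u \<in> C \<Longrightarrow> f u (\<lambda>v. x v + y v) = f u x + f u y"
      "\<And>u c x. u \<in> C \<Longrightarrow> f u (\<lambda>v. c *s x v) = c * f u x"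
    and g: "\<And>x y. g (\<lambda>v. x v + y v) = g x + g y" "\<And>c x. g (\<lambda>v. c *s x v) = c * g x"
    and ker: "\<And>y. y \<in> D \<Longrightarrow> (\<And>u. u \<in> C \<Longrightarrow> f u y = 0) \<Longrightarrow> g y = 0"
  shows "\<exists>c. \<forall>y\<in>D. g y = (\<Sum>u\<in>C. c u * f u y)"
  using assms
proof (induction C arbitrary: D rule: finite_induct)
  case (insert u C)
  define D0 where "D0 = {y \<in> D. f u y = 0}"
  have f0: "f u 0 = 0" using insert.prems(3)[of u 0 0] by (simp add: zero_fun_def)
  have "Op.subspace D0"
    using insert.prems(1) f0 insert.prems(2,3)[of u]
    by (auto simp: D0_def Op.subspace_def plus_fun_def)
  then have "\<exists>c. \<forall>y\<in>D0. g y = (\<Sum>u\<in>C. c u * f u y)"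
  proof (rule insert.IH)
    show "g y = 0" if "y \<in> D0" "\<And>w. w \<in> C \<Longrightarrow> f w y = 0" for y
      using insert.prems(6)[of y] that by (auto simp: D0_def)
  qed (use insert.prems(2-5) in auto)
  then obtain c where c: "\<And>y. y \<in> D0 \<Longrightarrow> g y = (\<Sum>u\<in>C. c u * f u y)" by blast
  show ?case
  proof (cases "\<forall>y\<in>D. f u y = 0")
    case True
    then have "\<forall>y\<in>D. g y = (\<Sum>w\<in>insert u C. (c(u := 0)) w * f w y)"
      using c insert.hyps by (auto simp: D0_def intro!: sum.cong)
    then show ?thesis by blast
  next
    case False
    then obtain y0 where y0: "y0 \<in> D" "f u y0 \<noteq> 0" by blast
    define y1 where "y1 = (\<lambda>v. inverse (f u y0) *s y0 v)"
    have y1: "y1 \<in> D" "f u y1 = 1"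
      using y0 Op.subspace_scale[OF insert.prems(1)] insert.prems(3)[of u] by (auto simp: y1_def)
    \<comment> \<open>The coefficient of \<open>f u\<close> is forced by evaluation at
      \<open>y1\<close>, where \<open>f u\<close> is 1.\<close>
    define c0 where "c0 = g y1 - (\<Sum>w\<in>C. c w * f w y1)"
    have "g y = (\<Sum>w\<in>insert u C. (c(u := c0)) w * f w y)" if y: "y \<in> D" for y
    proof -
      let ?y = "\<lambda>v. y v + (- f u y) *s y1 v"
      have "?y = y + (\<lambda>v. (- f u y) *s y1 v)" by (simp add: plus_fun_def)
      then have "?y \<in> D" using Op.subspace_add[OF insert.prems(1) y]
          Op.subspace_scale[OF insert.prems(1) y1(1), of "- f u y"] by simp
      moreover have fy: "f w ?y = f w y - f u y * f w y1" if "w \<in> insert u C" for w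
        unfolding insert.prems(2)[OF that] insert.prems(3)[OF that] by simp
      ultimately have "?y \<in> D0" using y1(2) by (simp add: D0_def)
      from c[OF this] have "g y - f u y * g y1 = (\<Sum>w\<in>C. c w * f w ?y)"
        unfolding insert.prems(4,5) by simp
      also have "\<dots> = (\<Sum>w\<in>C. c w * (f w y - f u y * f w y1))"
        by (rule sum.cong) (simp_all only: fy insertI2)
      also have "\<dots> = (\<Sum>w\<in>C. c w * f w y) - f u y * (\<Sum>w\<in>C. c w * f w y1)"
        by (simp add: right_diff_distrib sum_subtractf sum_distrib_left mult.left_commute)
      finally have "g y = c0 * f u y + (\<Sum>w\<in>C. c w * f w y)"
        by (simp add: c0_def algebra_simps)
      also have "\<dots> = (\<Sum>w\<in>insert u C. (c(u := c0)) w * f w y)"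
        using insert.hyps by (auto intro!: sum.cong)
      finally show ?thesis .
    qed
    then show ?thesis by blast
  qed
qed simp

end

text \<open>The grading is encoded by its projections, indexed by all integers, so that homogeneity
  becomes an equation. \<open>M\<close> bounds the degrees and keeps all sums finite.\<close>

locale int_graded = fd_lie scale bracket Basis
  for scale :: "'k::field_char_0 \<Rightarrow> 'g::ab_group_add \<Rightarrow> 'g" (infixr \<open>*s\<close> 75)
    and bracket :: "'g \<Rightarrow> 'g \<Rightarrow> 'g" and Basis :: "'g set" +
  fixes p :: "int \<Rightarrow> 'g \<Rightarrow> 'g" and M :: int
  assumes M: "0 \<le> M" and p_lin: "lin (p i)"
    and p_p: "p i (p j v) = (if i = j then p j v else 0)"
    and p_out: "i \<notin> {-M..M} \<Longrightarrow> p i v = 0"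
    and p_sum: "(\<Sum>i\<in>{-M..M}. p i v) = v"
    and p_bracket: "p (i + j) (bracket (p i v) (p j w)) = bracket (p i v) (p j w)"
begin

lemmas p_simps = lin_add[OF p_lin] lin_scale[OF p_lin] lin_zero[OF p_lin] lin_diff[OF p_lin]
  lin_neg[OF p_lin] lin_sum[OF p_lin]

lemma p_eqI: "(\<And>i. p i v = p i w) \<Longrightarrow> v = w"
proof -
  assume "\<And>i. p i v = p i w"
  then have "(\<Sum>i\<in>{-M..M}. p i v) = (\<Sum>i\<in>{-M..M}. p i w)" by (intro sum.cong) auto
  then show ?thesis by (simp only: p_sum)
qed

lemma p_sum_superset: "finite A \<Longrightarrow> {-M..M} \<subseteq> A \<Longrightarrow> (\<Sum>i\<in>A. p i v) = v"
  using sum.mono_neutral_right[of A "{-M..M}" "\<lambda>i. p i v"] p_out p_sum by auto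

text \<open>The index \<open>l\<close> may lie outside the range of summation, where
  \<open>p l v = 0\<close>; hence the condition on \<open>f\<close> at 0.\<close>

lemma sum_p_delta: "(\<Sum>i\<in>{-M..M}. if i = l then f i (p i v) else 0) = f l (p l v)"
  if "\<And>i. f i 0 = 0" for f :: "int \<Rightarrow> 'g \<Rightarrow> 'g"
  using p_out[of l v] that by (auto simp: sum.delta)

definition h :: "'g \<Rightarrow> 'g" where "h v = (\<Sum>i\<in>{-M..M}. of_int i *s p i v)"

lemma lin_h: "lin h"
  unfolding h_def[abs_def] by (intro lin_sums lin_smult p_lin)

lemma p_h: "p l (h v) = of_int l *s p l v"
proof -
  have "p l (h v) = (\<Sum>i\<in>{-M..M}. if i = l then of_int i *s p i v else 0)"
    unfolding h_def lin_sum[OF p_lin] lin_scale[OF p_lin] by (rule sum.cong) (auto simp: p_p)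
  then show ?thesis using sum_p_delta[of "\<lambda>i v. of_int i *s v"] by simp
qed

lemma h_p: "h (p i v) = of_int i *s p i v"
  by (rule p_eqI) (simp add: p_h p_simps p_p)

lemma eigenvector_of_h: "h w = of_int i *s w \<Longrightarrow> p i w = w"
proof (rule p_eqI)
  fix l assume *: "h w = of_int i *s w"
  have "of_int l *s p l w = of_int i *s p l w" using p_h[of l w] unfolding * lin_scale[OF p_lin] by (rule sym)
  then have "(of_int l - of_int i) *s p l w = 0" by (simp only: scale_left_diff_distrib right_minus_eq)
  then have "l = i \<or> p l w = 0" by auto
  then show "p l (p i w) = p l w" by (auto simp: p_p)
qed

lemma derivationI:
  assumes x: "lin x" and "\<And>i j v w. x (bracket (p i v) (p j w)) =
    bracket (x (p i v)) (p j w) + bracket (p i v) (x (p j w))"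
  shows "x \<in> derivations"
proof -
  have "x (bracket v w) = bracket (x v) w + bracket v (x w)" for v w
  proof -
    have "x (bracket (\<Sum>i\<in>{-M..M}. p i v) (\<Sum>j\<in>{-M..M}. p j w)) =
      bracket (x (\<Sum>i\<in>{-M..M}. p i v)) (\<Sum>j\<in>{-M..M}. p j w) +
      bracket (\<Sum>i\<in>{-M..M}. p i v) (x (\<Sum>j\<in>{-M..M}. p j w))"
      unfolding lin_sum[OF x] bracket_sum_left bracket_sum_right assms(2) sum.distrib ..
    then show ?thesis by (simp only: p_sum)
  qed
  then show ?thesis using x by (simp add: derivations_def)
qed

lemma p_bracket_left: "p (i + j) (bracket u (p j w)) = bracket (p i u) (p j w)"
proof -
  have "p (i + j) (bracket (\<Sum>k\<in>{-M..M}. p k u) (p j w)) =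
      (\<Sum>k\<in>{-M..M}. if k = i then bracket (p k u) (p j w) else 0)"
    unfolding bracket_sum_left lin_sum[OF p_lin]
  proof (rule sum.cong)
    fix k
    show "p (i + j) (bracket (p k u) (p j w)) = (if k = i then bracket (p k u) (p j w) else 0)"
      using p_p[of "i + j" "k + j" "bracket (p k u) (p j w)"]
      by (cases "k = i") (simp_all add: p_bracket)
  qed simp
  then show ?thesis using sum_p_delta[of "\<lambda>i v. bracket v (p j w)"] by (simp add: p_sum bracket_simps)
qed

lemma p_bracket_right: "p (i + j) (bracket (p i u) w) = bracket (p i u) (p j w)"
proof -
  have "p (i + j) (bracket (p i u) (\<Sum>k\<in>{-M..M}. p k w)) =
      (\<Sum>k\<in>{-M..M}. if k = j then bracket (p i u) (p k w) else 0)"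
    unfolding bracket_sum_right lin_sum[OF p_lin]
  proof (rule sum.cong)
    fix k
    show "p (i + j) (bracket (p i u) (p k w)) = (if k = j then bracket (p i u) (p k w) else 0)"
      using p_p[of "i + j" "i + k" "bracket (p i u) (p k w)"]
      by (cases "k = j") (simp_all add: p_bracket)
  qed simp
  then show ?thesis using sum_p_delta[of "\<lambda>i v. bracket (p i' u) v" for i'] by (simp add: p_sum bracket_simps)
qed

lemma h_derivation: "h \<in> derivations"
proof (rule derivationI[OF lin_h])
  fix i j v w
  have "h (bracket (p i v) (p j w)) = h (p (i + j) (bracket (p i v) (p j w)))"
    by (simp only: p_bracket)
  also have "\<dots> = of_int (i + j) *s p (i + j) (bracket (p i v) (p j w))" by (rule h_p)
  also have "\<dots> = of_int (i + j) *s bracket (p i v) (p j w)" by (simp only: p_bracket)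
  finally show "h (bracket (p i v) (p j w)) = bracket (h (p i v)) (p j w) + bracket (p i v) (h (p j w))"
    by (simp add: h_p bracket_simps scale_left_distrib)
qed

text \<open>The homogeneous component of degree \<open>j\<close> of \<open>x\<close> for the grading
  induced on operators. By \<open>h_deg\<close> it is an eigenvector, with eigenvalue
  \<open>j\<close>, of taking the commutator with \<open>h\<close>.\<close>

definition deg :: "int \<Rightarrow> ('g \<Rightarrow> 'g) \<Rightarrow> 'g \<Rightarrow> 'g" where
  "deg j x v = (\<Sum>i\<in>{-M..M}. p (i + j) (x (p i v)))"

lemma lin_deg: "lin x \<Longrightarrow> lin (deg j x)"
  unfolding deg_def[abs_def] by (intro lin_sums lin_comp[OF p_lin] lin_comp[OF _ p_lin])

lemma p_deg: "lin x \<Longrightarrow> p l (deg j x v) = p l (x (p (l - j) v))"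
proof -
  assume x: "lin x"
  have "p l (deg j x v) = (\<Sum>i\<in>{-M..M}. if i = l - j then p l (x (p i v)) else 0)"
    unfolding deg_def lin_sum[OF p_lin] by (rule sum.cong) (auto simp: p_p)
  then show ?thesis using sum_p_delta[of "\<lambda>i v. p l (x v)"] by (simp add: lin_zero[OF x] p_simps)
qed

lemma deg_p: "lin x \<Longrightarrow> deg j x (p i v) = p (i + j) (x (p i v))"
proof -
  assume x: "lin x"
  show ?thesis
  proof (rule p_eqI)
    fix l show "p l (deg j x (p i v)) = p l (p (i + j) (x (p i v)))"
      by (cases "l = i + j") (auto simp: p_deg[OF x] p_p lin_zero[OF x] p_simps)
  qed
qed

text \<open>Operator degrees are differences of two degrees in \<open>{-M..M}\<close>, hence the
  doubled range.\<close>

lemma sum_deg: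
  assumes x: "lin x" shows "(\<Sum>j\<in>{-2*M..2*M}. deg j x v) = x v"
proof (rule p_eqI)
  fix l
  have "p l (\<Sum>j\<in>{-2*M..2*M}. deg j x v) = p l (x (\<Sum>j\<in>{-2*M..2*M}. p (l - j) v))"
    by (simp add: p_simps p_deg[OF x] lin_sum[OF x])
  also have "\<dots> = p l (x v)"
  proof (cases "l \<in> {-M..M}")
    case True
    have "(\<Sum>j\<in>{-2*M..2*M}. p (l - j) v) = (\<Sum>i\<in>(\<lambda>j. l - j) ` {-2*M..2*M}. p i v)"
      by (subst sum.reindex) (auto simp: inj_on_def)
    also have "\<dots> = v"
    proof (rule p_sum_superset)
      show "{-M..M} \<subseteq> (\<lambda>j. l - j) ` {-2*M..2*M}"
      proof
        fix i assume "i \<in> {-M..M}"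
        then show "i \<in> (\<lambda>j. l - j) ` {-2*M..2*M}" using True by (intro image_eqI[of _ _ "l - i"]) auto
      qed
    qed simp
    finally show ?thesis by simp
  qed (simp add: p_out)
  finally show "p l (\<Sum>j\<in>{-2*M..2*M}. deg j x v) = p l (x v)" .
qed

text \<open>On homogeneous arguments of degrees \<open>a\<close> and \<open>b\<close> this is the
  Leibniz rule for \<open>x\<close>, projected to degree \<open>a + b + j\<close>.\<close>

lemma deg_derivation:
  assumes x: "x \<in> derivations" shows "deg j x \<in> derivations"
proof (rule derivationI[OF lin_deg[OF derivation_lin[OF x]]])
  note xl = derivation_lin[OF x]
  fix a b v w
  have "deg j x (bracket (p a v) (p b w)) = deg j x (p (a + b) (bracket (p a v) (p b w)))"
    by (simp only: p_bracket)
  also have "\<dots> = p (a + b + j) (bracket (x (p a v)) (p b w) + bracket (p a v) (x (p b w)))"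
    by (subst deg_p[OF xl]) (simp only: p_bracket derivation_bracket[OF x])
  also have "\<dots> = bracket (p (a + j) (x (p a v))) (p b w) + bracket (p a v) (p (b + j) (x (p b w)))"
    using p_bracket_left[of "a + j" b] p_bracket_right[of a "b + j"]
    by (simp add: p_simps ac_simps)
  finally show "deg j x (bracket (p a v) (p b w)) =
      bracket (deg j x (p a v)) (p b w) + bracket (p a v) (deg j x (p b w))"
    by (simp add: deg_p[OF xl])
qed

lemma h_deg: "lin x \<Longrightarrow> h (deg j x v) - deg j x (h v) = of_int j *s deg j x v"
  by (rule p_eqI) (simp add: p_simps p_h p_deg lin_scale[of x] scale_left_diff_distrib[symmetric])

lemma deg_0_h: "deg 0 h = h"
  by (rule ext, rule p_eqI) (simp add: p_deg[OF lin_h] h_p p_simps p_p p_h)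

text \<open>Cyclicity moves the projections to the other factor, where they cut out the opposite
  degree. Components whose degrees do not cancel are therefore orthogonal.\<close>

lemma tr_deg:
  assumes d: "lin d" and y: "lin y"
  shows "tr (\<lambda>v. d (deg j y v)) = tr (\<lambda>v. deg (- j) d (y v))"
proof -
  have "tr (\<lambda>v. d (deg j y v)) = (\<Sum>i\<in>{-M..M}. tr (\<lambda>v. d (p (i + j) (y (p i v)))))"
    by (simp add: deg_def lin_sum[OF d] tr_sum)
  also have "\<dots> = (\<Sum>i\<in>{-M..M}. tr (\<lambda>v. p i (d (p (i + j) (y v)))))"
    by (intro sum.cong refl tr_commute lin_comp[OF d] lin_comp[OF p_lin] y p_lin)
  also have "\<dots> = tr (\<lambda>v. \<Sum>i\<in>{-M..M}. p i (d (p (i + j) (y v))))" by (simp add: tr_sum)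
  also have "(\<lambda>v. \<Sum>i\<in>{-M..M}. p i (d (p (i + j) (y v)))) = (\<lambda>v. deg (- j) d (y v))"
  proof (rule ext, rule p_eqI)
    fix v l
    have "p l (\<Sum>i\<in>{-M..M}. p i (d (p (i + j) (y v)))) =
        (\<Sum>i\<in>{-M..M}. if i = l then p i (d (p (l + j) (y v))) else 0)"
      unfolding lin_sum[OF p_lin] by (rule sum.cong) (auto simp: p_p)
    also have "\<dots> = p l (d (p (l + j) (y v)))"
      using sum_p_delta[of "\<lambda>i v. v"] p_out[of l] by (auto simp: sum.delta)
    finally show "p l (\<Sum>i\<in>{-M..M}. p i (d (p (i + j) (y v)))) = p l (deg (- j) d (y v))"
      by (simp add: p_deg[OF d])
  qed
  finally show ?thesis .
qed

section \<open>The filtration of a grading and its triangular derivations\<close>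

definition filt :: "int \<Rightarrow> 'g set" where
  "filt i = {v. \<forall>j<i. p j v = 0}"

lemma subspace_filt: "subspace (filt i)"
  by (auto simp: filt_def p_simps intro!: subspaceI)

lemma filt_antimono: "i \<le> j \<Longrightarrow> filt j \<subseteq> filt i"
  by (auto simp: filt_def)

lemma filt_bottom: "filt (- M) = UNIV"
  by (auto simp: filt_def p_out)

lemma filt_top: "filt (M + 1) = {0}"
proof -
  have "v = 0" if "v \<in> filt (M + 1)" for v
    using that p_out[of _ v] by (rule_tac p_eqI) (force simp: filt_def p_simps)
  then show ?thesis by (auto simp: filt_def p_simps)
qed

lemma p_filt: "i \<le> j \<Longrightarrow> p j v \<in> filt i"
  by (auto simp: filt_def p_p)

lemma p_filt_stable: "v \<in> filt i \<Longrightarrow> p j v \<in> filt i"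
  by (auto simp: filt_def p_p)

lemma h_filt: "v \<in> filt i \<Longrightarrow> h v \<in> filt i"
  by (auto simp: filt_def p_h)

lemma deg_filt: "lin x \<Longrightarrow> v \<in> filt i \<Longrightarrow> deg j x v \<in> filt (i + j)"
  by (auto simp: filt_def p_deg lin_zero[of x] p_simps)

lemma diff_p_filt: "v \<in> filt i \<Longrightarrow> v - p i v \<in> filt (i + 1)"
proof -
  assume "v \<in> filt i"
  then have "p j (v - p i v) = 0" if "j < i + 1" for j
    using that by (cases "j = i") (auto simp: filt_def p_simps p_p)
  then show ?thesis by (simp add: filt_def)
qed

text \<open>The analogue of a parabolic subalgebra, with \<open>pos_der\<close> as its nilpotent
  part. It is phrased through the filtration rather than through degrees, since stability of the
  filtration is what the later conjugation exploits.\<close>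

definition nonneg_der :: "('g \<Rightarrow> 'g) set" where
  "nonneg_der = {x \<in> derivations. \<forall>i. \<forall>v\<in>filt i. x v \<in> filt i}"

definition pos_der :: "('g \<Rightarrow> 'g) set" where
  "pos_der = {x \<in> derivations. \<forall>i. \<forall>v\<in>filt i. x v \<in> filt (i + 1)}"

lemma subspace_nonneg_der: "Op.subspace nonneg_der"
  unfolding nonneg_der_def
  by (rule Op.subspaceI) (auto intro: Op.subspace_0[OF subspace_derivations]
      Op.subspace_add[OF subspace_derivations] Op.subspace_scale[OF subspace_derivations]
      subspace_0[OF subspace_filt] subspace_add[OF subspace_filt] subspace_scale[OF subspace_filt])

lemma subspace_pos_der: "Op.subspace pos_der"
  unfolding pos_der_def
  by (rule Op.subspaceI) (auto intro: Op.subspace_0[OF subspace_derivations]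
      Op.subspace_add[OF subspace_derivations] Op.subspace_scale[OF subspace_derivations]
      subspace_0[OF subspace_filt] subspace_add[OF subspace_filt] subspace_scale[OF subspace_filt])

lemma deg_nonneg: "x \<in> derivations \<Longrightarrow> 0 \<le> j \<Longrightarrow> deg j x \<in> nonneg_der"
  unfolding nonneg_der_def
proof (intro CollectI conjI allI ballI deg_derivation)
  fix i v assume "x \<in> derivations" "0 \<le> j" "v \<in> filt i"
  then show "deg j x v \<in> filt i"
    using deg_filt[OF derivation_lin, of x v i j] filt_antimono[of i "i + j"] by auto
qed

lemma deg_pos: "x \<in> derivations \<Longrightarrow> 0 < j \<Longrightarrow> deg j x \<in> pos_der"
  unfolding pos_der_def
proof (intro CollectI conjI allI ballI deg_derivation)
  fix i v assume "x \<in> derivations" "0 < j" "v \<in> filt i"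
  then show "deg j x v \<in> filt (i + 1)"
    using deg_filt[OF derivation_lin, of x v i j] filt_antimono[of "i + 1" "i + j"] by auto
qed

lemma pos_der_nilpotent: "x \<in> pos_der \<Longrightarrow> (x ^^ nat (2 * M + 1)) v = 0"
proof -
  assume x: "x \<in> pos_der"
  have "(x ^^ n) v \<in> filt (- M + int n)" for n
  proof (induction n)
    case 0 show ?case using filt_bottom by simp
  next
    case (Suc n)
    then have "x ((x ^^ n) v) \<in> filt (- M + int n + 1)" using x by (simp add: pos_der_def)
    then show ?case by (simp add: ac_simps)
  qed
  from this[of "nat (2 * M + 1)"] show ?thesis using filt_top M by simp
qed

section \<open>Orthogonality for the trace form\<close>

lemma deg_trace_radical:
  assumes y: "y \<in> derivations" and "\<And>d. d \<in> derivations \<Longrightarrow> tr (\<lambda>v. deg (- j) d (y v)) = 0"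
  shows "deg j y \<in> trace_radical"
  unfolding trace_radical_def
proof (intro CollectI conjI ballI)
  show D: "deg j y \<in> derivations" by (rule deg_derivation[OF y])
  fix d assume d: "d \<in> derivations"
  have "tr (\<lambda>v. deg j y (d v)) = tr (\<lambda>v. d (deg j y v))"
    by (rule tr_commute[OF derivation_lin[OF D] derivation_lin[OF d]])
  also have "\<dots> = tr (\<lambda>v. deg (- j) d (y v))"
    by (rule tr_deg[OF derivation_lin[OF d] derivation_lin[OF y]])
  finally show "tr (\<lambda>v. deg j y (d v)) = 0" using assms(2)[OF d] by simp
qed

lemma sum_deg_split:
  assumes y: "lin y" and "\<And>j. j < a \<Longrightarrow> deg j y \<in> trace_radical"
    and "Op.subspace S" "\<And>j. a \<le> j \<Longrightarrow> deg j y \<in> S"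
  shows "\<exists>n\<in>S. \<exists>r\<in>trace_radical. y = (\<lambda>v. n v + r v)"
proof (intro bexI)
  let ?J = "{-2*M..2*M}"
  have J: "?J = (?J \<inter> {a..}) \<union> (?J \<inter> {..<a})" by auto
  have "y v = (\<Sum>j\<in>?J \<inter> {a..}. deg j y) v + (\<Sum>j\<in>?J \<inter> {..<a}. deg j y) v" for v
  proof -
    have "(\<Sum>j\<in>(?J \<inter> {a..}) \<union> (?J \<inter> {..<a}). deg j y v)
        = (\<Sum>j\<in>?J \<inter> {a..}. deg j y v) + (\<Sum>j\<in>?J \<inter> {..<a}. deg j y v)"
      by (rule sum.union_disjoint) auto
    then show ?thesis unfolding sum_fun_apply J[symmetric] sum_deg[OF y] .
  qed
  then show "y = (\<lambda>v. (\<Sum>j\<in>?J \<inter> {a..}. deg j y) v + (\<Sum>j\<in>?J \<inter> {..<a}. deg j y) v)" by blast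
  show "(\<Sum>j\<in>?J \<inter> {..<a}. deg j y) \<in> trace_radical"
    by (rule Op.subspace_sum[OF subspace_trace_radical]) (use assms(2) in auto)
  show "(\<Sum>j\<in>?J \<inter> {a..}. deg j y) \<in> S"
    by (rule Op.subspace_sum[OF assms(3)]) (use assms(4) in auto)
qed

text \<open>By \<open>tr_deg\<close> a component of \<open>y\<close> of degree at most 0 pairs only
  with derivations of nonnegative degree, to which \<open>y\<close> is orthogonal. It thus lies in
  \<open>trace_radical\<close>, and the positive components remain.\<close>

lemma orthogonal_nonneg_der:
  assumes y: "y \<in> derivations" and "\<And>u. u \<in> nonneg_der \<Longrightarrow> tr (\<lambda>v. u (y v)) = 0"
  shows "\<exists>n\<in>pos_der. \<exists>r\<in>trace_radical. y = (\<lambda>v. n v + r v)"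
proof (rule sum_deg_split[OF derivation_lin[OF y] _ subspace_pos_der])
  show "deg j y \<in> trace_radical" if "j < 1" for j
    using that by (intro deg_trace_radical[OF y] assms(2) deg_nonneg) auto
  show "deg j y \<in> pos_der" if "1 \<le> j" for j using that by (intro deg_pos[OF y]) simp
qed

lemma orthogonal_pos_der:
  assumes y: "y \<in> derivations" and "\<And>u. u \<in> pos_der \<Longrightarrow> tr (\<lambda>v. u (y v)) = 0"
  shows "\<exists>q\<in>nonneg_der. \<exists>r\<in>trace_radical. y = (\<lambda>v. q v + r v)"
proof (rule sum_deg_split[OF derivation_lin[OF y] _ subspace_nonneg_der])
  show "deg j y \<in> trace_radical" if "j < 0" for j
    using that by (intro deg_trace_radical[OF y] assms(2) deg_pos) auto
  show "deg j y \<in> nonneg_der" if "0 \<le> j" for j using that by (intro deg_nonneg[OF y]) simp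
qed

text \<open>Only the diagonal part \<open>deg 0 q\<close> contributes, since \<open>h\<close> has
  degree 0. It inherits nilpotency from the block triangular \<open>q\<close> and commutes with
  \<open>h\<close>, so its product with \<open>h\<close> is nilpotent.\<close>

lemma tr_h_nilpotent:
  assumes q: "q \<in> nonneg_der" and nil: "\<And>v. (q ^^ m) v = 0"
  shows "tr (\<lambda>v. h (q v)) = 0"
proof -
  have ql: "lin q" using q derivation_lin by (auto simp: nonneg_der_def)
  have qf: "q v \<in> filt i" if "v \<in> filt i" for v i using q that by (auto simp: nonneg_der_def)
  \<comment> \<open>Diagonal blocks of powers of a block triangular operator are powers of the
    blocks: what \<open>q\<close> moves to higher filtration never returns to degree
    \<open>i\<close>.\<close>
  have pow: "p i ((deg 0 q ^^ k) v) = p i ((q ^^ k) (p i v))" for i k v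
  proof (induction k)
    case (Suc k)
    define w where "w = (q ^^ k) (p i v)"
    have w: "w \<in> filt i" unfolding w_def by (induction k) (auto simp: p_filt intro: qf)
    have "q (w - p i w) \<in> filt (i + 1)" by (intro qf diff_p_filt w)
    then have "p i (q (w - p i w)) = 0" by (simp add: filt_def)
    then have "p i (q (p i w)) = p i (q w)" by (simp add: lin_diff[OF ql] p_simps)
    then show ?case using Suc by (simp add: p_deg[OF ql] w_def)
  qed (simp add: p_p)
  have q0: "(deg 0 q ^^ m) v = 0" for v
    by (rule p_eqI) (simp add: pow nil p_simps)
  have comm: "h (deg 0 q v) = deg 0 q (h v)" for v using h_deg[OF ql, of 0 v] by simp
  have "((\<lambda>v. h (deg 0 q v)) ^^ k) v = (h ^^ k) ((deg 0 q ^^ k) v)" for k v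
  proof (induction k)
    case (Suc k)
    have "deg 0 q ((h ^^ k) w) = (h ^^ k) (deg 0 q w)" for w
      by (induction k) (simp_all add: comm[symmetric])
    then show ?case using Suc by simp
  qed simp
  then have "((\<lambda>v. h (deg 0 q v)) ^^ m) v = 0" for v
    by (simp add: q0 lin_zero[OF lin_funpow[OF lin_h]])
  then have "tr (\<lambda>v. h (deg 0 q v)) = 0"
    by (rule tr_nilpotent[OF lin_comp[OF lin_h lin_deg[OF ql]]])
  then show ?thesis using tr_deg[OF lin_h ql, of 0] by (simp add: deg_0_h)
qed

end

section \<open>Conjugation by exponentials\<close>

context fd_lie
begin

lemma automorphism_D:
  assumes "\<Phi> \<in> automorphisms"
  shows "lin \<Phi>" "bij \<Phi>" "\<Phi> (bracket x y) = bracket (\<Phi> x) (\<Phi> y)"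
    "\<Phi> (inv_into UNIV \<Phi> x) = x" "inv_into UNIV \<Phi> (\<Phi> x) = x"
  using assms
  by (auto simp: automorphisms_def surj_f_inv_f[OF bij_is_surj] inv_f_f[OF bij_is_inj])

lemma automorphism_id: "(\<lambda>v. v) \<in> automorphisms"
  by (auto simp: automorphisms_def lin_id bij_def)

lemma automorphism_comp:
  assumes "\<Phi> \<in> automorphisms" "\<Psi> \<in> automorphisms"
  shows "(\<lambda>v. \<Phi> (\<Psi> v)) \<in> automorphisms"
proof -
  have "bij (\<lambda>v. \<Phi> (\<Psi> v))"
    using bij_comp[OF automorphism_D(2)[OF assms(2)] automorphism_D(2)[OF assms(1)]]
    by (simp add: comp_def)
  then show ?thesis
    using lin_comp[OF automorphism_D(1)[OF assms(1)] automorphism_D(1)[OF assms(2)]]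
    by (simp add: automorphisms_def automorphism_D(3)[OF assms(1)] automorphism_D(3)[OF assms(2)])
qed

lemma automorphism_inv:
  assumes "\<Phi> \<in> automorphisms"
  shows "inv_into UNIV \<Phi> \<in> automorphisms"
proof -
  note \<Phi> = automorphism_D[OF assms]
  have inj: "x = y" if "\<Phi> x = \<Phi> y" for x y using that bij_is_inj[OF \<Phi>(2)] by (simp add: inj_eq)
  have "lin (inv_into UNIV \<Phi>)"
    by (rule linI; rule inj) (simp_all add: lin_add[OF \<Phi>(1)] lin_scale[OF \<Phi>(1)] \<Phi>(4))
  moreover have "inv_into UNIV \<Phi> (bracket x y) = bracket (inv_into UNIV \<Phi> x) (inv_into UNIV \<Phi> y)" for x y
    by (rule inj) (simp add: \<Phi>(3,4))
  ultimately show ?thesis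
    using bij_imp_bij_inv[OF \<Phi>(2)] by (simp add: automorphisms_def)
qed

lemma derivation_conjugate:
  assumes "\<Phi> \<in> automorphisms" "x \<in> derivations"
  shows "(\<lambda>v. \<Phi> (x (inv_into UNIV \<Phi> v))) \<in> derivations"
proof -
  note \<Phi> = automorphism_D[OF assms(1)] and \<Psi> = automorphism_D[OF automorphism_inv[OF assms(1)]]
  have "lin (\<lambda>v. \<Phi> (x (inv_into UNIV \<Phi> v)))"
    by (rule lin_comp[OF \<Phi>(1) lin_comp[OF derivation_lin[OF assms(2)] \<Psi>(1)]])
  then show ?thesis
    by (simp add: derivations_def \<Psi>(3) derivation_bracket[OF assms(2)] \<Phi>(3,4) lin_add[OF \<Phi>(1)])
qed

definition divided_power :: "('g \<Rightarrow> 'g) \<Rightarrow> nat \<Rightarrow> 'g \<Rightarrow> 'g" where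
  "divided_power u k v = inverse (fact k) *s (u ^^ k) v"

lemma lin_divided_power: "lin u \<Longrightarrow> lin (divided_power u k)"
  unfolding divided_power_def[abs_def] by (intro lin_smult lin_funpow)

lemma divided_power_Suc:
  "lin u \<Longrightarrow> u (divided_power u k v) = of_nat (Suc k) *s divided_power u (Suc k) v"
proof -
  assume u: "lin u"
  have "of_nat (Suc k) * inverse (fact (Suc k)) = (inverse (fact k) :: 'k)"
    by (simp add: fact_Suc field_simps del: of_nat_Suc)
  then show ?thesis by (simp add: divided_power_def lin_scale[OF u] del: of_nat_Suc fact_Suc)
qed

text \<open>With the factorials absorbed, the Leibniz rule has no binomial coefficients. The
  induction step is proved after multiplication by \<open>Suc k\<close>, split as
  \<open>i + (Suc k - i)\<close> on each term, and this factor is cancelled in characteristic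
  zero.\<close>

lemma divided_power_bracket:
  assumes u: "u \<in> derivations"
  shows "divided_power u k (bracket v w) =
    (\<Sum>i\<le>k. bracket (divided_power u i v) (divided_power u (k - i) w))"
proof (induction k)
  case 0 show ?case by (simp add: divided_power_def)
next
  case (Suc k)
  note ul = derivation_lin[OF u]
  let ?b = "\<lambda>i. bracket (divided_power u i v) (divided_power u (Suc k - i) w)"
  have "of_nat (Suc k) *s divided_power u (Suc k) (bracket v w) =
      (\<Sum>i\<le>k. u (bracket (divided_power u i v) (divided_power u (k - i) w)))"
    unfolding divided_power_Suc[OF ul, symmetric] Suc lin_sum[OF ul] ..
  also have "\<dots> = (\<Sum>i\<le>k. of_nat (Suc i) *s ?b (Suc i)) + (\<Sum>i\<le>k. of_nat (Suc k - i) *s ?b i)"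
    unfolding sum.distrib[symmetric]
    by (rule sum.cong) (simp_all add: derivation_bracket[OF u] divided_power_Suc[OF ul]
        bracket_scale_left bracket_scale_right Suc_diff_le del: of_nat_Suc)
  also have "(\<Sum>i\<le>k. of_nat (Suc i) *s ?b (Suc i)) = (\<Sum>i\<le>Suc k. of_nat i *s ?b i)"
    by (subst sum.atMost_Suc_shift) simp
  also have "(\<Sum>i\<le>k. of_nat (Suc k - i) *s ?b i) = (\<Sum>i\<le>Suc k. of_nat (Suc k - i) *s ?b i)"
    by simp
  also have "(\<Sum>i\<le>Suc k. of_nat i *s ?b i) + (\<Sum>i\<le>Suc k. of_nat (Suc k - i) *s ?b i) =
      (\<Sum>i\<le>Suc k. of_nat (Suc k) *s ?b i)"
    unfolding sum.distrib[symmetric] scale_left_distrib[symmetric]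
    by (rule sum.cong) (simp_all only: of_nat_add[symmetric] atMost_iff le_add_diff_inverse)
  also have "\<dots> = of_nat (Suc k) *s (\<Sum>i\<le>Suc k. ?b i)" by (simp only: scale_sum_right)
  finally show ?case by (simp only: scale_cancel_left of_nat_eq_0_iff) simp
qed

text \<open>The series is cut off at \<open>q\<close>, so it is the exponential exactly when the
  divided powers of \<open>u\<close> from \<open>q\<close> on sum to nothing; all uses have
  \<open>u ^^ q\<close> equal to zero.\<close>

definition exponential :: "nat \<Rightarrow> ('g \<Rightarrow> 'g) \<Rightarrow> 'g \<Rightarrow> 'g" where
  "exponential q u v = (\<Sum>k<q. divided_power u k v)"

lemma lin_exponential: "lin u \<Longrightarrow> lin (exponential q u)"
  unfolding exponential_def[abs_def] by (intro lin_sums lin_divided_power)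

lemma exponential_bracket:
  assumes u: "u \<in> derivations" and nil: "\<And>v. (u ^^ q) v = 0"
  shows "exponential q u (bracket v w) = bracket (exponential q u v) (exponential q u w)"
proof -
  note ul = derivation_lin[OF u]
  have zero: "divided_power u k v = 0" if "q \<le> k" for k v
  proof -
    have "(u ^^ k) v = (u ^^ (k - q + q)) v" using that by simp
    also have "\<dots> = 0" unfolding funpow_add comp_apply nil by (rule lin_zero[OF lin_funpow[OF ul]])
    finally show ?thesis by (simp add: divided_power_def)
  qed
  let ?b = "\<lambda>i j. bracket (divided_power u i v) (divided_power u j w)"
  have "bracket (exponential q u v) (exponential q u w) = (\<Sum>i<q. \<Sum>j<q. ?b i j)"
    unfolding exponential_def bracket_sum_left by (simp add: bracket_sum_right)
  also have "\<dots> = (\<Sum>(i, j)\<in>{..<q} \<times> {..<q}. ?b i j)" by (simp add: sum.cartesian_product)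
  \<comment> \<open>The square is enlarged to the triangle \<open>i + j < 2 * q\<close>, which can
    be summed along diagonals. The extra terms have an index of at least \<open>q\<close> and
    vanish.\<close>
  also have "\<dots> = (\<Sum>(i, j)\<in>{(i, j). i + j < 2 * q}. ?b i j)"
  proof (rule sum.mono_neutral_left)
    have "{(i, j). i + j < 2 * q} \<subseteq> {..<2 * q} \<times> {..<2 * q}" by auto
    then show "finite {(i, j). i + j < 2 * q}" by (rule finite_subset) simp
    have b: "?b i j = 0" if "\<not> (i < q \<and> j < q)" for i j
      using that zero[of i v] zero[of j w] by (auto simp: bracket_simps not_less)
    show "\<forall>x\<in>{(i, j). i + j < 2 * q} - {..<q} \<times> {..<q}. (case x of (i, j) \<Rightarrow> ?b i j) = 0"
    proof
      fix x assume "x \<in> {(i, j). i + j < 2 * q} - {..<q} \<times> {..<q}"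
      then have "\<not> (fst x < q \<and> snd x < q)" by (cases x) simp
      then show "(case x of (i, j) \<Rightarrow> ?b i j) = 0" unfolding split_beta by (rule b)
    qed
  qed auto
  also have "\<dots> = (\<Sum>k<2 * q. \<Sum>i\<le>k. ?b i (k - i))" by (rule sum.triangle_reindex)
  also have "\<dots> = (\<Sum>k<2 * q. divided_power u k (bracket v w))"
    by (simp add: divided_power_bracket[OF u])
  also have "\<dots> = exponential q u (bracket v w)"
    unfolding exponential_def by (rule sum.mono_neutral_right) (auto simp: zero)
  finally show ?thesis by simp
qed

end

text \<open>Two flags of graded subspaces occur: the one that Engel's theorem gives for a nilpotent
  Lie algebra of derivations, and the filtration of the grading itself.\<close>

locale stable_flag = int_graded scale bracket Basis p M
  for scale :: "'k::field_char_0 \<Rightarrow> 'g::ab_group_add \<Rightarrow> 'g" (infixr \<open>*s\<close> 75)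
    and bracket :: "'g \<Rightarrow> 'g \<Rightarrow> 'g" and Basis :: "'g set" and p M +
  fixes V :: "nat \<Rightarrow> 'g set" and Q :: nat
  assumes V_subspace: "subspace (V n)" and V_0: "V 0 = UNIV" and V_Suc: "V (Suc n) \<subseteq> V n"
    and V_top: "V Q \<subseteq> {0}" and V_p: "v \<in> V n \<Longrightarrow> p i v \<in> V n"
begin

lemma V_antimono: "m \<le> n \<Longrightarrow> V n \<subseteq> V m"
  by (rule lift_Suc_antimono_le[of V, OF V_Suc])

lemmas V_closed = subspace_add[OF V_subspace] subspace_diff[OF V_subspace]
  subspace_scale[OF V_subspace] subspace_0[OF V_subspace] subspace_neg[OF V_subspace]

definition lowering :: "nat \<Rightarrow> ('g \<Rightarrow> 'g) set" where
  "lowering k = {f. lin f \<and> (\<forall>n. \<forall>v\<in>V n. f v \<in> V (n + k))}"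

lemma loweringD: "f \<in> lowering k \<Longrightarrow> v \<in> V n \<Longrightarrow> f v \<in> V (n + k)"
  by (simp add: lowering_def)

lemma lowering_antimono: "j \<le> k \<Longrightarrow> f \<in> lowering k \<Longrightarrow> f \<in> lowering j"
proof -
  assume "j \<le> k" "f \<in> lowering k"
  moreover from this have "V (n + k) \<subseteq> V (n + j)" for n by (intro V_antimono) simp
  ultimately show ?thesis unfolding lowering_def by blast
qed

lemma lowering_zero: "f \<in> lowering k \<Longrightarrow> Q \<le> k \<Longrightarrow> f v = 0"
  using loweringD[of f k v 0] V_0 V_antimono[of Q k] V_top by auto

lemma lowering_funpow: "f \<in> lowering k \<Longrightarrow> f ^^ i \<in> lowering (i * k)"
proof (induction i)
  case 0 then show ?case by (simp add: lowering_def lin_id id_def)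
next
  case (Suc i)
  then have "f ((f ^^ i) v) \<in> V (n + i * k + k)" if "v \<in> V n" for v n
    using that loweringD by blast
  then show ?case
    using Suc lin_funpow[of f "Suc i"] by (simp add: lowering_def comp_def ac_simps)
qed

lemma lowering_deg: "m \<in> lowering k \<Longrightarrow> deg j m \<in> lowering k"
  unfolding lowering_def deg_def[abs_def] mem_Collect_eq
  by (auto intro!: subspace_sum[OF V_subspace] V_p lin_sums lin_comp[OF p_lin] lin_comp[OF _ p_lin])

lemma V_h: "v \<in> V n \<Longrightarrow> h v \<in> V n"
  unfolding h_def by (intro subspace_sum[OF V_subspace] V_closed V_p)

text \<open>Since \<open>1 \<le> k\<close>, every term of order at least 2 in \<open>u\<close>
  descends at least \<open>Suc k\<close> steps. \<open>E\<close> is the identity modulo the next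
  step of the flag, hence injective, hence bijective in finite dimension.\<close>

lemma exponential_lowering:
  assumes u: "u \<in> derivations" "u \<in> lowering k" and k: "1 \<le> k"
  obtains E e where "E \<in> automorphisms" "\<And>v. E v = v + u v + e v" "e \<in> lowering (Suc k)"
    "\<And>v n. v \<in> V n \<Longrightarrow> inv_into UNIV E v \<in> V n"
proof -
  note ul = derivation_lin[OF u(1)]
  \<comment> \<open>The two extra terms keep the constant and linear parts in the sum even if
    \<open>Q\<close> is 0; the other \<open>Q\<close> terms form \<open>e\<close>.\<close>
  define E where "E = exponential (Suc (Suc Q)) u"
  define e where "e v = (\<Sum>i<Q. divided_power u (Suc (Suc i)) v)" for v
  have Ev: "E v = v + u v + e v" for v
    unfolding E_def e_def exponential_def sum.lessThan_Suc_shift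
    by (simp add: divided_power_def)
  have nil: "(u ^^ Suc (Suc Q)) v = 0" for v
    by (rule lowering_zero[OF lowering_funpow[OF u(2)]]) (use mult_le_mono2[OF k, of "Suc (Suc Q)"] in simp)
  have linE: "lin E" unfolding E_def by (rule lin_exponential[OF ul])
  have "lin e" unfolding e_def[abs_def] by (intro lin_sums lin_divided_power ul)
  moreover have "e v \<in> V (n + Suc k)" if "v \<in> V n" for n v
    unfolding e_def
  proof (rule subspace_sum[OF V_subspace])
    fix i
    have "(u ^^ Suc (Suc i)) v \<in> V (n + Suc (Suc i) * k)"
      by (rule loweringD[OF lowering_funpow[OF u(2)] that])
    then have "(u ^^ Suc (Suc i)) v \<in> V (n + Suc k)"
      using V_antimono[of "n + Suc k" "n + Suc (Suc i) * k"] k by auto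
    then show "divided_power u (Suc (Suc i)) v \<in> V (n + Suc k)"
      unfolding divided_power_def by (rule V_closed(3))
  qed
  ultimately have e: "e \<in> lowering (Suc k)" by (simp add: lowering_def)
  have diff: "E v - v \<in> V (Suc n)" if "v \<in> V n" for v n
  proof -
    have "u v \<in> V (n + 1)" using loweringD[OF lowering_antimono[OF k u(2)] that] .
    moreover have "e v \<in> V (n + 1)" using loweringD[OF lowering_antimono[OF _ e, of 1] that] by simp
    ultimately show ?thesis using V_closed(1)[of "u v" "n + 1" "e v"] by (simp add: Ev)
  qed
  have "v = 0" if "E v = 0" for v
  proof -
    have "v \<in> V n" for n
    proof (induction n)
      case (Suc n)
      from diff[OF this] that show ?case using V_closed(5)[of "- v" "Suc n"] by simp
    qed (simp add: V_0)
    then show ?thesis using V_top by blast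
  qed
  then have injE: "inj E"
    by (auto simp: inj_def) (metis eq_iff_diff_eq_0 lin_diff[OF linE])
  then have "bij E" using linear_inj_imp_surj[OF linE] by (simp add: bij_def)
  then have aut: "E \<in> automorphisms"
    using exponential_bracket[OF u(1) nil] linE by (auto simp: automorphisms_def E_def)
  note autD = automorphism_D[OF aut]
  have "inv_into UNIV E w \<in> V n" if w: "w \<in> V n" for w n
  proof -
    have "m \<le> n \<Longrightarrow> inv_into UNIV E w \<in> V m" for m
    proof (induction m)
      case (Suc m)
      then have "E (inv_into UNIV E w) - inv_into UNIV E w \<in> V (Suc m)" by (intro diff) simp
      moreover have "w \<in> V (Suc m)" using w V_antimono[OF Suc.prems] by blast
      ultimately have "w - (E (inv_into UNIV E w) - inv_into UNIV E w) \<in> V (Suc m)" by (rule_tac V_closed(2))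
      then show ?case by (simp add: autD(4))
    qed (simp add: V_0)
    then show ?thesis by simp
  qed
  with aut Ev e that show thesis by blast
qed

text \<open>A normal form along the flag. The part of \<open>m\<close> that does not commute with
  \<open>h\<close> is removed by the exponential of a \<open>u\<close> whose commutator with
  \<open>h\<close> is that part; the new error lies one step deeper, so \<open>Q - k\<close>
  decreases. What commutes with \<open>h\<close> is collected in \<open>z\<close>.\<close>

lemma conjugate_to_commuting_aux:
  assumes "z \<in> derivations" "z \<in> lowering 1" "\<And>v. h (z v) = z (h v)"
    and "m \<in> derivations" "m \<in> lowering k" "1 \<le> k"
  shows "\<exists>\<Phi>\<in>automorphisms. \<exists>z'\<in>lowering 1. (\<forall>v. h (z' v) = z' (h v)) \<and>
    (\<forall>v. \<Phi> (h v + z v + m v) = h (\<Phi> v) + z' (\<Phi> v))"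
  using assms
proof (induction "Q - k" arbitrary: k z m rule: less_induct)
  case less
  note z = less.prems(1,2,3) and m = less.prems(4,5) and k = less.prems(6)
  show ?case
  proof (cases "Q \<le> k")
    case True
    then have "m v = 0" for v using lowering_zero[OF m(2)] by blast
    then show ?thesis using automorphism_id z by (intro bexI[of _ "\<lambda>v. v"] bexI[of _ z]) auto
  next
    case False
    note ml = derivation_lin[OF m(1)] and zl = derivation_lin[OF z(1)]
    let ?J = "{-2*M..2*M}"
    \<comment> \<open>Taking the commutator with \<open>h\<close> multiplies degree \<open>j\<close>
      by \<open>j\<close>, so it can be inverted on all components of nonzero degree.\<close>
    define u where "u v = (\<Sum>j\<in>?J - {0}. inverse (of_int j) *s deg j m v)" for v
    define m0 where "m0 = deg 0 m"
    have u: "u \<in> derivations" unfolding u_def[abs_def]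
      by (intro derivation_sum derivation_smult deg_derivation m)
    note ul = derivation_lin[OF u]
    have uL: "u \<in> lowering k"
      unfolding lowering_def mem_Collect_eq
    proof (intro conjI ul allI ballI)
      fix n v assume "v \<in> V n"
      then show "u v \<in> V (n + k)"
        unfolding u_def by (intro subspace_sum[OF V_subspace] V_closed loweringD[OF lowering_deg[OF m(2)]])
    qed
    have m0: "m0 \<in> derivations" "m0 \<in> lowering k" "\<And>v. h (m0 v) = m0 (h v)"
      using deg_derivation[OF m(1)] lowering_deg[OF m(2)] h_deg[OF ml, of 0] by (simp_all add: m0_def)
    note m0l = derivation_lin[OF m0(1)]
    have hu: "u (h v) - h (u v) = m0 v - m v" for v
    proof -
      have "h (u v) - u (h v) = (\<Sum>j\<in>?J - {0}. inverse (of_int j) *s (h (deg j m v) - deg j m (h v)))"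
        by (simp only: u_def lin_sum[OF lin_h] lin_scale[OF lin_h] sum_subtractf[symmetric]
            scale_right_diff_distrib)
      also have "\<dots> = (\<Sum>j\<in>?J - {0}. deg j m v)"
        by (rule sum.cong) (simp_all add: h_deg[OF ml])
      also have "\<dots> = (\<Sum>j\<in>?J. deg j m v) - m0 v"
        using M by (subst sum.remove[of ?J 0]) (simp_all add: m0_def)
      also have "\<dots> = m v - m0 v" by (simp only: sum_deg[OF ml])
      finally show ?thesis by (simp add: algebra_simps)
    qed
    obtain E e where E: "E \<in> automorphisms" "\<And>v. E v = v + u v + e v" "e \<in> lowering (Suc k)"
      "\<And>v n. v \<in> V n \<Longrightarrow> inv_into UNIV E v \<in> V n"
      using exponential_lowering[OF u uL k] by blast
    note autE = automorphism_D[OF E(1)]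
    define x where "x v = h v + z v + m v" for v
    have x: "x \<in> derivations"
      unfolding x_def[abs_def] by (intro derivation_plus h_derivation z(1) m(1))
    define z' where "z' v = z v + m0 v" for v
    have z'D: "z' \<in> derivations" unfolding z'_def[abs_def] by (intro derivation_plus z(1) m0(1))
    have z'V: "z' v \<in> V (n + 1)" if "v \<in> V n" for v n
      unfolding z'_def
      by (intro V_closed(1) loweringD[OF z(2) that] loweringD[OF lowering_antimono[OF k m0(2)] that])
    have z'L: "z' \<in> lowering 1"
      using z'V derivation_lin[OF z'D] by (simp add: lowering_def)
    have z'h: "h (z' v) = z' (h v)" for v
      by (simp add: z'_def lin_add[OF lin_h] z(3) m0(3))
    define m' where "m' v = E (x (inv_into UNIV E v)) - (h v + z' v)" for v
    have m'D: "m' \<in> derivations"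
      unfolding m'_def[abs_def]
      by (intro derivation_minus derivation_conjugate E(1) x derivation_plus h_derivation z'D)
    have m'V: "m' w \<in> V (n + Suc k)" if w: "w \<in> V n" for w n
    proof -
      define a where "a = inv_into UNIV E w"
      have a: "a \<in> V n" "w = E a" unfolding a_def using E(4)[OF w] autE(4) by auto
      have zm: "z a + m a \<in> V (n + 1)"
        by (intro V_closed(1) loweringD[OF z(2) a(1)] loweringD[OF lowering_antimono[OF k m(2)] a(1)])
      have t1: "u (z a + m a) \<in> V (n + Suc k)" using loweringD[OF uL zm] by simp
      have t2: "z' (u a) \<in> V (n + Suc k)" using z'V[OF loweringD[OF uL a(1)]] by simp
      have "x a \<in> V n"
        unfolding x_def using V_h[OF a(1)] zm V_antimono[of n "n + 1"] V_closed(1)[of "h a" n "z a + m a"]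
        by (auto simp: add.assoc)
      then have t3: "e (x a) \<in> V (n + Suc k)" by (rule loweringD[OF E(3)])
      have ea: "e a \<in> V (n + Suc k)" by (rule loweringD[OF E(3) a(1)])
      have t4: "h (e a) + z' (e a) \<in> V (n + Suc k)"
        using V_h[OF ea] z'V[OF ea] V_Suc[of "n + Suc k"] by (auto intro!: V_closed(1))
      have "m' w = E (x a) - (h (E a) + z' (E a))" by (simp add: m'_def a_def[symmetric] a(2)[symmetric])
      \<comment> \<open>The first group cancels by \<open>hu\<close>. Each other term contains
        \<open>e\<close>, or \<open>u\<close> together with one of \<open>z\<close>,
        \<open>m\<close> and \<open>z'\<close>, and so descends at least \<open>Suc k\<close>
        steps.\<close>
      also have "\<dots> = (m a - m0 a + (u (h a) - h (u a))) + (u (z a + m a) - z' (u a))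
          + (e (x a) - (h (e a) + z' (e a)))"
        by (simp add: E(2) x_def lin_add[OF lin_h] lin_add[OF ul] lin_add[OF derivation_lin[OF z'D]])
          (simp add: z'_def algebra_simps)
      also have "\<dots> = (u (z a + m a) - z' (u a)) + (e (x a) - (h (e a) + z' (e a)))"
        by (simp add: hu)
      also have "\<dots> \<in> V (n + Suc k)"
        by (rule V_closed(1)[OF V_closed(2)[OF t1 t2] V_closed(2)[OF t3 t4]])
      finally show ?thesis .
    qed
    then have m'L: "m' \<in> lowering (Suc k)"
      using derivation_lin[OF m'D] by (simp add: lowering_def)
    obtain \<Phi> z'' where \<Phi>: "\<Phi> \<in> automorphisms" "z'' \<in> lowering 1" "\<And>v. h (z'' v) = z'' (h v)"
      "\<And>v. \<Phi> (h v + z' v + m' v) = h (\<Phi> v) + z'' (\<Phi> v)"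
      using less.hyps[OF _ z'D z'L z'h m'D m'L] False k by (metis diff_less_mono2 le_SucI lessI not_le)
    have "\<Phi> (E (x v)) = h (\<Phi> (E v)) + z'' (\<Phi> (E v))" for v
      using \<Phi>(4)[of "E v"] by (simp add: m'_def autE(5))
    then show ?thesis
      using automorphism_comp[OF \<Phi>(1) E(1)] \<Phi>(2,3) unfolding x_def
      by (intro bexI[of _ "\<lambda>v. \<Phi> (E v)"] bexI[of _ z'']) auto
  qed
qed

lemma conjugate_to_commuting:
  assumes x: "x \<in> derivations" and xh: "\<And>v n. v \<in> V n \<Longrightarrow> x v - h v \<in> V (Suc n)"
  obtains \<Phi> z m where "\<Phi> \<in> automorphisms" "lin z" "\<And>v. h (z v) = z (h v)"
    "\<And>v. (z ^^ m) v = 0" "\<And>v. \<Phi> (x v) = h (\<Phi> v) + z (\<Phi> v)"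
proof -
  have D: "(\<lambda>v. x v - h v) \<in> derivations" by (intro derivation_minus x h_derivation)
  have L: "(\<lambda>v. x v - h v) \<in> lowering 1"
    using xh derivation_lin[OF D] by (simp add: lowering_def)
  have zero: "(\<lambda>v. 0) \<in> derivations" "(\<lambda>v. 0) \<in> lowering 1"
    using Op.subspace_0[OF subspace_derivations] lin_const_zero
    by (simp_all add: zero_fun_def lowering_def V_closed)
  obtain \<Phi> z where \<Phi>: "\<Phi> \<in> automorphisms" "z \<in> lowering 1" "\<And>v. h (z v) = z (h v)"
    "\<And>v. \<Phi> (h v + 0 + (x v - h v)) = h (\<Phi> v) + z (\<Phi> v)"
    using conjugate_to_commuting_aux[OF zero _ D L] by (auto simp: lin_zero[OF lin_h])
  have "(z ^^ Q) v = 0" for v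
    by (rule lowering_zero[OF lowering_funpow[OF \<Phi>(2)]]) simp
  then show thesis using that[of \<Phi> z Q] \<Phi> by (simp add: lowering_def)
qed

end

section \<open>Any two integer gradings are compatible up to conjugation\<close>

lemma (in int_graded) commute_p:
  assumes z_lin: "lin z" and h_z: "\<And>v. h (z v) = z (h v)"
  shows "z (p i v) = p i (z v)"
proof (rule p_eqI)
  fix l
  have fix_p: "p j (z (p j w)) = z (p j w)" for j w
  proof (rule eigenvector_of_h)
    show "h (z (p j w)) = of_int j *s z (p j w)"
      by (simp add: h_z h_p lin_scale[OF z_lin])
  qed
  have "p l (z (p i v)) = p l (p i (z (p i v)))" by (simp only: fix_p)
  moreover have "p i (z v) = z (p i v)"
  proof -
    have "p i (z v) = p i (z (\<Sum>j\<in>{-M..M}. p j v))" by (simp only: p_sum)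
    also have "\<dots> = (\<Sum>j\<in>{-M..M}. p i (p j (z (p j v))))"
      by (simp only: lin_sum[OF z_lin] lin_sum[OF p_lin] fix_p)
    also have "\<dots> = (\<Sum>j\<in>{-M..M}. if j = i then z (p j v) else 0)"
    proof (rule sum.cong)
      fix j show "p i (p j (z (p j v))) = (if j = i then z (p j v) else 0)"
        using p_p[of i j "z (p j v)"] fix_p[of j v] by (cases "j = i") auto
    qed simp
    also have "\<dots> = z (p i v)"
      using sum_p_delta[of "\<lambda>i v. z v"] by (simp add: lin_zero[OF z_lin])
    finally show ?thesis .
  qed
  ultimately show "p l (z (p i v)) = p l (p i (z v))" by simp
qed

text \<open>\<open>h\<close> and \<open>z\<close> are the semisimple and nilpotent parts of
  \<open>h + z\<close>, so \<open>h\<close> is a polynomial in the sum. The consequences for stable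
  subspaces and for commuting operators are derived directly.\<close>

locale graded_plus_nilpotent = int_graded scale bracket Basis p M
  for scale :: "'k::field_char_0 \<Rightarrow> 'g::ab_group_add \<Rightarrow> 'g" (infixr \<open>*s\<close> 75)
    and bracket :: "'g \<Rightarrow> 'g \<Rightarrow> 'g" and Basis :: "'g set" and p M +
  fixes z :: "'g \<Rightarrow> 'g" and m :: nat
  assumes z_lin: "lin z" and h_z: "h (z v) = z (h v)" and z_nilpotent: "(z ^^ m) v = 0"
begin

lemma z_p: "z (p i v) = p i (z v)"
  by (rule commute_p[OF z_lin h_z])

definition shifted :: "int \<Rightarrow> 'g \<Rightarrow> 'g" where
  "shifted l v = h v + z v - of_int l *s v"

lemma lin_shifted: "lin (shifted l)"
  unfolding shifted_def[abs_def] by (intro lin_minus lin_plus lin_h z_lin lin_smult lin_id)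

lemma p_shifted: "p i (shifted l v) = shifted l (p i v)"
  by (simp add: shifted_def p_simps p_h h_p z_p)

lemma p_shifted_funpow: "p i ((shifted l ^^ n) v) = (shifted l ^^ n) (p i v)"
  by (induction n) (simp_all add: p_shifted)

lemma shifted_own: "p i w = w \<Longrightarrow> (shifted i ^^ n) w = (z ^^ n) w"
proof (induction n)
  case (Suc n)
  have "p i ((z ^^ n) w) = (z ^^ n) w" using Suc p_shifted_funpow[where i=i and l=i and n=n and v=w] by simp
  then have "h ((z ^^ n) w) = of_int i *s (z ^^ n) w" using h_p[of i "(z ^^ n) w"] by simp
  then show ?case using Suc by (simp add: shifted_def)
qed simp

text \<open>On degree \<open>i\<close> the operator \<open>shifted l\<close> is the nonzero scalar
  \<open>i - l\<close> plus the nilpotent \<open>z\<close>. Starting from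
  \<open>(z ^^ m) w = 0\<close>, the vectors \<open>(z ^^ k) w\<close> are solved for in turn, down
  to \<open>w\<close> itself.\<close>

lemma shifted_reflects:
  assumes U: "subspace U" "\<And>v. v \<in> U \<Longrightarrow> h v + z v \<in> U"
    and w: "p i w = w" "shifted l w \<in> U" "i \<noteq> l"
  shows "w \<in> U"
proof -
  have stable: "shifted j v \<in> U" if "v \<in> U" for v j
    unfolding shifted_def by (intro subspace_diff[OF U(1)] U(2) subspace_scale[OF U(1)] that)
  let ?c = "of_int i - of_int l :: 'k"
  have hw: "h w = of_int i *s w" using h_p[of i w] w(1) by simp
  then have sw: "shifted l w = ?c *s w + z w" by (simp add: shifted_def algebra_simps)
  have step: "(z ^^ k) w \<in> U" if "(z ^^ Suc k) w \<in> U" for k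
  proof -
    \<comment> \<open>\<open>U\<close> is stable under \<open>h + z\<close>, which does not give
      stability under \<open>z\<close>. On degree \<open>i\<close>, however, \<open>z\<close> acts
      as \<open>shifted i\<close>, and this preserves \<open>U\<close>.\<close>
    have "p i (shifted l w) = shifted l w" by (simp add: p_shifted w(1))
    then have "(z ^^ k) (shifted l w) = (shifted i ^^ k) (shifted l w)" by (simp add: shifted_own)
    moreover have "(shifted i ^^ k) (shifted l w) \<in> U" by (induction k) (auto intro: stable w(2))
    ultimately have "(z ^^ k) (?c *s w + z w) \<in> U" by (simp add: sw)
    moreover have "(z ^^ k) (?c *s w + z w) = ?c *s (z ^^ k) w + (z ^^ Suc k) w"
      by (simp add: lin_add[OF lin_funpow[OF z_lin]] lin_scale[OF lin_funpow[OF z_lin]] funpow_swap1)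
    ultimately have "(?c *s (z ^^ k) w + (z ^^ Suc k) w) - (z ^^ Suc k) w \<in> U"
      using that subspace_diff[OF U(1)] by metis
    then have "?c *s (z ^^ k) w \<in> U" by simp
    then have "inverse ?c *s ?c *s (z ^^ k) w \<in> U" by (rule subspace_scale[OF U(1)])
    then show ?thesis using w(3) by simp
  qed
  have "(z ^^ (m - k)) w \<in> U" for k
  proof (induction k)
    case 0 show ?case by (simp add: z_nilpotent subspace_0[OF U(1)])
  next
    case (Suc k)
    show ?case
    proof (cases "m - k = 0")
      case False
      then have "m - k = Suc (m - Suc k)" by simp
      then show ?thesis using Suc step by metis
    qed (use Suc in simp)
  qed
  from this[of m] show ?thesis by simp
qed

lemma shifted_funpow_reflects:
  assumes U: "subspace U" "\<And>v. v \<in> U \<Longrightarrow> h v + z v \<in> U"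
    and w: "p i w = w" "(shifted l ^^ n) w \<in> U" "i \<noteq> l"
  shows "w \<in> U"
  using w(2)
proof (induction n)
  case (Suc n)
  have "p i ((shifted l ^^ n) w) = (shifted l ^^ n) w" by (simp add: p_shifted_funpow w(1))
  then have "(shifted l ^^ n) w \<in> U"
    using shifted_reflects[OF U, of i _ l] Suc.prems w(3) by simp
  then show ?case by (rule Suc.IH)
qed simp

text \<open>One degree \<open>l\<close> is removed at a time: \<open>shifted l ^^ m\<close> kills
  the component of degree \<open>l\<close>, and by \<open>shifted_funpow_reflects\<close> membership
  in \<open>U\<close> can be pulled back through it on the other degrees. The component of degree
  \<open>l\<close> is what remains of the vector.\<close>

lemma stable_subspace_graded:
  assumes U: "subspace U" "\<And>v. v \<in> U \<Longrightarrow> h v + z v \<in> U" and v: "v \<in> U"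
  shows "p i v \<in> U"
proof -
  have stable: "shifted j v \<in> U" if "v \<in> U" for v j
    unfolding shifted_def by (intro subspace_diff[OF U(1)] U(2) subspace_scale[OF U(1)] that)
  have *: "p i u \<in> U" if "finite I" "u \<in> U" "\<And>i. i \<notin> I \<Longrightarrow> p i u = 0" for I i u
    using that
  proof (induction I arbitrary: u i rule: finite_induct)
    case empty then show ?case by (simp add: subspace_0[OF U(1)])
  next
    case (insert l I)
    define u' where "u' = (shifted l ^^ m) u"
    have "u' \<in> U" unfolding u'_def using insert.prems(1) by (induction m) (auto intro: stable)
    moreover have "p i u' = 0" if "i \<notin> I" for i
    proof (cases "i = l")
      case True
      have "(shifted l ^^ m) (p l u) = (z ^^ m) (p l u)" by (rule shifted_own) (simp add: p_p)
      then show ?thesis by (simp add: True u'_def p_shifted_funpow z_nilpotent)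
    next
      case False
      then have "p i u = 0" using insert.prems(2) that by auto
      then show ?thesis by (simp add: u'_def p_shifted_funpow lin_zero[OF lin_funpow[OF lin_shifted]])
    qed
    ultimately have mem: "p i u' \<in> U" for i by (rule insert.IH)
    have other: "p i u \<in> U" if "i \<noteq> l" for i
    proof (rule shifted_funpow_reflects[OF U _ _ that])
      show "p i (p i u) = p i u" by (simp add: p_p)
      show "(shifted l ^^ m) (p i u) \<in> U" using mem[of i] by (simp add: u'_def p_shifted_funpow)
    qed
    show ?case
    proof (cases "i = l")
      case True
      have "finite (insert l {-M..M})" by simp
      then have "u = (\<Sum>j\<in>insert l {-M..M}. p j u)" by (subst p_sum_superset) auto
      also have "\<dots> = p l u + (\<Sum>j\<in>insert l {-M..M} - {l}. p j u)" by (rule sum.remove) auto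
      finally have "p l u = u - (\<Sum>j\<in>insert l {-M..M} - {l}. p j u)" by (simp add: algebra_simps)
      moreover have "(\<Sum>j\<in>insert l {-M..M} - {l}. p j u) \<in> U"
        by (rule subspace_sum[OF U(1)]) (use other in auto)
      ultimately show ?thesis using True subspace_diff[OF U(1) insert.prems(1)] by metis
    qed (rule other)
  qed
  show ?thesis by (rule *[of "{-M..M}"]) (use v p_out in auto)
qed

text \<open>\<open>a\<close> maps degree \<open>i\<close> into the kernel of
  \<open>shifted i ^^ m\<close>, which is injective on every other degree by
  \<open>shifted_funpow_reflects\<close> for the zero subspace. So \<open>a\<close> preserves
  degrees.\<close>

lemma commute_h:
  assumes a: "lin a" "\<And>v. a (h v + z v) = h (a v) + z (a v)"
  shows "a (h v) = h (a v)"
proof -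
  have shift: "(shifted l ^^ n) (a v) = a ((shifted l ^^ n) v)" for l n v
    by (induction n)
      (simp_all add: shifted_def lin_diff[OF a(1)] lin_scale[OF a(1)] a(2)[symmetric])
  have zero: "p l (a (p i v)) = 0" if "l \<noteq> i" for l i v
  proof -
    have "(shifted i ^^ m) (p i v) = 0" using shifted_own[of i "p i v" m] by (simp add: p_p z_nilpotent)
    then have "(shifted i ^^ m) (p l (a (p i v))) \<in> {0}"
      by (simp add: p_shifted_funpow[symmetric] shift lin_zero[OF a(1)] p_simps)
    then have "p l (a (p i v)) \<in> {0}"
      by (rule_tac shifted_funpow_reflects[OF subspace_single_0 _ _ _ that])
        (simp_all add: p_p lin_zero[OF lin_h] lin_zero[OF z_lin])
    then show ?thesis by simp
  qed
  have comm: "p i (a v) = a (p i v)" for i v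
  proof (rule p_eqI)
    fix l
    have "p l (a (p i v)) = (if l = i then p i (a (p i v)) else 0)" using zero by auto
    moreover have "p i (a v) = p i (a (p i v))"
    proof -
      have "p i (a v) = (\<Sum>j\<in>{-M..M}. p i (a (p j v)))"
        by (simp only: lin_sum[OF a(1), symmetric] lin_sum[OF p_lin, symmetric] p_sum)
      also have "\<dots> = (\<Sum>j\<in>{-M..M}. if j = i then p i (a (p j v)) else 0)"
        by (rule sum.cong) (auto simp: zero)
      also have "\<dots> = p i (a (p i v))"
        using sum_p_delta[of "\<lambda>j v. p i (a v)"] by (simp add: lin_zero[OF a(1)] p_simps)
      finally show ?thesis .
    qed
    ultimately show "p l (p i (a v)) = p l (a (p i v))" by (simp add: p_p)
  qed
  show ?thesis
    by (rule p_eqI) (simp add: p_h comm lin_scale[OF a(1), symmetric])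
qed

end

locale int_graded_pair = int_graded scale bracket Basis p M + B: int_graded scale bracket Basis p' M'
  for scale :: "'k::field_char_0 \<Rightarrow> 'g::ab_group_add \<Rightarrow> 'g" (infixr \<open>*s\<close> 75)
    and bracket :: "'g \<Rightarrow> 'g \<Rightarrow> 'g" and Basis :: "'g set" and p M p' M'
begin

text \<open>By duality for the trace form it is enough that \<open>tr (h y) = 0\<close> whenever \<open>y\<close> is orthogonal to
  both summands. Such a \<open>y\<close> is, modulo the trace radical, both in \<open>B.pos_der\<close>, hence nilpotent,
  and in \<open>nonneg_der\<close>.\<close>

lemma grading_derivation_decomposition:
  obtains n q r where "n \<in> pos_der" "q \<in> B.nonneg_der" "r \<in> trace_radical"
    "\<And>v. h v = n v + q v + r v"
proof -
  define U where "U = {n + q |n q. n \<in> pos_der \<and> q \<in> B.nonneg_der}"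
  have U: "Op.subspace U"
    unfolding U_def by (rule Op.subspace_plus[OF subspace_pos_der B.subspace_nonneg_der])
  have posU: "pos_der \<subseteq> U"
    unfolding U_def using Op.subspace_0[OF B.subspace_nonneg_der] add.right_neutral[symmetric] by blast
  have nonnegU: "B.nonneg_der \<subseteq> U"
    unfolding U_def using Op.subspace_0[OF subspace_pos_der] add.left_neutral[symmetric] by blast
  have UD: "u \<in> derivations" if "u \<in> U" for u
    using that Op.subspace_add[OF subspace_derivations]
    by (auto simp: U_def pos_der_def B.nonneg_der_def)
  obtain C where C: "C \<subseteq> U" "Op.independent C" "U \<subseteq> Op.span C"
    by (rule Op.maximal_independent_subset) (rule that)
  have finC: "finite C" using independent_lin_bound[OF C(2)] C(1) UD derivation_lin by blast
  have Cl: "lin u" if "u \<in> C" for u using that C(1) UD derivation_lin by blast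
  have ker: "tr (\<lambda>v. h (y v)) = 0"
    if y: "y \<in> derivations" and yC: "\<And>u. u \<in> C \<Longrightarrow> tr (\<lambda>v. u (y v)) = 0" for y
  proof -
    have "Op.subspace {u. tr (\<lambda>v. u (y v)) = 0}"
      using tr_scale[of 0] by (auto intro!: Op.subspaceI simp: tr_add tr_scale)
    then have "Op.span C \<subseteq> {u. tr (\<lambda>v. u (y v)) = 0}"
      using yC by (intro Op.span_minimal) auto
    then have yU: "tr (\<lambda>v. u (y v)) = 0" if "u \<in> U" for u using C(3) that by blast
    obtain n' r1 where n': "n' \<in> B.pos_der" "r1 \<in> trace_radical" "y = (\<lambda>v. n' v + r1 v)"
      using B.orthogonal_nonneg_der[OF y] yU nonnegU by blast
    obtain q r2 where q: "q \<in> nonneg_der" "r2 \<in> trace_radical" "y = (\<lambda>v. q v + r2 v)"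
      using orthogonal_pos_der[OF y] yU posU by blast
    have r: "r1 - r2 \<in> trace_radical" using Op.subspace_diff[OF subspace_trace_radical n'(2) q(2)] .
    have qv: "q = (\<lambda>v. n' v + (r1 - r2) v)"
      using n'(3) q(3) by (auto simp: fun_eq_iff) (metis add_diff_eq add_diff_cancel)
    obtain f where f: "flag trace_radical f \<subseteq> {0}" using trace_radical_flag by blast
    have n'D: "n' \<in> derivations" using n'(1) by (simp add: B.pos_der_def)
    have "\<exists>N. \<forall>v. (q ^^ N) v = 0"
      unfolding qv
      by (rule nilpotent_plus_ideal[OF f derivation_lin[OF n'D] B.pos_der_nilpotent[OF n'(1)]
            trace_radical_ideal[OF n'D] r derivation_lin[OF trace_radical_D(1)[OF r]]])
    then obtain N where "\<And>v. (q ^^ N) v = 0" by blast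
    then have hq: "tr (\<lambda>v. h (q v)) = 0" by (rule tr_h_nilpotent[OF q(1)])
    have r2l: "lin r2" using derivation_lin[OF trace_radical_D(1)[OF q(2)]] .
    have "tr (\<lambda>v. h (r2 v)) = tr (\<lambda>v. r2 (h v))" by (rule tr_commute[OF lin_h r2l])
    also have "\<dots> = 0" by (rule trace_radical_D(2)[OF q(2) h_derivation])
    finally show ?thesis using hq by (simp add: q(3) lin_add[OF lin_h] tr_add)
  qed
  \<comment> \<open>Pairing with \<open>h\<close> vanishes on the joint kernel of the pairings with
    \<open>C\<close>, so it is a combination of them. The resulting \<open>w\<close> has the same
    pairings as \<open>h\<close>, and their difference is in the radical.\<close>
  have "\<exists>c. \<forall>y\<in>derivations. tr (\<lambda>v. h (y v)) = (\<Sum>u\<in>C. c u * tr (\<lambda>v. u (y v)))"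
    by (rule functional_in_span[OF finC subspace_derivations, of "\<lambda>u y. tr (\<lambda>v. u (y v))"])
      (simp_all add: tr_add tr_scale lin_add[OF Cl] lin_scale[OF Cl] lin_add[OF lin_h]
        lin_scale[OF lin_h] ker)
  then obtain c where c: "\<And>y. y \<in> derivations \<Longrightarrow> tr (\<lambda>v. h (y v)) = (\<Sum>u\<in>C. c u * tr (\<lambda>v. u (y v)))"
    by blast
  define w where "w = (\<Sum>u\<in>C. (\<lambda>v. c u *s u v))"
  have w: "w \<in> U" unfolding w_def by (intro Op.subspace_sum[OF U] Op.subspace_scale[OF U]) (use C(1) in blast)
  have "h - w \<in> trace_radical"
    unfolding trace_radical_def
  proof (intro CollectI conjI ballI)
    show "h - w \<in> derivations" by (rule Op.subspace_diff[OF subspace_derivations h_derivation UD[OF w]])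
    fix y assume y: "y \<in> derivations"
    have "tr (\<lambda>v. w (y v)) = (\<Sum>u\<in>C. c u * tr (\<lambda>v. u (y v)))"
      by (simp add: w_def sum_fun_apply tr_sum tr_scale)
    then show "tr (\<lambda>v. (h - w) (y v)) = 0" by (simp add: tr_diff c[OF y])
  qed
  moreover obtain n q where "n \<in> pos_der" "q \<in> B.nonneg_der" "w = n + q" using w unfolding U_def by blast
  ultimately show thesis using that[of n q "h - w"] by simp
qed

text \<open>Each member is nilpotent by \<open>nilpotent_plus_ideal\<close>, and the sum is closed
  under commutators because \<open>trace_radical\<close> is an ideal. Along this flag
  \<open>q = h - (n + r)\<close> has diagonal part \<open>h\<close>.\<close>

lemma engel_flag:
  "\<exists>f. flag {n + r |n r. n \<in> pos_der \<and> r \<in> trace_radical} f \<subseteq> {0}" (is "\<exists>f. flag ?M f \<subseteq> {0}")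
proof (rule engel)
  have posD: "n \<in> derivations" if "n \<in> pos_der" for n using that by (simp add: pos_der_def)
  show "Op.subspace ?M" by (rule Op.subspace_plus[OF subspace_pos_der subspace_trace_radical])
  have MD: "m \<in> derivations" if "m \<in> ?M" for m
    using that Op.subspace_add[OF subspace_derivations] posD trace_radical_D(1) by blast
  then show "lin m" if "m \<in> ?M" for m using that derivation_lin by blast
  show "commutator x y \<in> ?M" if xy: "x \<in> ?M" "y \<in> ?M" for x y
  proof -
    obtain n r n' r' where *: "n \<in> pos_der" "r \<in> trace_radical" "x = n + r"
      "n' \<in> pos_der" "r' \<in> trace_radical" "y = n' + r'" using xy by blast
    note l = derivation_lin[OF posD[OF *(1)]] derivation_lin[OF posD[OF *(4)]]
      derivation_lin[OF trace_radical_D(1)[OF *(2)]] derivation_lin[OF trace_radical_D(1)[OF *(5)]]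
    have "commutator n n' v \<in> filt (i + 1)" if v: "v \<in> filt i" for v i
    proof -
      have "n (n' v) \<in> filt (i + 1 + 1)" "n' (n v) \<in> filt (i + 1 + 1)"
        using *(1,4) v unfolding pos_der_def by blast+
      then show ?thesis
        unfolding commutator_def using filt_antimono[of "i + 1" "i + 1 + 1"] subspace_diff[OF subspace_filt]
        by auto
    qed
    then have 1: "commutator n n' \<in> pos_der"
      using derivation_commutator[OF posD[OF *(1)] posD[OF *(4)]] by (simp add: pos_der_def)
    have 2: "commutator n r' - commutator n' r + commutator r r' \<in> trace_radical"
      by (intro Op.subspace_add[OF subspace_trace_radical] Op.subspace_diff[OF subspace_trace_radical]
          trace_radical_ideal posD * trace_radical_D(1)[OF *(2)])
    have "commutator x y = commutator n n' + (commutator n r' - commutator n' r + commutator r r')"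
      by (simp add: commutator_def fun_eq_iff *(3,6) lin_add[OF l(1)] lin_add[OF l(2)] lin_add[OF l(3)]
          lin_add[OF l(4)] algebra_simps)
    with 1 2 show ?thesis by blast
  qed
  show "\<exists>k. \<forall>v. (m ^^ k) v = 0" if "m \<in> ?M" for m
  proof -
    obtain n r where *: "n \<in> pos_der" "r \<in> trace_radical" "m = n + r" using \<open>m \<in> ?M\<close> by blast
    obtain f where f: "flag trace_radical f \<subseteq> {0}" using trace_radical_flag by blast
    have "m = (\<lambda>v. n v + r v)" by (simp add: *(3) plus_fun_def)
    then show ?thesis
      using nilpotent_plus_ideal[OF f derivation_lin[OF posD[OF *(1)]] pos_der_nilpotent[OF *(1)]
          trace_radical_ideal[OF posD[OF *(1)]] *(2) derivation_lin[OF trace_radical_D(1)[OF *(2)]]]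
      by simp
  qed
qed

end

lemma (in int_graded) int_graded_conjugate:
  assumes "\<Phi> \<in> automorphisms"
  shows "int_graded scale bracket Basis (\<lambda>i v. inv_into UNIV \<Phi> (p i (\<Phi> v))) M"
proof (intro int_graded.intro fd_lie_axioms int_graded_axioms.intro M)
  note \<Phi> = automorphism_D[OF assms] and \<Psi> = automorphism_D[OF automorphism_inv[OF assms]]
  fix i j v w
  show "lin (\<lambda>v. inv_into UNIV \<Phi> (p i (\<Phi> v)))" by (rule lin_comp[OF \<Psi>(1) lin_comp[OF p_lin \<Phi>(1)]])
  show "inv_into UNIV \<Phi> (p i (\<Phi> (inv_into UNIV \<Phi> (p j (\<Phi> v))))) =
      (if i = j then inv_into UNIV \<Phi> (p j (\<Phi> v)) else 0)"
    by (simp add: \<Phi>(4) p_p lin_zero[OF \<Psi>(1)])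
  show "inv_into UNIV \<Phi> (p i (\<Phi> v)) = 0" if "i \<notin> {-M..M}"
    using that by (simp add: p_out lin_zero[OF \<Psi>(1)])
  show "(\<Sum>i\<in>{-M..M}. inv_into UNIV \<Phi> (p i (\<Phi> v))) = v"
    unfolding lin_sum[OF \<Psi>(1), symmetric] p_sum by (rule \<Phi>(5))
  show "inv_into UNIV \<Phi> (p (i + j) (\<Phi> (bracket (inv_into UNIV \<Phi> (p i (\<Phi> v))) (inv_into UNIV \<Phi> (p j (\<Phi> w)))))) =
      bracket (inv_into UNIV \<Phi> (p i (\<Phi> v))) (inv_into UNIV \<Phi> (p j (\<Phi> w)))"
    by (simp add: \<Phi>(3,4) p_bracket \<Psi>(3))
qed

context int_graded_pair
begin

text \<open>\<open>q\<close> differs from \<open>h\<close> by \<open>-(n + r)\<close>, which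
  descends the flag of \<open>N\<close>, so some \<open>\<Phi>\<close> conjugates \<open>q\<close>
  to \<open>h + z\<close>. Since \<open>q\<close> preserves \<open>B.filt j\<close>, the image of
  this space under \<open>\<Phi>\<close> is stable under \<open>h + z\<close> and therefore
  graded.\<close>

lemma conjugate_preserving_filtration:
  obtains \<Phi> where "\<Phi> \<in> automorphisms"
    "\<And>i j v. v \<in> B.filt j \<Longrightarrow> inv_into UNIV \<Phi> (p i (\<Phi> v)) \<in> B.filt j"
proof -
  obtain n q r where nqr: "n \<in> pos_der" "q \<in> B.nonneg_der" "r \<in> trace_radical"
    "\<And>v. h v = n v + q v + r v"
    using grading_derivation_decomposition by blast
  define N where "N = {n + r |n r. n \<in> pos_der \<and> r \<in> trace_radical}"
  obtain f where f: "flag N f \<subseteq> {0}" using engel_flag unfolding N_def by blast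
  have qD: "q \<in> derivations" using nqr(2) by (simp add: B.nonneg_der_def)
  have posD: "n \<in> derivations" if "n \<in> pos_der" for n using that by (simp add: pos_der_def)
  have hN: "commutator h m \<in> N" if mN: "m \<in> N" for m
  proof -
    obtain n r where m: "n \<in> pos_der" "r \<in> trace_radical" "m = n + r"
      using mN unfolding N_def by blast
    have "commutator h n v \<in> filt (i + 1)" if v: "v \<in> filt i" for v i
      unfolding commutator_def using m(1) v h_filt
      by (intro subspace_diff[OF subspace_filt]) (auto simp: pos_der_def)
    then have 1: "commutator h n \<in> pos_der"
      using derivation_commutator[OF h_derivation posD[OF m(1)]] by (simp add: pos_der_def)
    have 2: "commutator h r \<in> trace_radical" by (rule trace_radical_ideal[OF h_derivation m(2)])
    have "commutator h m = commutator h n + commutator h r"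
      by (simp add: commutator_def fun_eq_iff m(3) lin_add[OF lin_h])
    then show ?thesis unfolding N_def using 1 2 by blast
  qed
  have hflag: "h v \<in> flag N k" if "v \<in> flag N k" for v k by (rule flag_normalized[OF lin_h hN that])
  \<comment> \<open>With zero nilpotent part, \<open>stable_subspace_graded\<close> says that an
    \<open>h\<close>-stable subspace is graded; this makes the Engel flag an instance of
    \<open>stable_flag\<close>.\<close>
  interpret Z: graded_plus_nilpotent scale bracket Basis p M "\<lambda>v. 0" 1
    by unfold_locales (simp_all add: lin_const_zero lin_zero[OF lin_h])
  interpret F: stable_flag scale bracket Basis p M "flag N" f
  proof unfold_locales
    show "p i v \<in> flag N k" if "v \<in> flag N k" for i v k
      by (rule Z.stable_subspace_graded[OF subspace_flag _ that]) (simp add: hflag)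
  qed (use f subspace_flag flag_Suc_subset in auto)
  have "q v - h v \<in> flag N (Suc k)" if v: "v \<in> flag N k" for v k
  proof -
    have "n + r \<in> N" using nqr(1,3) unfolding N_def by blast
    then have "(n + r) v \<in> flag N (Suc k)" using v by (rule flag_step)
    then have "- (n + r) v \<in> flag N (Suc k)" by (rule subspace_neg[OF subspace_flag])
    then show ?thesis by (simp add: nqr(4))
  qed
  then obtain \<Phi> z m where \<Phi>: "\<Phi> \<in> automorphisms" "lin z" "\<And>v. h (z v) = z (h v)"
    "\<And>v. (z ^^ m) v = 0" "\<And>v. \<Phi> (q v) = h (\<Phi> v) + z (\<Phi> v)"
    using F.conjugate_to_commuting[OF qD] by blast
  interpret G: graded_plus_nilpotent scale bracket Basis p M z m
    by (rule graded_plus_nilpotent.intro[OF int_graded_axioms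
        graded_plus_nilpotent_axioms.intro[OF \<Phi>(2-4)]])
  note autD = automorphism_D[OF \<Phi>(1)]
  have "inv_into UNIV \<Phi> (p i (\<Phi> v)) \<in> B.filt j" if v: "v \<in> B.filt j" for i j v
  proof -
    have U: "subspace (\<Phi> ` B.filt j)" by (rule subspace_lin_image[OF autD(1) B.subspace_filt])
    have "p i (\<Phi> v) \<in> \<Phi> ` B.filt j"
    proof (rule G.stable_subspace_graded[OF U])
      show "h u + z u \<in> \<Phi> ` B.filt j" if "u \<in> \<Phi> ` B.filt j" for u
        using that nqr(2) by (auto simp: \<Phi>(5)[symmetric] B.nonneg_der_def)
    qed (use v in blast)
    then show ?thesis by (auto simp: autD(5))
  qed
  with \<Phi>(1) that show thesis by blast
qed

text \<open>The part \<open>x\<close> of \<open>B.h\<close> that commutes with the once conjugated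
  \<open>h\<close> is itself conjugate to \<open>B.h + z\<close>. The same conjugation takes the
  once conjugated \<open>h\<close> to an operator commuting with \<open>B.h + z\<close>, hence with
  \<open>B.h\<close>.\<close>

theorem conjugate_to_commuting_grading:
  obtains \<Phi> where "\<Phi> \<in> automorphisms"
    "\<And>v. \<Phi> (h (inv_into UNIV \<Phi> (B.h v))) = B.h (\<Phi> (h (inv_into UNIV \<Phi> v)))"
proof -
  obtain \<Phi>1 where \<Phi>1: "\<Phi>1 \<in> automorphisms"
    "\<And>i j v. v \<in> B.filt j \<Longrightarrow> inv_into UNIV \<Phi>1 (p i (\<Phi>1 v)) \<in> B.filt j"
    using conjugate_preserving_filtration by blast
  define p1 where "p1 = (\<lambda>i v. inv_into UNIV \<Phi>1 (p i (\<Phi>1 v)))"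
  note D1 = automorphism_D[OF \<Phi>1(1)] and I1 = automorphism_D[OF automorphism_inv[OF \<Phi>1(1)]]
  interpret C: int_graded scale bracket Basis p1 M
    unfolding p1_def by (rule int_graded_conjugate[OF \<Phi>1(1)])
  have Ch: "C.h v = inv_into UNIV \<Phi>1 (h (\<Phi>1 v))" for v
    unfolding C.h_def h_def by (simp add: p1_def lin_sum[OF I1(1)] lin_scale[OF I1(1)])
  have p1f: "p1 i v \<in> B.filt j" if "v \<in> B.filt j" for i j v using \<Phi>1(2)[OF that] by (simp add: p1_def)
  define x where "x = C.deg 0 B.h"
  have xD: "x \<in> derivations" unfolding x_def by (rule C.deg_derivation[OF B.h_derivation])
  \<comment> \<open>\<open>B.h\<close> is the scalar \<open>j\<close> on \<open>B.filt j\<close>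
    modulo \<open>B.filt (j + 1)\<close>. Because the projections \<open>p1\<close> preserve this
    filtration, \<open>x\<close> is the same scalar there.\<close>
  have xf: "x v - B.h v \<in> B.filt (j + 1)" if v: "v \<in> B.filt j" for j v
  proof -
    have B: "B.h w - of_int j *s w \<in> B.filt (j + 1)" if "w \<in> B.filt j" for w
    proof -
      have "B.h w - of_int j *s w = B.h (w - p' j w) - of_int j *s (w - p' j w)"
        by (simp add: lin_diff[OF B.lin_h] B.h_p scale_right_diff_distrib)
      also have "\<dots> \<in> B.filt (j + 1)"
        by (intro subspace_diff[OF B.subspace_filt] subspace_scale[OF B.subspace_filt] B.h_filt
            B.diff_p_filt that)
      finally show ?thesis .
    qed
    have "x v = (\<Sum>i\<in>{-M..M}. p1 i (B.h (p1 i v)))" by (simp add: x_def C.deg_def)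
    moreover have "of_int j *s v = (\<Sum>i\<in>{-M..M}. p1 i (of_int j *s p1 i v))"
      by (simp add: C.p_simps C.p_p scale_sum_right[symmetric] C.p_sum)
    ultimately have "x v - of_int j *s v = (\<Sum>i\<in>{-M..M}. p1 i (B.h (p1 i v) - of_int j *s p1 i v))"
      by (simp add: C.p_simps sum_subtractf)
    also have "\<dots> \<in> B.filt (j + 1)" by (intro subspace_sum[OF B.subspace_filt] p1f B v)
    finally have "(x v - of_int j *s v) - (B.h v - of_int j *s v) \<in> B.filt (j + 1)"
      by (rule subspace_diff[OF B.subspace_filt]) (rule B[OF v])
    then show ?thesis by simp
  qed
  \<comment> \<open>The filtration, which runs from \<open>- M'\<close> to \<open>M' + 1\<close>, is
    renumbered from 0 and so reaches zero after \<open>2 * M' + 1\<close> steps.\<close>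
  interpret F: stable_flag scale bracket Basis p' M' "\<lambda>n. B.filt (int n - M')" "nat (2 * M' + 1)"
    by unfold_locales (use B.subspace_filt B.filt_bottom B.filt_top B.M B.filt_antimono B.p_filt_stable in auto)
  have "x v - B.h v \<in> B.filt (int (Suc n) - M')" if "v \<in> B.filt (int n - M')" for v n
    using xf[OF that] by (simp add: algebra_simps)
  then obtain \<Phi>2 z m where \<Phi>2: "\<Phi>2 \<in> automorphisms" "lin z" "\<And>v. B.h (z v) = z (B.h v)"
    "\<And>v. (z ^^ m) v = 0" "\<And>v. \<Phi>2 (x v) = B.h (\<Phi>2 v) + z (\<Phi>2 v)"
    using F.conjugate_to_commuting[OF xD] by blast
  interpret G: graded_plus_nilpotent scale bracket Basis p' M' z m
    by (rule graded_plus_nilpotent.intro[OF B.int_graded_axioms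
        graded_plus_nilpotent_axioms.intro[OF \<Phi>2(2-4)]])
  note D2 = automorphism_D[OF \<Phi>2(1)] and I2 = automorphism_D[OF automorphism_inv[OF \<Phi>2(1)]]
  define a where "a v = \<Phi>2 (C.h (inv_into UNIV \<Phi>2 v))" for v
  have al: "lin a" unfolding a_def[abs_def] by (rule lin_comp[OF D2(1) lin_comp[OF C.lin_h I2(1)]])
  have "a (B.h v + z v) = B.h (a v) + z (a v)" for v
  proof -
    have "B.h v + z v = \<Phi>2 (x (inv_into UNIV \<Phi>2 v))" by (simp add: \<Phi>2(5) D2(4))
    then have "a (B.h v + z v) = \<Phi>2 (C.h (x (inv_into UNIV \<Phi>2 v)))" by (simp add: a_def D2(5))
    also have "\<dots> = \<Phi>2 (x (C.h (inv_into UNIV \<Phi>2 v)))"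
      using C.h_deg[OF B.lin_h, of 0] by (simp add: x_def)
    finally show ?thesis by (simp add: a_def \<Phi>2(5))
  qed
  then have comm: "a (B.h v) = B.h (a v)" for v by (rule G.commute_h[OF al])
  define \<Phi> where "\<Phi> v = \<Phi>2 (inv_into UNIV \<Phi>1 v)" for v
  have \<Phi>: "\<Phi> \<in> automorphisms"
    unfolding \<Phi>_def[abs_def] by (rule automorphism_comp[OF \<Phi>2(1) automorphism_inv[OF \<Phi>1(1)]])
  have "inv_into UNIV \<Phi> v = \<Phi>1 (inv_into UNIV \<Phi>2 v)" for v
  proof -
    have "\<Phi> (\<Phi>1 (inv_into UNIV \<Phi>2 v)) = v" by (simp add: \<Phi>_def D1(5) D2(4))
    then show ?thesis using automorphism_D(5)[OF \<Phi>] by metis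
  qed
  then have "\<Phi> (h (inv_into UNIV \<Phi> v)) = a v" for v
    by (simp add: \<Phi>_def a_def Ch)
  with comm \<Phi> that show thesis by metis
qed

end

section \<open>Direct sums and coarsenings of gradings\<close>

context fd_lie
begin

definition component :: "'a set \<Rightarrow> ('a \<Rightarrow> 'g set) \<Rightarrow> 'g \<Rightarrow> 'a \<Rightarrow> 'g" where
  "component I V x = (THE c. (\<forall>\<alpha>\<in>I. c \<alpha> \<in> V \<alpha>) \<and> (\<forall>\<alpha>. \<alpha> \<notin> I \<longrightarrow> c \<alpha> = 0) \<and>
     finite {\<alpha>. c \<alpha> \<noteq> 0} \<and> x = (\<Sum>\<alpha> | c \<alpha> \<noteq> 0. c \<alpha>))"

lemma direct_sum_subspace: "is_direct_sum I V \<Longrightarrow> \<alpha> \<in> I \<Longrightarrow> subspace (V \<alpha>)"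
  by (simp add: is_direct_sum_def)

lemma component:
  assumes "is_direct_sum I V"
  shows component_mem: "\<alpha> \<in> I \<Longrightarrow> component I V x \<alpha> \<in> V \<alpha>"
    and component_outside: "\<alpha> \<notin> I \<Longrightarrow> component I V x \<alpha> = 0"
    and sum_component: "x = (\<Sum>\<alpha> | component I V x \<alpha> \<noteq> 0. component I V x \<alpha>)"
proof -
  have "\<exists>!c. (\<forall>\<alpha>\<in>I. c \<alpha> \<in> V \<alpha>) \<and> (\<forall>\<alpha>. \<alpha> \<notin> I \<longrightarrow> c \<alpha> = 0) \<and>
      finite {\<alpha>. c \<alpha> \<noteq> 0} \<and> x = (\<Sum>\<alpha> | c \<alpha> \<noteq> 0. c \<alpha>)"
    using assms by (simp add: is_direct_sum_def)
  from theI'[OF this, folded component_def]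
  show "\<alpha> \<in> I \<Longrightarrow> component I V x \<alpha> \<in> V \<alpha>" "\<alpha> \<notin> I \<Longrightarrow> component I V x \<alpha> = 0"
    "x = (\<Sum>\<alpha> | component I V x \<alpha> \<noteq> 0. component I V x \<alpha>)"
    by blast+
qed

lemma sum_support: "finite F \<Longrightarrow> (\<And>\<alpha>. \<alpha> \<notin> F \<Longrightarrow> c \<alpha> = 0) \<Longrightarrow> (\<Sum>\<alpha> | c \<alpha> \<noteq> 0. c \<alpha>) = (\<Sum>\<alpha>\<in>F. c \<alpha>)"
  for c :: "'a \<Rightarrow> 'g"
  by (rule sum.mono_neutral_left) auto

lemma component_eqI:
  assumes ds: "is_direct_sum I V" and c: "\<And>\<alpha>. \<alpha> \<in> I \<Longrightarrow> c \<alpha> \<in> V \<alpha>" "\<And>\<alpha>. \<alpha> \<notin> I \<Longrightarrow> c \<alpha> = 0"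
    and F: "finite F" "\<And>\<alpha>. \<alpha> \<notin> F \<Longrightarrow> c \<alpha> = 0" "x = (\<Sum>\<alpha>\<in>F. c \<alpha>)"
  shows "component I V x = c"
  unfolding component_def
proof (rule the1_equality)
  show "\<exists>!c. (\<forall>\<alpha>\<in>I. c \<alpha> \<in> V \<alpha>) \<and> (\<forall>\<alpha>. \<alpha> \<notin> I \<longrightarrow> c \<alpha> = 0) \<and>
      finite {\<alpha>. c \<alpha> \<noteq> 0} \<and> x = (\<Sum>\<alpha> | c \<alpha> \<noteq> 0. c \<alpha>)"
    using ds by (simp add: is_direct_sum_def)
  have "{\<alpha>. c \<alpha> \<noteq> 0} \<subseteq> F" using F(2) by blast
  then show "(\<forall>\<alpha>\<in>I. c \<alpha> \<in> V \<alpha>) \<and> (\<forall>\<alpha>. \<alpha> \<notin> I \<longrightarrow> c \<alpha> = 0) \<and>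
      finite {\<alpha>. c \<alpha> \<noteq> 0} \<and> x = (\<Sum>\<alpha> | c \<alpha> \<noteq> 0. c \<alpha>)"
    using c F(3) sum_support[OF F(1,2)] finite_subset[OF _ F(1)] by simp
qed

lemma direct_sum_independent:
  assumes ds: "is_direct_sum I V" and F: "finite F" "F \<subseteq> I"
    and v: "\<And>\<alpha>. \<alpha> \<in> F \<Longrightarrow> v \<alpha> \<in> V \<alpha>" and sum: "(\<Sum>\<alpha>\<in>F. v \<alpha>) = 0" and \<alpha>: "\<alpha> \<in> F"
  shows "v \<alpha> = 0"
proof -
  have zero: "0 \<in> V \<alpha>" if "\<alpha> \<in> I" for \<alpha> using subspace_0[OF direct_sum_subspace[OF ds that]] .
  have "component I V 0 = (\<lambda>\<alpha>. if \<alpha> \<in> F then v \<alpha> else 0)"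
    by (rule component_eqI[OF ds _ _ F(1)]) (use zero v F(2) sum in \<open>auto simp: subset_iff\<close>)
  moreover have "component I V 0 = (\<lambda>\<alpha>. 0)"
    by (rule component_eqI[OF ds _ _ F(1)]) (use zero in auto)
  ultimately have "(if \<alpha> \<in> F then v \<alpha> else 0) = 0" by metis
  with \<alpha> show ?thesis by simp
qed

lemma direct_sum_disjoint:
  assumes ds: "is_direct_sum I V" and "\<alpha> \<in> I" "\<beta> \<in> I" "\<alpha> \<noteq> \<beta>" "x \<in> V \<alpha>" "x \<in> V \<beta>"
  shows "x = 0"
proof -
  have "(\<lambda>\<gamma>. if \<gamma> = \<alpha> then x else - x) \<alpha> = 0"
    by (rule direct_sum_independent[OF ds, of "{\<alpha>, \<beta>}"])
      (use assms subspace_neg[OF direct_sum_subspace[OF ds]] in auto)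
  then show ?thesis by simp
qed

text \<open>Nonzero vectors from distinct layers are distinct and independent, so there are at most
  \<open>card Basis\<close> of them.\<close>

lemma finite_nonzero_layers:
  assumes ds: "is_direct_sum I V"
  shows "finite {\<alpha> \<in> I. V \<alpha> \<noteq> {0}}"
proof (rule ccontr)
  let ?\<Omega> = "{\<alpha> \<in> I. V \<alpha> \<noteq> {0}}"
  assume "infinite ?\<Omega>"
  then obtain F where F: "finite F" "card F = Suc (card Basis)" "F \<subseteq> ?\<Omega>"
    using infinite_arbitrarily_large by blast
  have "\<exists>x\<in>V \<alpha>. x \<noteq> 0" if "\<alpha> \<in> F" for \<alpha>
    using that F(3) subspace_0[OF direct_sum_subspace[OF ds]] by blast
  then obtain v where v: "\<And>\<alpha>. \<alpha> \<in> F \<Longrightarrow> v \<alpha> \<in> V \<alpha>" "\<And>\<alpha>. \<alpha> \<in> F \<Longrightarrow> v \<alpha> \<noteq> 0" by metis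
  have FI: "F \<subseteq> I" using F(3) by blast
  have inj: "inj_on v F"
  proof (rule inj_onI, rule ccontr)
    fix \<alpha> \<beta> assume *: "\<alpha> \<in> F" "\<beta> \<in> F" "v \<alpha> = v \<beta>" "\<alpha> \<noteq> \<beta>"
    then have "v \<alpha> \<in> V \<beta>" using v(1)[of \<beta>] by simp
    then have "v \<alpha> = 0"
      using direct_sum_disjoint[OF ds _ _ *(4) v(1)[OF *(1)]] *(1,2) FI by blast
    then show False using v(2) *(1) by blast
  qed
  have "independent (v ` F)"
  proof (rule independent_if_scalars_zero)
    fix f x assume *: "(\<Sum>x\<in>v ` F. f x *s x) = 0" "x \<in> v ` F"
    then obtain \<alpha> where \<alpha>: "\<alpha> \<in> F" "x = v \<alpha>" by blast
    have "(\<lambda>\<alpha>. f (v \<alpha>) *s v \<alpha>) \<alpha> = 0"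
      by (rule direct_sum_independent[OF ds F(1) FI _ _ \<alpha>(1)])
        (use * v FI subspace_scale[OF direct_sum_subspace[OF ds]] in \<open>auto simp: sum.reindex[OF inj]\<close>)
    then show "f x = 0" using v(2) \<alpha> by simp
  qed (use F(1) in simp)
  then have "card (v ` F) \<le> card Basis"
    using independent_span_bound[OF finite_Basis] by (simp add: span_Basis)
  then show False using F(2) by (simp add: card_image[OF inj])
qed

lemma component_layer:
  assumes ds: "is_direct_sum I V" and "\<alpha> \<in> I" "x \<in> V \<alpha>"
  shows "component I V x = (\<lambda>\<beta>. if \<beta> = \<alpha> then x else 0)"
  by (rule component_eqI[OF ds, where F="{\<alpha>}"])
    (use assms subspace_0[OF direct_sum_subspace[OF ds]] in auto)

lemma sum_components:
  assumes ds: "is_direct_sum I V"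
  shows "(\<Sum>\<alpha>\<in>{\<alpha> \<in> I. V \<alpha> \<noteq> {0}}. component I V x \<alpha>) = x"
proof -
  have "component I V x \<alpha> = 0" if "\<alpha> \<notin> {\<alpha> \<in> I. V \<alpha> \<noteq> {0}}" for \<alpha>
    using that component_mem[OF ds, of \<alpha> x] component_outside[OF ds, of \<alpha> x] by (cases "\<alpha> \<in> I") auto
  from sum_support[OF finite_nonzero_layers[OF ds] this]
  show ?thesis using sum_component[OF ds, of x] by simp
qed

lemma lin_component:
  assumes ds: "is_direct_sum I V"
  shows "lin (\<lambda>x. component I V x \<alpha>)"
proof (rule linI)
  let ?c = "component I V" and ?\<Omega> = "{\<alpha> \<in> I. V \<alpha> \<noteq> {0}}"
  note mem = component_mem[OF ds] and out = component_outside[OF ds] and sub = direct_sum_subspace[OF ds]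
  have zero: "?c x \<alpha> = 0" if "\<alpha> \<notin> ?\<Omega>" for \<alpha> x
    using that mem[of \<alpha> x] out[of \<alpha> x] by (cases "\<alpha> \<in> I") auto
  fix x y c
  have "?c (x + y) = (\<lambda>\<alpha>. ?c x \<alpha> + ?c y \<alpha>)"
  proof (rule component_eqI[OF ds, where F="?\<Omega>"])
    show "x + y = (\<Sum>\<alpha>\<in>?\<Omega>. ?c x \<alpha> + ?c y \<alpha>)"
      by (simp only: sum.distrib sum_components[OF ds])
    show "?c x \<alpha> + ?c y \<alpha> \<in> V \<alpha>" if "\<alpha> \<in> I" for \<alpha>
      by (intro subspace_add[OF sub[OF that]] mem that)
    show "finite ?\<Omega>" by (rule finite_nonzero_layers[OF ds])
  qed (use zero out in auto)
  then show "?c (x + y) \<alpha> = ?c x \<alpha> + ?c y \<alpha>" by simp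
  have "?c (c *s x) = (\<lambda>\<alpha>. c *s ?c x \<alpha>)"
  proof (rule component_eqI[OF ds, where F="?\<Omega>"])
    show "c *s x = (\<Sum>\<alpha>\<in>?\<Omega>. c *s ?c x \<alpha>)"
      by (simp only: scale_sum_right[symmetric] sum_components[OF ds])
    show "c *s ?c x \<alpha> \<in> V \<alpha>" if "\<alpha> \<in> I" for \<alpha>
      by (intro subspace_scale[OF sub[OF that]] mem that)
    show "finite ?\<Omega>" by (rule finite_nonzero_layers[OF ds])
  qed (use zero out in auto)
  then show "?c (c *s x) \<alpha> = c *s ?c x \<alpha>" by simp
qed

lemma is_direct_sumI:
  assumes sub: "\<And>\<alpha>. \<alpha> \<in> I \<Longrightarrow> subspace (V \<alpha>)" and S: "finite S" "S \<subseteq> I"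
    and zero: "\<And>\<alpha>. \<alpha> \<in> I \<Longrightarrow> \<alpha> \<notin> S \<Longrightarrow> V \<alpha> = {0}"
    and ex: "\<And>x. \<exists>c. (\<forall>\<alpha>\<in>S. c \<alpha> \<in> V \<alpha>) \<and> x = (\<Sum>\<alpha>\<in>S. c \<alpha>)"
    and ind: "\<And>c. (\<And>\<alpha>. \<alpha> \<in> S \<Longrightarrow> c \<alpha> \<in> V \<alpha>) \<Longrightarrow> (\<Sum>\<alpha>\<in>S. c \<alpha>) = 0 \<Longrightarrow> \<forall>\<alpha>\<in>S. c \<alpha> = 0"
  shows "is_direct_sum I V"
  unfolding is_direct_sum_def
proof (intro conjI ballI allI sub)
  fix x
  obtain c where c: "\<And>\<alpha>. \<alpha> \<in> S \<Longrightarrow> c \<alpha> \<in> V \<alpha>" "x = (\<Sum>\<alpha>\<in>S. c \<alpha>)" using ex by blast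
  let ?P = "\<lambda>c. (\<forall>\<alpha>\<in>I. c \<alpha> \<in> V \<alpha>) \<and> (\<forall>\<alpha>. \<alpha> \<notin> I \<longrightarrow> c \<alpha> = 0) \<and>
      finite {\<alpha>. c \<alpha> \<noteq> 0} \<and> x = (\<Sum>\<alpha> | c \<alpha> \<noteq> 0. c \<alpha>)"
  show "\<exists>!c. ?P c"
  proof (rule ex1I)
    define d where "d \<alpha> = (if \<alpha> \<in> S then c \<alpha> else 0)" for \<alpha>
    have "(\<Sum>\<alpha> | d \<alpha> \<noteq> 0. d \<alpha>) = (\<Sum>\<alpha>\<in>S. d \<alpha>)" by (rule sum_support) (use S in \<open>auto simp: d_def\<close>)
    also have "\<dots> = x" unfolding c(2) by (rule sum.cong) (auto simp: d_def)
    finally have "x = (\<Sum>\<alpha> | d \<alpha> \<noteq> 0. d \<alpha>)" by simp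
    moreover have "finite {\<alpha>. d \<alpha> \<noteq> 0}" by (rule finite_subset[OF _ S(1)]) (auto simp: d_def)
    ultimately show "?P d"
      using c(1) subspace_0[OF sub] S(2) by (auto simp: d_def subset_iff)
    fix e assume e: "?P e"
    have out: "e \<alpha> = 0" if "\<alpha> \<notin> S" for \<alpha> using e zero[of \<alpha>] that by (cases "\<alpha> \<in> I") auto
    have "(\<Sum>\<alpha>\<in>S. e \<alpha>) = x" using e sum_support[OF S(1) out] by simp
    then have "(\<Sum>\<alpha>\<in>S. e \<alpha> - c \<alpha>) = 0" by (simp add: sum_subtractf c(2))
    moreover have "e \<alpha> - c \<alpha> \<in> V \<alpha>" if "\<alpha> \<in> S" for \<alpha>
      using that e c(1) S(2) by (intro subspace_diff[OF sub]) auto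
    ultimately have "\<forall>\<alpha>\<in>S. e \<alpha> - c \<alpha> = 0" by (intro ind)
    then show "e = d" using out by (auto simp: d_def)
  qed
qed

lemma span_UN_subspaces:
  assumes S: "finite S" and sub: "\<And>\<alpha>. \<alpha> \<in> S \<Longrightarrow> subspace (V \<alpha>)"
  shows "x \<in> span (\<Union>\<alpha>\<in>S. V \<alpha>) \<longleftrightarrow> (\<exists>c. (\<forall>\<alpha>\<in>S. c \<alpha> \<in> V \<alpha>) \<and> x = (\<Sum>\<alpha>\<in>S. c \<alpha>))"
proof
  let ?T = "{x. \<exists>c. (\<forall>\<alpha>\<in>S. c \<alpha> \<in> V \<alpha>) \<and> x = (\<Sum>\<alpha>\<in>S. c \<alpha>)}"
  have "subspace ?T"
  proof (rule subspaceI)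
    show "0 \<in> ?T" using subspace_0[OF sub] by (intro CollectI exI[of _ "\<lambda>_. 0"]) simp
  next
    fix x y assume "x \<in> ?T" "y \<in> ?T"
    then obtain c d where "\<And>\<alpha>. \<alpha> \<in> S \<Longrightarrow> c \<alpha> \<in> V \<alpha>" "x = (\<Sum>\<alpha>\<in>S. c \<alpha>)"
      "\<And>\<alpha>. \<alpha> \<in> S \<Longrightarrow> d \<alpha> \<in> V \<alpha>" "y = (\<Sum>\<alpha>\<in>S. d \<alpha>)" by blast
    then show "x + y \<in> ?T"
      using subspace_add[OF sub] by (intro CollectI exI[of _ "\<lambda>\<alpha>. c \<alpha> + d \<alpha>"]) (simp add: sum.distrib)
  next
    fix a x assume "x \<in> ?T"
    then obtain c where "\<And>\<alpha>. \<alpha> \<in> S \<Longrightarrow> c \<alpha> \<in> V \<alpha>" "x = (\<Sum>\<alpha>\<in>S. c \<alpha>)" by blast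
    then show "a *s x \<in> ?T"
      using subspace_scale[OF sub] by (intro CollectI exI[of _ "\<lambda>\<alpha>. a *s c \<alpha>"]) (simp add: scale_sum_right)
  qed
  moreover have "(\<Union>\<alpha>\<in>S. V \<alpha>) \<subseteq> ?T"
  proof
    fix x assume "x \<in> (\<Union>\<alpha>\<in>S. V \<alpha>)"
    then obtain \<beta> where \<beta>: "\<beta> \<in> S" "x \<in> V \<beta>" by blast
    then show "x \<in> ?T"
      using S subspace_0[OF sub] by (intro CollectI exI[of _ "\<lambda>\<alpha>. if \<alpha> = \<beta> then x else 0"]) auto
  qed
  ultimately have "span (\<Union>\<alpha>\<in>S. V \<alpha>) \<subseteq> ?T" by (intro span_minimal)
  then show "x \<in> span (\<Union>\<alpha>\<in>S. V \<alpha>) \<Longrightarrow> \<exists>c. (\<forall>\<alpha>\<in>S. c \<alpha> \<in> V \<alpha>) \<and> x = (\<Sum>\<alpha>\<in>S. c \<alpha>)" by blast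
  show "\<exists>c. (\<forall>\<alpha>\<in>S. c \<alpha> \<in> V \<alpha>) \<and> x = (\<Sum>\<alpha>\<in>S. c \<alpha>) \<Longrightarrow> x \<in> span (\<Union>\<alpha>\<in>S. V \<alpha>)"
    by (auto intro!: span_sum intro: span_base)
qed

text \<open>On a grading this has the same layers as \<open>push_forward\<close> with the identity
  automorphism. It refers to the finite set of weights only, so the values of \<open>f\<close>
  elsewhere do not enter and layers become finite sums.\<close>

definition coarsening :: "'a monoid \<Rightarrow> ('a \<Rightarrow> 'g set) \<Rightarrow> ('a \<Rightarrow> 'b) \<Rightarrow> 'b \<Rightarrow> 'g set" where
  "coarsening A V f \<beta> = span (\<Union>\<alpha>\<in>{\<alpha> \<in> weights A V. f \<alpha> = \<beta>}. V \<alpha>)"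

lemma gradingD:
  assumes "is_grading A V"
  shows grading_direct_sum: "is_direct_sum (carrier A) V"
    and grading_subspace: "\<alpha> \<in> carrier A \<Longrightarrow> subspace (V \<alpha>)"
    and grading_bracket: "\<alpha> \<in> carrier A \<Longrightarrow> \<beta> \<in> carrier A \<Longrightarrow> x \<in> V \<alpha> \<Longrightarrow> y \<in> V \<beta> \<Longrightarrow>
      bracket x y \<in> V (\<alpha> \<otimes>\<^bsub>A\<^esub> \<beta>)"
    and grading_group: "comm_group A"
    and finite_weights: "finite (weights A V)"
  using assms finite_nonzero_layers direct_sum_subspace
  by (auto simp: is_grading_def weights_def)

lemma coarsening_decomposition:
  assumes V: "is_grading A V"
  shows "x \<in> coarsening A V f \<beta> \<longleftrightarrow>
    (\<exists>c. (\<forall>\<alpha>\<in>weights A V. c \<alpha> \<in> V \<alpha>) \<and> x = (\<Sum>\<alpha>\<in>{\<alpha> \<in> weights A V. f \<alpha> = \<beta>}. c \<alpha>))"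
proof -
  have sub: "subspace (V \<alpha>)" if "\<alpha> \<in> weights A V" for \<alpha>
    using that grading_subspace[OF V] by (simp add: weights_def)
  have "x \<in> coarsening A V f \<beta> \<longleftrightarrow>
    (\<exists>c. (\<forall>\<alpha>\<in>{\<alpha> \<in> weights A V. f \<alpha> = \<beta>}. c \<alpha> \<in> V \<alpha>) \<and> x = (\<Sum>\<alpha>\<in>{\<alpha> \<in> weights A V. f \<alpha> = \<beta>}. c \<alpha>))"
    unfolding coarsening_def by (rule span_UN_subspaces) (use finite_weights[OF V] sub in auto)
  also have "\<dots> \<longleftrightarrow>
    (\<exists>c. (\<forall>\<alpha>\<in>weights A V. c \<alpha> \<in> V \<alpha>) \<and> x = (\<Sum>\<alpha>\<in>{\<alpha> \<in> weights A V. f \<alpha> = \<beta>}. c \<alpha>))"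
  proof
    assume "\<exists>c. (\<forall>\<alpha>\<in>{\<alpha> \<in> weights A V. f \<alpha> = \<beta>}. c \<alpha> \<in> V \<alpha>) \<and> x = (\<Sum>\<alpha>\<in>{\<alpha> \<in> weights A V. f \<alpha> = \<beta>}. c \<alpha>)"
    then obtain c where c: "\<And>\<alpha>. \<alpha> \<in> weights A V \<Longrightarrow> f \<alpha> = \<beta> \<Longrightarrow> c \<alpha> \<in> V \<alpha>"
      "x = (\<Sum>\<alpha>\<in>{\<alpha> \<in> weights A V. f \<alpha> = \<beta>}. c \<alpha>)" by blast
    then show "\<exists>c. (\<forall>\<alpha>\<in>weights A V. c \<alpha> \<in> V \<alpha>) \<and> x = (\<Sum>\<alpha>\<in>{\<alpha> \<in> weights A V. f \<alpha> = \<beta>}. c \<alpha>)"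
      using subspace_0[OF sub] by (intro exI[of _ "\<lambda>\<alpha>. if f \<alpha> = \<beta> then c \<alpha> else 0"]) (auto intro!: sum.cong)
  qed blast
  finally show ?thesis .
qed

lemma coarsening_superset: "\<alpha> \<in> weights A V \<Longrightarrow> V \<alpha> \<subseteq> coarsening A V f (f \<alpha>)"
  unfolding coarsening_def by (rule order_trans[OF _ span_superset]) blast

lemma coarsening_outside: "\<beta> \<notin> f ` weights A V \<Longrightarrow> coarsening A V f \<beta> = {0}"
proof -
  assume "\<beta> \<notin> f ` weights A V"
  then have "{\<alpha> \<in> weights A V. f \<alpha> = \<beta>} = {}" by blast
  then show ?thesis by (simp only: coarsening_def UN_empty span_empty)
qed

lemma coarsening_inj:
  assumes V: "is_grading A V" and f: "inj_on f (weights A V)" and \<alpha>: "\<alpha> \<in> weights A V"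
  shows "coarsening A V f (f \<alpha>) = V \<alpha>"
proof -
  have "{\<gamma> \<in> weights A V. f \<gamma> = f \<alpha>} = {\<alpha>}" using f \<alpha> by (auto dest: inj_onD)
  then show ?thesis
    using grading_subspace[OF V] \<alpha> by (simp add: coarsening_def weights_def span_eq_iff)
qed

lemma nonzero_layer: "is_grading A V \<Longrightarrow> \<alpha> \<in> weights A V \<Longrightarrow> \<exists>x\<in>V \<alpha>. x \<noteq> 0"
  using subspace_0[OF grading_subspace, of A V \<alpha>] unfolding weights_def by blast

lemma weights_coarsening:
  assumes V: "is_grading A V" and f: "f ` weights A V \<subseteq> carrier B"
  shows "weights B (coarsening A V f) = f ` weights A V"
proof
  show "weights B (coarsening A V f) \<subseteq> f ` weights A V"
    using coarsening_outside[of _ f A V] unfolding weights_def[of B] by blast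
  show "f ` weights A V \<subseteq> weights B (coarsening A V f)"
  proof
    fix \<beta> assume "\<beta> \<in> f ` weights A V"
    then obtain \<alpha> where \<alpha>: "\<alpha> \<in> weights A V" "\<beta> = f \<alpha>" by blast
    obtain x where "x \<in> V \<alpha>" "x \<noteq> 0" using nonzero_layer[OF V \<alpha>(1)] by blast
    then have "coarsening A V f \<beta> \<noteq> {0}" using coarsening_superset[OF \<alpha>(1), of f] \<alpha>(2) by blast
    then show "\<beta> \<in> weights B (coarsening A V f)" using f \<alpha> by (auto simp: weights_def[of B])
  qed
qed

text \<open>The bracket condition has content only for a nonzero bracket, whose weight is then again
  a weight, so additivity of \<open>f\<close> is asked only there. Integer roundings and maps
  obtained from inclusions of layers satisfy just this much.\<close>

lemma coarsening_grading:
  assumes V: "is_grading A V" and B: "comm_group B" and f: "f ` weights A V \<subseteq> carrier B"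
    and mult: "\<And>\<alpha> \<beta> x y. \<alpha> \<in> weights A V \<Longrightarrow> \<beta> \<in> weights A V \<Longrightarrow> x \<in> V \<alpha> \<Longrightarrow> y \<in> V \<beta> \<Longrightarrow>
      bracket x y \<noteq> 0 \<Longrightarrow> \<alpha> \<otimes>\<^bsub>A\<^esub> \<beta> \<in> weights A V \<Longrightarrow> f (\<alpha> \<otimes>\<^bsub>A\<^esub> \<beta>) = f \<alpha> \<otimes>\<^bsub>B\<^esub> f \<beta>"
  shows "is_grading B (coarsening A V f)"
  unfolding is_grading_def
proof (intro conjI ballI B)
  let ?\<Omega> = "weights A V" and ?L = "coarsening A V f"
  interpret A: comm_group A by (rule grading_group[OF V])
  have subL: "subspace (?L \<beta>)" for \<beta> by (simp add: coarsening_def)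
  have fin: "finite ?\<Omega>" by (rule finite_weights[OF V])
  have \<Omega>: "{\<alpha> \<in> carrier A. V \<alpha> \<noteq> {0}} = ?\<Omega>" by (simp add: weights_def)
  have \<Omega>A: "?\<Omega> \<subseteq> carrier A" by (auto simp: weights_def)
  note ds = grading_direct_sum[OF V]
  show "is_direct_sum (carrier B) ?L"
  proof (rule is_direct_sumI[where S="f ` ?\<Omega>"])
    show "finite (f ` ?\<Omega>)" using fin by simp
    show "?L \<beta> = {0}" if "\<beta> \<notin> f ` ?\<Omega>" for \<beta> using coarsening_outside[OF that] .
    show "\<exists>c. (\<forall>\<beta>\<in>f ` ?\<Omega>. c \<beta> \<in> ?L \<beta>) \<and> x = (\<Sum>\<beta>\<in>f ` ?\<Omega>. c \<beta>)" for x
    proof (intro exI conjI ballI)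
      let ?c = "\<lambda>\<beta>. \<Sum>\<alpha>\<in>{\<alpha> \<in> ?\<Omega>. f \<alpha> = \<beta>}. component (carrier A) V x \<alpha>"
      show "?c \<beta> \<in> ?L \<beta>" for \<beta>
        unfolding coarsening_decomposition[OF V] using component_mem[OF ds] \<Omega>A by blast
      have "(\<Sum>\<beta>\<in>f ` ?\<Omega>. ?c \<beta>) = (\<Sum>\<alpha>\<in>?\<Omega>. component (carrier A) V x \<alpha>)"
        by (rule sum.group) (use fin in auto)
      then show "x = (\<Sum>\<beta>\<in>f ` ?\<Omega>. ?c \<beta>)" using sum_components[OF ds, of x] by (simp add: \<Omega>)
    qed
    show "\<forall>\<beta>\<in>f ` ?\<Omega>. c \<beta> = 0"
      if c: "\<And>\<beta>. \<beta> \<in> f ` ?\<Omega> \<Longrightarrow> c \<beta> \<in> ?L \<beta>" and sum: "(\<Sum>\<beta>\<in>f ` ?\<Omega>. c \<beta>) = 0" for c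
    proof -
      have "\<forall>\<beta>\<in>f ` ?\<Omega>. \<exists>d. (\<forall>\<alpha>\<in>?\<Omega>. d \<alpha> \<in> V \<alpha>) \<and> c \<beta> = (\<Sum>\<alpha>\<in>{\<alpha> \<in> ?\<Omega>. f \<alpha> = \<beta>}. d \<alpha>)"
        using c unfolding coarsening_decomposition[OF V] by blast
      then obtain d where d: "\<And>\<beta> \<alpha>. \<beta> \<in> f ` ?\<Omega> \<Longrightarrow> \<alpha> \<in> ?\<Omega> \<Longrightarrow> d \<beta> \<alpha> \<in> V \<alpha>"
        "\<And>\<beta>. \<beta> \<in> f ` ?\<Omega> \<Longrightarrow> c \<beta> = (\<Sum>\<alpha>\<in>{\<alpha> \<in> ?\<Omega>. f \<alpha> = \<beta>}. d \<beta> \<alpha>)" by metis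
      have "(\<Sum>\<alpha>\<in>?\<Omega>. d (f \<alpha>) \<alpha>) = (\<Sum>\<beta>\<in>f ` ?\<Omega>. \<Sum>\<alpha>\<in>{\<alpha> \<in> ?\<Omega>. f \<alpha> = \<beta>}. d (f \<alpha>) \<alpha>)"
        by (rule sum.group[symmetric]) (use fin in auto)
      also have "\<dots> = (\<Sum>\<beta>\<in>f ` ?\<Omega>. c \<beta>)"
      proof (rule sum.cong)
        fix \<beta> assume "\<beta> \<in> f ` ?\<Omega>"
        then have "c \<beta> = (\<Sum>\<alpha>\<in>{\<alpha> \<in> ?\<Omega>. f \<alpha> = \<beta>}. d \<beta> \<alpha>)" by (rule d(2))
        also have "\<dots> = (\<Sum>\<alpha>\<in>{\<alpha> \<in> ?\<Omega>. f \<alpha> = \<beta>}. d (f \<alpha>) \<alpha>)" by (rule sum.cong) auto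
        finally show "(\<Sum>\<alpha>\<in>{\<alpha> \<in> ?\<Omega>. f \<alpha> = \<beta>}. d (f \<alpha>) \<alpha>) = c \<beta>" by simp
      qed simp
      finally have sum0: "(\<Sum>\<alpha>\<in>?\<Omega>. d (f \<alpha>) \<alpha>) = 0" using sum by simp
      have dV: "d (f \<alpha>) \<alpha> \<in> V \<alpha>" if "\<alpha> \<in> ?\<Omega>" for \<alpha> by (rule d(1)) (use that in auto)
      have zero: "d (f \<alpha>) \<alpha> = 0" if "\<alpha> \<in> ?\<Omega>" for \<alpha>
        by (rule direct_sum_independent[OF ds fin \<Omega>A dV sum0 that])
      show ?thesis
      proof
        fix \<beta> assume \<beta>: "\<beta> \<in> f ` ?\<Omega>"
        have "(\<Sum>\<alpha>\<in>{\<alpha> \<in> ?\<Omega>. f \<alpha> = \<beta>}. d \<beta> \<alpha>) = 0" by (rule sum.neutral) (use zero in auto)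
        then show "c \<beta> = 0" using d(2)[OF \<beta>] by simp
      qed
    qed
  qed (use f subL in auto)
  fix \<beta> \<gamma> x y assume bg: "\<beta> \<in> carrier B" "\<gamma> \<in> carrier B" and x: "x \<in> ?L \<beta>" and y: "y \<in> ?L \<gamma>"
  obtain c where c: "\<And>\<alpha>. \<alpha> \<in> ?\<Omega> \<Longrightarrow> c \<alpha> \<in> V \<alpha>" "x = (\<Sum>\<alpha>\<in>{\<alpha> \<in> ?\<Omega>. f \<alpha> = \<beta>}. c \<alpha>)"
    using x unfolding coarsening_decomposition[OF V] by blast
  obtain d where d: "\<And>\<alpha>. \<alpha> \<in> ?\<Omega> \<Longrightarrow> d \<alpha> \<in> V \<alpha>" "y = (\<Sum>\<alpha>\<in>{\<alpha> \<in> ?\<Omega>. f \<alpha> = \<gamma>}. d \<alpha>)"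
    using y unfolding coarsening_decomposition[OF V] by blast
  show "bracket x y \<in> ?L (\<beta> \<otimes>\<^bsub>B\<^esub> \<gamma>)"
    unfolding c(2) d(2) bracket_sum_left bracket_sum_right
  proof (intro subspace_sum[OF subL])
    fix a b assume "a \<in> {\<alpha> \<in> ?\<Omega>. f \<alpha> = \<gamma>}" "b \<in> {\<alpha> \<in> ?\<Omega>. f \<alpha> = \<beta>}"
    then have ab: "a \<in> ?\<Omega>" "f a = \<gamma>" "b \<in> ?\<Omega>" "f b = \<beta>" by auto
    have mem: "bracket (c b) (d a) \<in> V (b \<otimes>\<^bsub>A\<^esub> a)"
      using grading_bracket[OF V] ab \<Omega>A c(1) d(1) by blast
    show "bracket (c b) (d a) \<in> ?L (\<beta> \<otimes>\<^bsub>B\<^esub> \<gamma>)"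
    proof (cases "bracket (c b) (d a) = 0")
      case True then show ?thesis using subspace_0[OF subL] by simp
    next
      case False
      have "b \<otimes>\<^bsub>A\<^esub> a \<in> carrier A" using ab \<Omega>A by blast
      with False mem have w: "b \<otimes>\<^bsub>A\<^esub> a \<in> ?\<Omega>" by (auto simp: weights_def)
      have "f (b \<otimes>\<^bsub>A\<^esub> a) = \<beta> \<otimes>\<^bsub>B\<^esub> \<gamma>"
        using mult[OF ab(3,1) c(1)[OF ab(3)] d(1)[OF ab(1)] False w] ab by simp
      then show ?thesis using coarsening_superset[OF w, of f] mem by auto
    qed
  qed
qed

lemma push_forward_eq_coarsening:
  assumes V: "is_grading A V"
  shows "push_forward A f id V = coarsening A V f"
proof
  fix \<beta>
  show "push_forward A f id V \<beta> = coarsening A V f \<beta>"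
  proof (rule antisym)
    have "V \<alpha> \<subseteq> coarsening A V f \<beta>" if "\<alpha> \<in> carrier A" "f \<alpha> = \<beta>" for \<alpha>
    proof (cases "\<alpha> \<in> weights A V")
      case False
      then have "V \<alpha> = {0}" using that by (simp add: weights_def)
      then show ?thesis by (simp add: coarsening_def span_zero)
    qed (use coarsening_superset[of \<alpha> A V f] that in auto)
    then show "push_forward A f id V \<beta> \<subseteq> coarsening A V f \<beta>"
      unfolding push_forward_def by (intro span_minimal) (auto simp: coarsening_def)
    show "coarsening A V f \<beta> \<subseteq> push_forward A f id V \<beta>"
      unfolding push_forward_def coarsening_def by (rule span_mono) (auto simp: weights_def)
  qed
qed

lemma int_graded_of_grading:
  assumes L: "is_grading integer_group L"
  obtains M where "int_graded scale bracket Basis (\<lambda>i x. component UNIV L x i) M"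
proof -
  have ds: "is_direct_sum UNIV L" using grading_direct_sum[OF L] by simp
  have fin: "finite (weights integer_group L)" by (rule finite_weights[OF L])
  \<comment> \<open>Inserting 0 covers the zero algebra, which has no weights.\<close>
  define M where "M = Max (insert 0 (abs ` weights integer_group L))"
  have M: "\<bar>i\<bar> \<le> M" if "i \<in> weights integer_group L" for i
    unfolding M_def using fin that by (intro Max_ge) auto
  have out: "component UNIV L x i = 0" if "i \<notin> {-M..M}" for i x
  proof -
    have "i \<notin> weights integer_group L" using that M[of i] by auto
    then show ?thesis using component_mem[OF ds, of i x] by (simp add: weights_def)
  qed
  have "int_graded scale bracket Basis (\<lambda>i x. component UNIV L x i) M"
  proof (intro int_graded.intro fd_lie_axioms int_graded_axioms.intro)
    show "0 \<le> M" unfolding M_def using fin by (intro Max_ge) auto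
    show "lin (\<lambda>x. component UNIV L x i)" for i by (rule lin_component[OF ds])
    show "component UNIV L (component UNIV L v j) i = (if i = j then component UNIV L v j else 0)" for i j v
      using component_layer[OF ds _ component_mem[OF ds, of j v]] by simp
    show "component UNIV L v i = 0" if "i \<notin> {-M..M}" for i v using out[OF that] .
    show "(\<Sum>i\<in>{-M..M}. component UNIV L v i) = v" for v
      using sum_component[OF ds, of v] sum_support[where F="{-M..M}" and c="component UNIV L v"] out by auto
    show "component UNIV L (bracket (component UNIV L v i) (component UNIV L w j)) (i + j) =
        bracket (component UNIV L v i) (component UNIV L w j)" for i j v w
      using grading_bracket[OF L, of i j "component UNIV L v i" "component UNIV L w j"]
        component_mem[OF ds] component_layer[OF ds, of "i + j"] by simp
  qed
  then show thesis by (rule that)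
qed

end

section \<open>Integer-valued weight maps\<close>

text \<open>A rational vector space is not a finite union of proper subspaces: among the functions
  \<open>\<phi> + q * \<chi>\<close> each pair rules out at most one \<open>q\<close>.\<close>

lemma separating_function_exists:
  fixes \<F> :: "('a \<Rightarrow> rat) set"
  assumes "finite D" and cl: "\<And>\<phi> \<chi> q. \<phi> \<in> \<F> \<Longrightarrow> \<chi> \<in> \<F> \<Longrightarrow> (\<lambda>x. \<phi> x + q * \<chi> x) \<in> \<F>"
    and ne: "\<F> \<noteq> {}" and sep: "\<And>x y. (x, y) \<in> D \<Longrightarrow> \<exists>\<phi>\<in>\<F>. \<phi> x \<noteq> \<phi> y"
  shows "\<exists>\<phi>\<in>\<F>. \<forall>(x, y)\<in>D. \<phi> x \<noteq> \<phi> y"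
  using assms(1,4)
proof (induction D rule: finite_induct)
  case empty then show ?case using ne by auto
next
  case (insert d D)
  obtain x y where d: "d = (x, y)" by (cases d)
  have "\<exists>\<phi>\<in>\<F>. \<forall>(x, y)\<in>D. \<phi> x \<noteq> \<phi> y" by (rule insert.IH) (use insert.prems in blast)
  then obtain \<phi> where \<phi>: "\<phi> \<in> \<F>" "\<And>x y. (x, y) \<in> D \<Longrightarrow> \<phi> x \<noteq> \<phi> y" by fast
  obtain \<chi> where \<chi>: "\<chi> \<in> \<F>" "\<chi> x \<noteq> \<chi> y" using insert.prems d by auto
  define bad where "bad = (\<lambda>(x, y). (\<phi> y - \<phi> x) / (\<chi> x - \<chi> y)) ` insert d D"
  have "finite bad" using insert.hyps by (simp add: bad_def)
  then obtain q where q: "q \<notin> insert 0 bad"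
    using ex_new_if_finite[of "insert 0 bad"] infinite_UNIV_char_0 by blast
  have "\<phi> u + q * \<chi> u \<noteq> \<phi> v + q * \<chi> v" if uv: "(u, v) \<in> insert d D" for u v
  proof
    assume eq: "\<phi> u + q * \<chi> u = \<phi> v + q * \<chi> v"
    show False
    proof (cases "\<chi> u = \<chi> v")
      case True
      then show False using eq uv \<phi>(2)[of u v] \<chi>(2) d by auto
    next
      case False
      then have "q = (\<phi> v - \<phi> u) / (\<chi> u - \<chi> v)" using eq by (simp add: field_simps)
      then have "q \<in> bad" unfolding bad_def using uv by (force intro: rev_image_eqI)
      then show False using q by simp
    qed
  qed
  then show ?case using cl[OF \<phi>(1) \<chi>(1), of q] by (intro bexI[of _ "\<lambda>x. \<phi> x + q * \<chi> x"]) auto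
qed

lemma common_denominator:
  fixes \<phi> :: "'a \<Rightarrow> rat"
  assumes "finite S"
  shows "\<exists>N>0. \<forall>x\<in>S. of_int N * \<phi> x \<in> \<int>"
  using assms
proof (induction S rule: finite_induct)
  case empty show ?case by (intro exI[of _ 1]) simp
next
  case (insert x S)
  then obtain N where N: "N > 0" "\<And>x. x \<in> S \<Longrightarrow> of_int N * \<phi> x \<in> \<int>" by blast
  obtain a b where ab: "quotient_of (\<phi> x) = (a, b)" by (cases "quotient_of (\<phi> x)")
  then have b: "b > 0" "\<phi> x = of_int a / of_int b"
    by (rule quotient_of_denom_pos) (rule quotient_of_div[OF ab])
  have "of_int (b * N) * \<phi> y \<in> \<int>" if "y \<in> insert x S" for y
  proof (cases "y = x")
    case True
    have "of_int (b * N) * \<phi> x = of_int (N * a)" using b by simp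
    then show ?thesis unfolding True by (simp only: Ints_of_int)
  next
    case False
    then have "of_int N * \<phi> y \<in> \<int>" using N(2) that by blast
    then have "of_int b * (of_int N * \<phi> y) \<in> \<int>" by (rule Ints_mult[OF Ints_of_int])
    then show ?thesis by (simp add: mult.assoc)
  qed
  then show ?case using b(1) N(1) by (intro exI[of _ "b * N"]) auto
qed

lemma integer_weight_map_exists:
  fixes A (structure)
  assumes S: "finite S" "S \<subseteq> carrier A" and A: "comm_group A"
    and sep: "\<And>x y. x \<in> S \<Longrightarrow> y \<in> S \<Longrightarrow> x \<noteq> y \<Longrightarrow> \<exists>\<phi> :: 'a \<Rightarrow> rat.
      (\<forall>a\<in>carrier A. \<forall>b\<in>carrier A. \<phi> (a \<otimes> b) = \<phi> a + \<phi> b) \<and> \<phi> x \<noteq> \<phi> y"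
  obtains \<psi> :: "'a \<Rightarrow> int" where "inj_on \<psi> S"
    "\<And>x y. x \<in> S \<Longrightarrow> y \<in> S \<Longrightarrow> x \<otimes> y \<in> S \<Longrightarrow> \<psi> (x \<otimes> y) = \<psi> x + \<psi> y"
proof -
  define \<F> where "\<F> = {\<phi> :: 'a \<Rightarrow> rat. \<forall>a\<in>carrier A. \<forall>b\<in>carrier A. \<phi> (a \<otimes> b) = \<phi> a + \<phi> b}"
  have "\<exists>\<phi>\<in>\<F>. \<forall>(x, y)\<in>{(x, y). x \<in> S \<and> y \<in> S \<and> x \<noteq> y}. \<phi> x \<noteq> \<phi> y"
  proof (rule separating_function_exists)
    show "finite {(x, y). x \<in> S \<and> y \<in> S \<and> x \<noteq> y}"
      by (rule finite_subset[of _ "S \<times> S"]) (use S in auto)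
    show "\<F> \<noteq> {}" unfolding \<F>_def by (auto intro: exI[of _ "\<lambda>_. 0"])
  qed (use sep in \<open>auto simp: \<F>_def algebra_simps\<close>)
  then obtain \<phi> where \<phi>: "\<phi> \<in> \<F>" "\<And>x y. x \<in> S \<Longrightarrow> y \<in> S \<Longrightarrow> x \<noteq> y \<Longrightarrow> \<phi> x \<noteq> \<phi> y" by blast
  obtain N where N: "N > 0" "\<And>x. x \<in> S \<Longrightarrow> of_int N * \<phi> x \<in> \<int>"
    using common_denominator[OF S(1)] by blast
  \<comment> \<open>On \<open>S\<close> the scaled value is already an integer, so the floor changes
    nothing. Outside \<open>S\<close> it may destroy additivity, which is why
    \<open>x \<otimes> y\<close> is required to lie in \<open>S\<close>.\<close>
  define \<psi> where "\<psi> x = \<lfloor>of_int N * \<phi> x\<rfloor>" for x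
  have \<psi>: "of_int (\<psi> x) = of_int N * \<phi> x" if "x \<in> S" for x
    unfolding \<psi>_def using N(2)[OF that] by simp
  show thesis
  proof
    show "inj_on \<psi> S"
    proof (rule inj_onI)
      fix x y assume xy: "x \<in> S" "y \<in> S" "\<psi> x = \<psi> y"
      then have "of_int N * \<phi> x = of_int N * \<phi> y" using \<psi> by metis
      then show "x = y" using N(1) \<phi>(2) xy by auto
    qed
    fix x y assume xy: "x \<in> S" "y \<in> S" "x \<otimes> y \<in> S"
    then have "(of_int (\<psi> (x \<otimes> y)) :: rat) = of_int (\<psi> x + \<psi> y)"
      using \<psi> \<phi>(1) S(2) by (simp add: \<F>_def subset_iff algebra_simps)
    then show "\<psi> (x \<otimes> y) = \<psi> x + \<psi> y" by (simp only: of_int_eq_iff)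
  qed
qed

section \<open>Maximal gradings\<close>

text \<open>Adjoining \<open>B.h\<close> to \<open>t\<close> gives a split torus again:
  \<open>B.h\<close> commutes with \<open>h\<close>, hence with the projections \<open>p j\<close>,
  on whose images \<open>t\<close> is scalar, and the joint eigenvectors \<open>p' i (p j v)\<close>
  span. Maximality does the rest.\<close>

lemma (in int_graded_pair) mem_maximal_split_torus:
  assumes max: "is_maximal_split_torus t"
    and scalar: "\<And>\<delta> j. \<delta> \<in> t \<Longrightarrow> \<exists>c. \<forall>v. \<delta> (p j v) = c *s p j v"
    and comm: "\<And>v. B.h (h v) = h (B.h v)"
  shows "B.h \<in> t"
proof -
  have t: "t \<subseteq> derivations" "(\<lambda>x. 0) \<in> t"
    "\<And>\<delta> \<epsilon>. \<delta> \<in> t \<Longrightarrow> \<epsilon> \<in> t \<Longrightarrow> (\<lambda>x. \<delta> x + \<epsilon> x) \<in> t"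
    "\<And>c \<delta>. \<delta> \<in> t \<Longrightarrow> (\<lambda>x. c *s \<delta> x) \<in> t"
    "\<And>\<delta> \<epsilon>. \<delta> \<in> t \<Longrightarrow> \<epsilon> \<in> t \<Longrightarrow> (\<lambda>x. \<delta> (\<epsilon> x) - \<epsilon> (\<delta> x)) = (\<lambda>x. 0)"
    using max by (simp_all add: is_maximal_split_torus_def is_split_torus_def)
  have tl: "lin \<delta>" if "\<delta> \<in> t" for \<delta> using that t(1) derivation_lin by blast
  note Bh_p = commute_p[OF B.lin_h comm[symmetric]]
  have p_Bp: "p j (p' i v) = p' i (p j v)" for i j v by (rule B.commute_p[OF p_lin Bh_p])
  have tcomm: "\<delta> (B.h v) = B.h (\<delta> v)" if \<delta>: "\<delta> \<in> t" for \<delta> v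
  proof -
    have "\<delta> (B.h (p j v)) = B.h (\<delta> (p j v))" for j
    proof -
      obtain c where c: "\<And>v. \<delta> (p j v) = c *s p j v" using scalar[OF \<delta>] by blast
      show ?thesis by (simp add: Bh_p c lin_scale[OF B.lin_h])
    qed
    then have "\<delta> (B.h (\<Sum>j\<in>{-M..M}. p j v)) = B.h (\<delta> (\<Sum>j\<in>{-M..M}. p j v))"
      by (simp only: lin_sum[OF B.lin_h] lin_sum[OF tl[OF \<delta>]])
    then show ?thesis by (simp only: p_sum)
  qed
  define t' where "t' = {\<lambda>v. \<delta> v + c *s B.h v |\<delta> c. \<delta> \<in> t}"
  have t'I: "(\<lambda>v. \<delta> v + c *s B.h v) \<in> t'" if "\<delta> \<in> t" for \<delta> c using that unfolding t'_def by blast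
  have tt': "t \<subseteq> t'" using t'I[of _ 0] by auto
  have "is_split_torus t'"
    unfolding is_split_torus_def
  proof (intro conjI ballI allI)
    show "t' \<subseteq> derivations"
      unfolding t'_def using t(1) by (auto intro!: derivation_plus derivation_smult B.h_derivation)
    show "(\<lambda>x. 0) \<in> t'" using t(2) tt' by blast
    show "(\<lambda>x. \<delta> x + \<epsilon> x) \<in> t'" if de: "\<delta> \<in> t'" "\<epsilon> \<in> t'" for \<delta> \<epsilon>
    proof -
      obtain \<delta>' c \<epsilon>' d where *: "\<delta>' \<in> t" "\<delta> = (\<lambda>v. \<delta>' v + c *s B.h v)" "\<epsilon>' \<in> t"
        "\<epsilon> = (\<lambda>v. \<epsilon>' v + d *s B.h v)" using de unfolding t'_def by blast
      have "(\<lambda>x. \<delta> x + \<epsilon> x) = (\<lambda>v. (\<delta>' v + \<epsilon>' v) + (c + d) *s B.h v)"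
        by (simp add: *(2,4) scale_left_distrib ac_simps)
      then show ?thesis using t'I[OF t(3)[OF *(1,3)]] by simp
    qed
    show "(\<lambda>x. a *s \<delta> x) \<in> t'" if d: "\<delta> \<in> t'" for a \<delta>
    proof -
      obtain \<delta>' c where *: "\<delta>' \<in> t" "\<delta> = (\<lambda>v. \<delta>' v + c *s B.h v)" using d unfolding t'_def by blast
      have "(\<lambda>x. a *s \<delta> x) = (\<lambda>v. a *s \<delta>' v + (a * c) *s B.h v)"
        by (simp add: *(2) scale_right_distrib)
      then show ?thesis using t'I[OF t(4)[OF *(1)]] by simp
    qed
    show "(\<lambda>x. \<delta> (\<epsilon> x) - \<epsilon> (\<delta> x)) = (\<lambda>x. 0)" if de: "\<delta> \<in> t'" "\<epsilon> \<in> t'" for \<delta> \<epsilon>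
    proof -
      obtain \<delta>' c \<epsilon>' d where *: "\<delta>' \<in> t" "\<delta> = (\<lambda>v. \<delta>' v + c *s B.h v)" "\<epsilon>' \<in> t"
        "\<epsilon> = (\<lambda>v. \<epsilon>' v + d *s B.h v)" using de unfolding t'_def by blast
      have "\<delta>' (\<epsilon>' x) = \<epsilon>' (\<delta>' x)" for x using t(5)[OF *(1,3)] by (simp add: fun_eq_iff)
      then show ?thesis
        by (simp add: *(2,4) fun_eq_iff lin_add[OF tl[OF *(1)]] lin_add[OF tl[OF *(3)]]
            lin_add[OF B.lin_h] lin_scale[OF tl[OF *(1)]] lin_scale[OF tl[OF *(3)]]
            lin_scale[OF B.lin_h] tcomm[OF *(1)] tcomm[OF *(3)] scale_right_distrib
            mult.commute algebra_simps)
    qed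
    show "simultaneously_diagonalizable t'"
    proof -
      define S where "S = {v. \<forall>\<delta>\<in>t'. \<exists>c. \<delta> v = c *s v}"
      have "p' i (p j v) \<in> S" for i j v
        unfolding S_def
      proof (intro CollectI ballI)
        fix \<delta> assume "\<delta> \<in> t'"
        then obtain \<delta>' c where *: "\<delta>' \<in> t" "\<delta> = (\<lambda>v. \<delta>' v + c *s B.h v)" unfolding t'_def by blast
        obtain d where d: "\<And>v. \<delta>' (p j v) = d *s p j v" using scalar[OF *(1)] by blast
        have "\<delta>' (p' i (p j v)) = d *s p' i (p j v)" using d[of "p' i v"] by (simp only: p_Bp)
        then have "\<delta> (p' i (p j v)) = (d + c * of_int i) *s p' i (p j v)"
          by (simp add: *(2) B.h_p scale_left_distrib)
        then show "\<exists>c. \<delta> (p' i (p j v)) = c *s p' i (p j v)" by blast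
      qed
      then have "(\<Sum>j\<in>{-M..M}. \<Sum>i\<in>{-M'..M'}. p' i (p j v)) \<in> span S" for v
        by (intro span_sum span_base)
      then have "v \<in> span S" for v by (simp only: B.p_sum p_sum)
      moreover obtain E where E: "E \<subseteq> S" "independent E" "S \<subseteq> span E"
        by (rule maximal_independent_subset) (rule that)
      moreover have "span S \<subseteq> span E" using E(3) by (intro span_minimal) auto
      ultimately have "span E = UNIV" by blast
      then show ?thesis
        using E(1,2) unfolding simultaneously_diagonalizable_def S_def by blast
    qed
  qed
  then have "t' = t" using max tt' by (simp add: is_maximal_split_torus_def)
  moreover have "B.h \<in> t'" using t'I[OF t(2), of 1] by simp
  ultimately show ?thesis by simp
qed

section \<open>Countable test groups and homomorphisms from the lattice\<close>

lemma countable_PiE_int: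
  assumes "finite S"
  shows "countable (S \<rightarrow>\<^sub>E (UNIV :: int set))"
  using assms
proof (induction S rule: finite_induct)
  case (insert x S)
  have "countable ((\<lambda>(y, g). g(x := y)) ` ((UNIV :: int set) \<times> (S \<rightarrow>\<^sub>E UNIV)))"
    by (intro countable_image countable_SIGMA insert.IH) simp
  then show ?case by (simp add: PiE_insert_eq)
qed simp

text \<open>Transport of structure along an injection \<open>e\<close>, which lets a countable test
  group live in an arbitrary infinite type.\<close>

definition transport :: "('a \<Rightarrow> 'u) \<Rightarrow> 'a monoid \<Rightarrow> 'u monoid" where
  "transport e G = \<lparr>carrier = e ` carrier G,
     monoid.mult = (\<lambda>x y. e (inv_into (carrier G) e x \<otimes>\<^bsub>G\<^esub> inv_into (carrier G) e y)),
     one = e \<one>\<^bsub>G\<^esub>\<rparr>"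

lemma comm_group_transport:
  assumes G: "comm_group G" and e: "inj_on e (carrier G)"
  shows "comm_group (transport e G)"
proof -
  interpret G: comm_group G by (rule G)
  show ?thesis
  proof (rule comm_groupI)
    show "\<exists>y\<in>carrier (transport e G). y \<otimes>\<^bsub>transport e G\<^esub> x = \<one>\<^bsub>transport e G\<^esub>"
      if x: "x \<in> carrier (transport e G)" for x
    proof -
      obtain g where g: "g \<in> carrier G" "x = e g" using x by (auto simp: transport_def)
      then show ?thesis
        by (intro bexI[of _ "e (inv\<^bsub>G\<^esub> g)"]) (auto simp: transport_def inv_into_f_f[OF e])
    qed
    show "x \<otimes>\<^bsub>transport e G\<^esub> y \<otimes>\<^bsub>transport e G\<^esub> z =
        x \<otimes>\<^bsub>transport e G\<^esub> (y \<otimes>\<^bsub>transport e G\<^esub> z)"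
      if "x \<in> carrier (transport e G)" "y \<in> carrier (transport e G)" "z \<in> carrier (transport e G)" for x y z
      using that by (auto simp: transport_def inv_into_f_f[OF e] G.m_assoc)
    show "x \<otimes>\<^bsub>transport e G\<^esub> y = y \<otimes>\<^bsub>transport e G\<^esub> x"
      if "x \<in> carrier (transport e G)" "y \<in> carrier (transport e G)" for x y
      using that by (auto simp: transport_def inv_into_f_f[OF e] G.m_comm)
  qed (auto simp: transport_def inv_into_f_f[OF e])
qed

text \<open>The unit vectors generate: multiples are treated for natural numbers, then by negation
  for integers, and the coordinates of \<open>n\<close> are added one at a time.\<close>

lemma hom_int_lattice_eq_lattice_proj:
  assumes \<pi>: "\<pi> \<in> hom (int_lattice k) real_group" and n: "n \<in> carrier (int_lattice k)"
  shows "\<pi> n = lattice_proj k (\<lambda>i\<in>{..<k}. \<pi> (unit_vec k i)) n"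
proof -
  let ?Z = "int_lattice k"
  have add: "\<pi> (x \<otimes>\<^bsub>?Z\<^esub> y) = \<pi> x + \<pi> y" if "x \<in> carrier ?Z" "y \<in> carrier ?Z" for x y
    using \<pi> that by (auto simp: hom_def real_group_def)
  define v where "v f = (\<lambda>i\<in>{..<k}. f i)" for f :: "nat \<Rightarrow> int"
  have v: "v f \<in> carrier ?Z" for f by (auto simp: v_def)
  have v_add: "v f \<otimes>\<^bsub>?Z\<^esub> v g = v (\<lambda>i. f i + g i)" for f g by (auto simp: v_def)
  have \<pi>_add: "\<pi> (v (\<lambda>i. f i + g i)) = \<pi> (v f) + \<pi> (v g)" for f g
    using add[OF v v, of f g] by (simp only: v_add)
  have \<pi>_zero: "\<pi> (v (\<lambda>i. 0)) = 0" using \<pi>_add[of "\<lambda>i. 0" "\<lambda>i. 0"] by simp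
  have unit: "unit_vec k j = v (\<lambda>i. if i = j then 1 else 0)" for j by (simp add: unit_vec_def v_def)
  have single_nat: "\<pi> (v (\<lambda>i. if i = j then int c else 0)) = real c * \<pi> (unit_vec k j)" for j c
  proof (induction c)
    case 0 show ?case by (simp only: of_nat_0 if_cancel \<pi>_zero mult_zero_left)
  next
    case (Suc c)
    have "(\<lambda>i. if i = j then int (Suc c) else 0) =
        (\<lambda>i. (if i = j then int c else 0) + (if i = j then 1 else 0))" by auto
    then have "\<pi> (v (\<lambda>i. if i = j then int (Suc c) else 0)) =
        \<pi> (v (\<lambda>i. if i = j then int c else 0)) + \<pi> (v (\<lambda>i. if i = j then 1 else 0))"
      by (simp only: \<pi>_add)
    then show ?case using Suc by (simp add: unit algebra_simps)
  qed
  have single: "\<pi> (v (\<lambda>i. if i = j then c else 0)) = of_int c * \<pi> (unit_vec k j)" for j c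
  proof (cases "0 \<le> c")
    case True then show ?thesis using single_nat[of j "nat c"] unfolding nat_0_le[OF True] by simp
  next
    case False
    have "(\<lambda>i. (if i = j then c else 0) + (if i = j then int (nat (- c)) else 0)) = (\<lambda>i. 0 :: int)"
      using False by auto
    then have "\<pi> (v (\<lambda>i. if i = j then c else 0)) + \<pi> (v (\<lambda>i. if i = j then int (nat (- c)) else 0)) = 0"
      using \<pi>_add[of "\<lambda>i. if i = j then c else 0" "\<lambda>i. if i = j then int (nat (- c)) else 0"] \<pi>_zero
      by simp
    then show ?thesis using single_nat[of j "nat (- c)"] False by simp
  qed
  have "\<pi> (v (\<lambda>i. if i < j then n i else 0)) = (\<Sum>i<j. of_int (n i) * \<pi> (unit_vec k i))" for j
  proof (induction j)
    case 0 then show ?case using \<pi>_zero by simp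
  next
    case (Suc j)
    have "(\<lambda>i. if i < Suc j then n i else 0) =
        (\<lambda>i. (if i < j then n i else 0) + (if i = j then n j else 0))" by auto
    then show ?case using Suc single[of j "n j"] by (simp only: \<pi>_add) simp
  qed
  from this[of k] have "\<pi> (v (\<lambda>i. if i < k then n i else 0)) = (\<Sum>i<k. of_int (n i) * \<pi> (unit_vec k i))" .
  moreover have "v (\<lambda>i. if i < k then n i else 0) = n"
    using n by (auto simp: v_def PiE_def extensional_def)
  ultimately show ?thesis by (simp add: lattice_proj_def mult.commute)
qed

section \<open>From the maximal torus to the cone of positive functionals\<close>

context fd_lie
begin

text \<open>The weights of the push-forward are exactly the images of the weights, so positivity is
  a condition on each weight of \<open>W\<close>.\<close>

lemma positive_push_forward_iff:
  assumes W: "is_grading (int_lattice k) W" and a: "a \<in> real_vectors k"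
  shows "is_positive_grading (push_forward (int_lattice k) (lattice_proj k a) id W) \<longleftrightarrow>
    a \<in> positive_cone k (weights (int_lattice k) W)"
proof -
  let ?\<Omega> = "weights (int_lattice k) W" and ?L = "coarsening (int_lattice k) W (lattice_proj k a)"
  have R: "lattice_proj k a ` ?\<Omega> \<subseteq> carrier real_group" by (simp add: real_group_def)
  have "is_grading real_group ?L"
    by (rule coarsening_grading[OF W comm_group_real_group R])
      (use lattice_proj_hom[of k a] in \<open>auto simp: hom_def weights_def\<close>)
  moreover have "weights real_group ?L = lattice_proj k a ` ?\<Omega>" by (rule weights_coarsening[OF W R])
  ultimately show ?thesis
    using a by (simp add: push_forward_eq_coarsening[OF W] is_positive_grading_def positive_cone_def)
qed

text \<open>By itself \<open>r\<close> may merge weights and then gives no realization. The pair of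
  \<open>n\<close> and \<open>r n\<close> separates them; universality extends it to a homomorphism,
  whose second coordinate is \<open>\<pi>\<close>.\<close>

lemma universal_realization_weight_map:
  fixes r :: "(nat \<Rightarrow> int) \<Rightarrow> real"
  assumes inf: "infinite (UNIV :: 'u set)"
    and univ: "is_universal_realization TYPE('u) A V (int_lattice k) W"
    and r: "\<And>m n x y. m \<in> weights (int_lattice k) W \<Longrightarrow> n \<in> weights (int_lattice k) W \<Longrightarrow>
      x \<in> W m \<Longrightarrow> y \<in> W n \<Longrightarrow> bracket x y \<noteq> 0 \<Longrightarrow>
      m \<otimes>\<^bsub>int_lattice k\<^esub> n \<in> weights (int_lattice k) W \<Longrightarrow> r (m \<otimes>\<^bsub>int_lattice k\<^esub> n) = r m + r n"
  obtains \<pi> where "\<pi> \<in> hom (int_lattice k) real_group"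
    "\<And>n. n \<in> weights (int_lattice k) W \<Longrightarrow> \<pi> n = r n"
proof -
  let ?Z = "int_lattice k" and ?\<Omega> = "weights (int_lattice k) W"
  interpret Z: comm_group ?Z by (rule comm_group_int_lattice)
  have real: "is_realization A V ?Z W" using univ by (simp add: is_universal_realization_def)
  then have W: "is_grading ?Z W" by (simp add: is_realization_def)
  obtain f0 where f0: "inj_on f0 (weights A V)" "f0 ` weights A V \<subseteq> carrier ?Z"
    "\<And>\<alpha>. \<alpha> \<in> weights A V \<Longrightarrow> W (f0 \<alpha>) = V \<alpha>"
    "\<And>n. n \<in> carrier ?Z \<Longrightarrow> n \<notin> f0 ` weights A V \<Longrightarrow> W n = {0}"
    using real unfolding is_realization_def by blast
  have \<Omega>: "?\<Omega> = f0 ` weights A V"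
  proof
    show "?\<Omega> \<subseteq> f0 ` weights A V"
    proof
      fix n assume "n \<in> ?\<Omega>"
      then have "n \<in> carrier ?Z" "W n \<noteq> {0}" by (simp_all add: weights_def[of ?Z])
      then show "n \<in> f0 ` weights A V" using f0(4) by blast
    qed
    show "f0 ` weights A V \<subseteq> ?\<Omega>"
    proof
      fix n assume "n \<in> f0 ` weights A V"
      then obtain \<alpha> where \<alpha>: "\<alpha> \<in> weights A V" "n = f0 \<alpha>" by blast
      then have "W n \<noteq> {0}" using f0(3)[OF \<alpha>(1)] by (simp add: weights_def[of A])
      moreover have "n \<in> carrier ?Z" using f0(2) \<alpha> by blast
      ultimately show "n \<in> ?\<Omega>" by (simp add: weights_def[of ?Z])
    qed
  qed
  have \<Omega>Z: "?\<Omega> \<subseteq> carrier ?Z" by (auto simp: weights_def)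
  have fin: "finite ?\<Omega>" by (rule finite_weights[OF W])
  txt \<open>The test group is the subgroup \<open>\<int>\<^sup>k \<times> \<langle>r n | n \<in> \<Omega>\<rangle>\<close> of \<open>\<int>\<^sup>k \<times> \<real>\<close>; it is countable, so it
    has a copy inside \<open>'u\<close>.\<close>
  define H where "H = (\<lambda>c. \<Sum>n\<in>?\<Omega>. of_int (c n) * r n) ` (?\<Omega> \<rightarrow>\<^sub>E (UNIV :: int set))"
  have HI: "(\<Sum>n\<in>?\<Omega>. of_int (c n) * r n) \<in> H" for c :: "(nat \<Rightarrow> int) \<Rightarrow> int"
    unfolding H_def by (rule image_eqI[of _ _ "restrict c ?\<Omega>"]) (auto intro!: sum.cong)
  have HE: "\<exists>c :: (nat \<Rightarrow> int) \<Rightarrow> int. s = (\<Sum>n\<in>?\<Omega>. of_int (c n) * r n)" if "s \<in> H" for s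
    using that unfolding H_def by blast
  have H_add: "s + s' \<in> H" if "s \<in> H" "s' \<in> H" for s s'
  proof -
    obtain c c' :: "(nat \<Rightarrow> int) \<Rightarrow> int" where "s = (\<Sum>n\<in>?\<Omega>. of_int (c n) * r n)"
      "s' = (\<Sum>n\<in>?\<Omega>. of_int (c' n) * r n)" using HE[OF \<open>s \<in> H\<close>] HE[OF \<open>s' \<in> H\<close>] by blast
    then show ?thesis using HI[of "\<lambda>n. c n + c' n"] by (simp add: sum.distrib algebra_simps)
  qed
  have H_neg: "- s \<in> H" if "s \<in> H" for s
  proof -
    obtain c :: "(nat \<Rightarrow> int) \<Rightarrow> int" where "s = (\<Sum>n\<in>?\<Omega>. of_int (c n) * r n)"
      using HE[OF \<open>s \<in> H\<close>] by blast
    then show ?thesis using HI[of "\<lambda>n. - c n"] by (simp add: sum_negf)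
  qed
  have H_zero: "0 \<in> H" using HI[of "\<lambda>n. 0"] by simp
  have H_r: "r n \<in> H" if "n \<in> ?\<Omega>" for n
  proof -
    have "(\<Sum>m\<in>?\<Omega>. of_int (if m = n then 1 else 0) * r m) = (\<Sum>m\<in>?\<Omega>. if m = n then r m else 0)"
      by (rule sum.cong) auto
    then show ?thesis using HI[of "\<lambda>m. if m = n then 1 else 0"] that fin by simp
  qed
  have cH: "countable H"
    unfolding H_def by (rule countable_image[OF countable_PiE_int[OF fin]])
  define G where "G = \<lparr>carrier = carrier ?Z \<times> H,
    monoid.mult = (\<lambda>(m, s) (n, t). (m \<otimes>\<^bsub>?Z\<^esub> n, s + t)), one = (\<one>\<^bsub>?Z\<^esub>, 0 :: real)\<rparr>"
  have G: "comm_group G"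
  proof (rule comm_groupI)
    show "\<exists>y\<in>carrier G. y \<otimes>\<^bsub>G\<^esub> x = \<one>\<^bsub>G\<^esub>" if xG: "x \<in> carrier G" for x
    proof -
      obtain n s where x: "x = (n, s)" "n \<in> carrier ?Z" "s \<in> H" using xG by (auto simp: G_def)
      then have "inv\<^bsub>?Z\<^esub> n \<otimes>\<^bsub>?Z\<^esub> n = \<one>\<^bsub>?Z\<^esub>" "inv\<^bsub>?Z\<^esub> n \<in> carrier ?Z"
        using Z.l_inv Z.inv_closed by blast+
      then show ?thesis using x H_neg by (intro bexI[of _ "(inv\<^bsub>?Z\<^esub> n, - s)"]) (auto simp: G_def)
    qed
    show "x \<otimes>\<^bsub>G\<^esub> y \<otimes>\<^bsub>G\<^esub> z = x \<otimes>\<^bsub>G\<^esub> (y \<otimes>\<^bsub>G\<^esub> z)"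
      if "x \<in> carrier G" "y \<in> carrier G" "z \<in> carrier G" for x y z
      using that Z.m_assoc by (auto simp: G_def simp del: mult_product_group)
    show "x \<otimes>\<^bsub>G\<^esub> y = y \<otimes>\<^bsub>G\<^esub> x" if "x \<in> carrier G" "y \<in> carrier G" for x y
      using that Z.m_comm by (auto simp: G_def simp del: mult_product_group)
    show "x \<otimes>\<^bsub>G\<^esub> y \<in> carrier G" if "x \<in> carrier G" "y \<in> carrier G" for x y
      using that Z.m_closed H_add by (auto simp: G_def simp del: mult_product_group carrier_product_group)
    show "\<one>\<^bsub>G\<^esub> \<in> carrier G"
      using Z.one_closed H_zero by (auto simp: G_def simp del: one_product_group carrier_product_group)
    show "\<one>\<^bsub>G\<^esub> \<otimes>\<^bsub>G\<^esub> x = x" if "x \<in> carrier G" for x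
      using that Z.l_one by (auto simp: G_def simp del: one_product_group mult_product_group carrier_product_group)
  qed
  have "countable (carrier ?Z)" using countable_PiE_int[of "{..<k}"] by simp
  then have cG: "countable (carrier G)" using cH by (simp add: G_def del: carrier_product_group)
  obtain g :: "nat \<Rightarrow> 'u" where g: "inj g" using infinite_countable_subset[OF inf] by blast
  define e where "e = g \<circ> to_nat_on (carrier G)"
  have e: "inj_on e (carrier G)"
    unfolding e_def by (rule comp_inj_on[OF inj_on_to_nat_on[OF cG] inj_on_subset[OF g]]) simp
  define B where "B = transport e G"
  have B: "comm_group B" unfolding B_def by (rule comm_group_transport[OF G e])
  have Bc: "carrier B = e ` carrier G" by (simp add: B_def transport_def)
  define d where "d = inv_into (carrier G) e"
  have de: "d (e x) = x" if "x \<in> carrier G" for x unfolding d_def by (rule inv_into_f_f[OF e that])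
  have Bm: "x \<otimes>\<^bsub>B\<^esub> y = e (d x \<otimes>\<^bsub>G\<^esub> d y)" for x y by (simp add: B_def transport_def d_def)
  define F where "F n = e (n, r n)" for n
  have nr: "(n, r n) \<in> carrier G" if "n \<in> ?\<Omega>" for n
    using that \<Omega>Z H_r by (auto simp: G_def simp del: carrier_product_group)
  have FB: "F ` ?\<Omega> \<subseteq> carrier B" using nr by (auto simp: F_def Bc)
  have Finj: "inj_on F ?\<Omega>"
    using nr de by (auto simp: inj_on_def F_def) (metis prod.inject)
  let ?L = "coarsening ?Z W F"
  have L: "is_grading B ?L"
  proof (rule coarsening_grading[OF W B FB])
    fix m n x y
    assume *: "m \<in> ?\<Omega>" "n \<in> ?\<Omega>" "x \<in> W m" "y \<in> W n" "bracket x y \<noteq> 0" "m \<otimes>\<^bsub>?Z\<^esub> n \<in> ?\<Omega>"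
    have "(m \<otimes>\<^bsub>?Z\<^esub> n, r (m \<otimes>\<^bsub>?Z\<^esub> n)) = (m, r m) \<otimes>\<^bsub>G\<^esub> (n, r n)"
      using r[OF *] by (simp add: G_def del: mult_product_group)
    then show "F (m \<otimes>\<^bsub>?Z\<^esub> n) = F m \<otimes>\<^bsub>B\<^esub> F n"
      by (simp only: F_def Bm de[OF nr[OF *(1)]] de[OF nr[OF *(2)]])
  qed
  have "is_realization A V B ?L"
    unfolding is_realization_def
  proof (intro conjI L exI[of _ "F \<circ> f0"] ballI)
    show "inj_on (F \<circ> f0) (weights A V)" using comp_inj_on[OF f0(1)] Finj by (simp add: \<Omega>)
    show "(F \<circ> f0) ` weights A V \<subseteq> carrier B" using FB by (simp add: \<Omega> image_comp)
    show "?L ((F \<circ> f0) \<alpha>) = V \<alpha>" if "\<alpha> \<in> weights A V" for \<alpha>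
      using coarsening_inj[OF W Finj, of "f0 \<alpha>"] that f0(3) by (simp add: \<Omega>)
    show "?L \<beta> = {0}" if "\<beta> \<in> carrier B - (F \<circ> f0) ` weights A V" for \<beta>
      by (rule coarsening_outside) (use that in \<open>simp add: \<Omega> image_comp\<close>)
  qed
  then obtain f where f: "f \<in> hom ?Z B" "\<And>\<beta>. \<beta> \<in> carrier B \<Longrightarrow> ?L \<beta> = push_forward ?Z f id W \<beta>"
    using univ unfolding is_universal_realization_def by blast
  \<comment> \<open>A nonzero vector of \<open>W n\<close> lies in the layers at both
    \<open>f n\<close> and \<open>F n\<close>, and distinct layers meet only in 0.\<close>
  have fF: "f n = F n" if n: "n \<in> ?\<Omega>" for n
  proof (rule ccontr)
    assume neq: "f n \<noteq> F n"
    obtain x where x: "x \<in> W n" "x \<noteq> 0" using nonzero_layer[OF W n] by blast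
    have fB: "f n \<in> carrier B" using f(1) n \<Omega>Z by (auto simp: hom_def simp del: carrier_product_group)
    have "x \<in> ?L (f n)"
      using f(2)[OF fB] coarsening_superset[OF n, of f] x(1) by (simp add: push_forward_eq_coarsening[OF W]) blast
    moreover have "x \<in> ?L (F n)" using coarsening_superset[OF n, of F] x(1) by blast
    moreover have "F n \<in> carrier B" using FB n by blast
    ultimately show False
      using direct_sum_disjoint[OF grading_direct_sum[OF L] fB _ neq] x(2) by blast
  qed
  define \<pi> where "\<pi> n = snd (d (f n))" for n
  have "\<pi> \<in> hom ?Z real_group"
  proof (rule homI)
    show "\<pi> n \<in> carrier real_group" for n by (simp add: real_group_def)
    fix m n assume mn: "m \<in> carrier ?Z" "n \<in> carrier ?Z"
    have "f m \<in> carrier B" "f n \<in> carrier B" using f(1) mn unfolding hom_def by blast+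
    then obtain x y where xy: "x \<in> carrier G" "y \<in> carrier G" "f m = e x" "f n = e y"
      unfolding Bc by blast
    have "f (m \<otimes>\<^bsub>?Z\<^esub> n) = f m \<otimes>\<^bsub>B\<^esub> f n" using f(1) mn unfolding hom_def by blast
    also have "\<dots> = e (x \<otimes>\<^bsub>G\<^esub> y)" using xy by (simp add: Bm de)
    finally have "d (f (m \<otimes>\<^bsub>?Z\<^esub> n)) = x \<otimes>\<^bsub>G\<^esub> y"
      using de comm_groupE(1)[OF G xy(1,2)] by simp
    then show "\<pi> (m \<otimes>\<^bsub>?Z\<^esub> n) = \<pi> m \<otimes>\<^bsub>real_group\<^esub> \<pi> n"
      unfolding \<pi>_def using xy by (simp add: de G_def real_group_def split_beta)
  qed
  moreover have "\<pi> n = r n" if "n \<in> ?\<Omega>" for n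
    using fF[OF that] de[OF nr[OF that]] by (simp add: \<pi>_def F_def)
  ultimately show thesis by (rule that)
qed

text \<open>Applied both to real weights and to weights in the lattice: additive rational functions
  that separate pairs suffice to renumber the layers by integers without merging any.\<close>

lemma integer_regrading_exists:
  fixes A (structure)
  assumes V: "is_grading A V"
    and sep: "\<And>x y. x \<in> weights A V \<Longrightarrow> y \<in> weights A V \<Longrightarrow> x \<noteq> y \<Longrightarrow> \<exists>\<phi> :: 'a \<Rightarrow> rat.
      (\<forall>a\<in>carrier A. \<forall>b\<in>carrier A. \<phi> (a \<otimes> b) = \<phi> a + \<phi> b) \<and> \<phi> x \<noteq> \<phi> y"
  obtains p M \<psi> where "int_graded scale bracket Basis p M"
    "\<And>i u. p i u = u \<Longrightarrow> u \<noteq> 0 \<Longrightarrow> \<exists>\<alpha>\<in>weights A V. \<psi> \<alpha> = i \<and> u \<in> V \<alpha>"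
    "\<And>\<alpha> u. \<alpha> \<in> weights A V \<Longrightarrow> u \<in> V \<alpha> \<Longrightarrow> p (\<psi> \<alpha>) u = u" "inj_on \<psi> (weights A V)"
proof -
  have sub: "weights A V \<subseteq> carrier A" by (auto simp: weights_def)
  obtain \<psi> :: "'a \<Rightarrow> int" where \<psi>: "inj_on \<psi> (weights A V)"
    "\<And>x y. x \<in> weights A V \<Longrightarrow> y \<in> weights A V \<Longrightarrow> x \<otimes> y \<in> weights A V \<Longrightarrow> \<psi> (x \<otimes> y) = \<psi> x + \<psi> y"
    using integer_weight_map_exists[OF finite_weights[OF V] sub grading_group[OF V] sep] by blast
  let ?L = "coarsening A V \<psi>"
  have L: "is_grading integer_group ?L"
  proof (rule coarsening_grading[OF V])
    show "comm_group integer_group"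
      by (rule group.group_comm_groupI[OF group_integer_group]) (simp add: add.commute)
  qed (use \<psi>(2) in auto)
  then have ds: "is_direct_sum UNIV ?L" using grading_direct_sum by fastforce
  obtain M where M: "int_graded scale bracket Basis (\<lambda>i x. component UNIV ?L x i) M"
    using int_graded_of_grading[OF L] .
  show thesis
  proof (rule that[OF M])
    fix i u assume u: "component UNIV ?L u i = u" "u \<noteq> 0"
    then have mem: "u \<in> ?L i" using component_mem[OF ds, of i u] by simp
    then have "i \<in> \<psi> ` weights A V" using coarsening_outside[of i \<psi> A V] u(2) by blast
    then show "\<exists>\<alpha>\<in>weights A V. \<psi> \<alpha> = i \<and> u \<in> V \<alpha>"
      using mem coarsening_inj[OF V \<psi>(1)] by blast
  next
    fix \<alpha> u assume "\<alpha> \<in> weights A V" "u \<in> V \<alpha>"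
    then have "u \<in> ?L (\<psi> \<alpha>)" using coarsening_superset[of \<alpha> A V \<psi>] by blast
    then show "component UNIV ?L u (\<psi> \<alpha>) = u" by (simp add: component_layer[OF ds])
  qed (rule \<psi>(1))
qed

text \<open>After conjugation the derivation of \<open>P\<close> lies in the torus \<open>t\<close>,
  which is scalar on each \<open>W n\<close>. That scalar is an integer eigenvalue, and since
  \<open>\<psi>\<close> is injective on weights it picks out a single layer of
  \<open>P\<close>.\<close>

lemma maximal_grading_refines:
  assumes P: "is_grading real_group P"
    and max: "is_maximal_split_torus t"
    and real: "is_realization (dual_group t) (torus_grading t) (int_lattice k) W"
  obtains \<Phi> r where "\<Phi> \<in> automorphisms"
    "\<And>n. n \<in> weights (int_lattice k) W \<Longrightarrow> r n \<in> weights real_group P"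
    "\<And>n. n \<in> weights (int_lattice k) W \<Longrightarrow> W n \<subseteq> \<Phi> ` P (r n)"
proof -
  let ?Z = "int_lattice k" and ?\<Omega> = "weights (int_lattice k) W"
  have W: "is_grading ?Z W" using real by (simp add: is_realization_def)
  obtain f0 where f0: "\<And>\<alpha>. \<alpha> \<in> weights (dual_group t) (torus_grading t) \<Longrightarrow> W (f0 \<alpha>) = torus_grading t \<alpha>"
    "\<And>n. n \<in> carrier ?Z \<Longrightarrow> n \<notin> f0 ` weights (dual_group t) (torus_grading t) \<Longrightarrow> W n = {0}"
    using real unfolding is_realization_def by blast
  have scalarW: "\<exists>c. \<forall>u\<in>W n. \<delta> u = c *s u" if "n \<in> ?\<Omega>" "\<delta> \<in> t" for n \<delta>
  proof -
    have "n \<in> f0 ` weights (dual_group t) (torus_grading t)" using that(1) f0(2) by (auto simp: weights_def)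
    then obtain \<alpha> where "W n = torus_grading t \<alpha>" using f0(1) by blast
    then show ?thesis using that(2) by (auto simp: torus_grading_def)
  qed
  obtain p M \<psi> where p: "int_graded scale bracket Basis p M"
    "\<And>i u. p i u = u \<Longrightarrow> u \<noteq> 0 \<Longrightarrow> \<exists>s\<in>weights real_group P. \<psi> s = i \<and> u \<in> P s"
    "\<And>s u. s \<in> weights real_group P \<Longrightarrow> u \<in> P s \<Longrightarrow> p (\<psi> s) u = u" "inj_on \<psi> (weights real_group P)"
  proof (rule integer_regrading_exists[OF P])
    fix x y :: real assume "x \<noteq> y"
    then obtain \<phi> :: "real \<Rightarrow> rat" where \<phi>: "\<And>a b. \<phi> (a + b) = \<phi> a + \<phi> b" "\<phi> (x - y) = 1"
      using rational_functional_exists[of "x - y"] by (metis right_minus_eq)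
    have "\<phi> x = \<phi> y + 1" using \<phi>(1)[of y "x - y"] \<phi>(2) by simp
    then show "\<exists>\<phi> :: real \<Rightarrow> rat. (\<forall>a\<in>carrier real_group. \<forall>b\<in>carrier real_group.
        \<phi> (a \<otimes>\<^bsub>real_group\<^esub> b) = \<phi> a + \<phi> b) \<and> \<phi> x \<noteq> \<phi> y"
      using \<phi>(1) by (intro exI[of _ \<phi>]) (simp add: real_group_def)
  qed (rule that)
  obtain p' M' \<psi>' where p': "int_graded scale bracket Basis p' M'"
    "\<And>i u. p' i u = u \<Longrightarrow> u \<noteq> 0 \<Longrightarrow> \<exists>n\<in>?\<Omega>. \<psi>' n = i \<and> u \<in> W n"
    "\<And>n u. n \<in> ?\<Omega> \<Longrightarrow> u \<in> W n \<Longrightarrow> p' (\<psi>' n) u = u" "inj_on \<psi>' ?\<Omega>"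
  proof (rule integer_regrading_exists[OF W])
    fix x y assume xy: "x \<in> ?\<Omega>" "y \<in> ?\<Omega>" "x \<noteq> y"
    then have "x \<in> {..<k} \<rightarrow>\<^sub>E UNIV" "y \<in> {..<k} \<rightarrow>\<^sub>E UNIV" by (auto simp: weights_def)
    then obtain i where i: "i < k" "x i \<noteq> y i" using xy(3) by (metis PiE_ext lessThan_iff)
    then show "\<exists>\<phi> :: (nat \<Rightarrow> int) \<Rightarrow> rat. (\<forall>a\<in>carrier ?Z. \<forall>b\<in>carrier ?Z.
        \<phi> (a \<otimes>\<^bsub>?Z\<^esub> b) = \<phi> a + \<phi> b) \<and> \<phi> x \<noteq> \<phi> y"
      by (intro exI[of _ "\<lambda>n. of_int (n i)"]) simp
  qed (rule that)
  interpret X: int_graded_pair scale bracket Basis p M p' M'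
    by (intro int_graded_pair.intro p(1) p'(1))
  obtain \<Phi> where \<Phi>: "\<Phi> \<in> automorphisms"
    "\<And>v. \<Phi> (X.h (inv_into UNIV \<Phi> (X.B.h v))) = X.B.h (\<Phi> (X.h (inv_into UNIV \<Phi> v)))"
    using X.conjugate_to_commuting_grading by blast
  note D = automorphism_D[OF \<Phi>(1)] and I = automorphism_D[OF automorphism_inv[OF \<Phi>(1)]]
  define q where "q = (\<lambda>i v. \<Phi> (p i (inv_into UNIV \<Phi> v)))"
  have "int_graded scale bracket Basis q M"
    using X.int_graded_conjugate[OF automorphism_inv[OF \<Phi>(1)]] by (simp add: q_def inv_inv_eq[OF D(2)])
  \<comment> \<open>The roles are exchanged: the maximal grading comes first and the conjugated
    positive grading second, as \<open>mem_maximal_split_torus\<close> expects.\<close>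
  interpret Y: int_graded_pair scale bracket Basis p' M' q M
    by (intro int_graded_pair.intro p'(1)) fact
  have Yh: "Y.B.h v = \<Phi> (X.h (inv_into UNIV \<Phi> v))" for v
    unfolding Y.B.h_def X.h_def by (simp add: q_def lin_sum[OF D(1)] lin_scale[OF D(1)])
  have torus: "Y.B.h \<in> t"
  proof (rule Y.mem_maximal_split_torus[OF max])
    show "Y.B.h (X.B.h v) = X.B.h (Y.B.h v)" for v unfolding Yh by (rule \<Phi>(2))
    fix \<delta> j assume \<delta>: "\<delta> \<in> t"
    have \<delta>l: "lin \<delta>" using \<delta> max derivation_lin unfolding is_maximal_split_torus_def is_split_torus_def by blast
    show "\<exists>c. \<forall>v. \<delta> (p' j v) = c *s p' j v"
    proof (cases "\<exists>v. p' j v \<noteq> 0")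
      case False then show ?thesis by (auto simp: lin_zero[OF \<delta>l])
    next
      case True
      have idem: "p' j (p' j v) = p' j v" for v by (simp add: X.B.p_p)
      obtain n where n: "n \<in> ?\<Omega>" "\<psi>' n = j" using True p'(2)[OF idem] by blast
      obtain c where c: "\<And>u. u \<in> W n \<Longrightarrow> \<delta> u = c *s u" using scalarW[OF n(1) \<delta>] by blast
      have "\<delta> (p' j v) = c *s p' j v" for v
      proof (cases "p' j v = 0")
        case False
        then obtain m where m: "m \<in> ?\<Omega>" "\<psi>' m = j" "p' j v \<in> W m" using p'(2)[OF idem] by blast
        then have "m = n" using n p'(4) by (simp add: inj_on_def)
        then show ?thesis using c m(3) by blast
      qed (simp add: lin_zero[OF \<delta>l])
      then show ?thesis by blast
    qed
  qed
  have "\<exists>s\<in>weights real_group P. W n \<subseteq> \<Phi> ` P s" if n: "n \<in> ?\<Omega>" for n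
  proof -
    obtain c where c: "\<And>w. w \<in> W n \<Longrightarrow> Y.B.h w = c *s w" using scalarW[OF n torus] by blast
    have hc: "X.h (inv_into UNIV \<Phi> w) = c *s inv_into UNIV \<Phi> w" if "w \<in> W n" for w
    proof -
      have "inv_into UNIV \<Phi> (Y.B.h w) = X.h (inv_into UNIV \<Phi> w)" by (simp add: Yh D(5))
      then show ?thesis by (simp add: c[OF that] lin_scale[OF I(1)])
    qed
    obtain w0 where w0: "w0 \<in> W n" "w0 \<noteq> 0" using nonzero_layer[OF W n] by blast
    define u0 where "u0 = inv_into UNIV \<Phi> w0"
    have u0: "u0 \<noteq> 0" using w0(2) D(4)[of w0] lin_zero[OF D(1)] by (auto simp: u0_def)
    \<comment> \<open>A nonzero component of \<open>u0\<close> forces the scalar \<open>c\<close> of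
      the base field to be the integer \<open>i\<close>.\<close>
    then obtain i where i: "p i u0 \<noteq> 0" using X.p_eqI[of u0 0] by (auto simp: X.p_simps)
    have "of_int i *s p i u0 = c *s p i u0"
      using X.p_h[of i u0] unfolding hc[OF w0(1), folded u0_def] lin_scale[OF X.p_lin] by (rule sym)
    then have ci: "c = of_int i" using i by simp
    have pi: "p i (inv_into UNIV \<Phi> w) = inv_into UNIV \<Phi> w" if "w \<in> W n" for w
      by (rule X.eigenvector_of_h) (use hc[OF that] ci in simp)
    obtain s where s: "s \<in> weights real_group P" "\<psi> s = i" "u0 \<in> P s"
      using p(2)[OF pi[OF w0(1)]] u0 by (auto simp: u0_def)
    have "w \<in> \<Phi> ` P s" if w: "w \<in> W n" for w
    proof -
      have "inv_into UNIV \<Phi> w \<in> P s"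
      proof (cases "inv_into UNIV \<Phi> w = 0")
        case True
        then show ?thesis
          using subspace_0[OF grading_subspace[OF P]] s(1) by (simp add: weights_def)
      next
        case False
        then obtain s' where "s' \<in> weights real_group P" "\<psi> s' = i" "inv_into UNIV \<Phi> w \<in> P s'"
          using p(2)[OF pi[OF w]] by blast
        then show ?thesis using s(1,2) p(4) by (metis inj_onD)
      qed
      then have "\<Phi> (inv_into UNIV \<Phi> w) \<in> \<Phi> ` P s" by blast
      then show ?thesis by (simp only: D(4))
    qed
    then show ?thesis using s(1) by blast
  qed
  then obtain r where "\<And>n. n \<in> ?\<Omega> \<Longrightarrow> r n \<in> weights real_group P"
    "\<And>n. n \<in> ?\<Omega> \<Longrightarrow> W n \<subseteq> \<Phi> ` P (r n)" by metis
  with \<Phi>(1) show thesis by (rule that)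
qed

text \<open>The layers of \<open>W\<close> refine those of the image of \<open>P\<close> under
  \<open>\<Phi>\<close>. A nonzero bracket lies in only one layer of the image, which makes
  \<open>r\<close> additive where needed; universality extends \<open>r\<close> to a homomorphism,
  and the push-forward along it recovers the image.\<close>

lemma positive_grading_equivalent:
  fixes k :: nat and W :: "(nat \<Rightarrow> int) \<Rightarrow> 'g set"
  assumes inf: "infinite (UNIV :: 'u set)"
    and W_max: "is_maximal_grading TYPE('u) (int_lattice k) W"
    and pos: "is_positive_grading P"
  shows "\<exists>a\<in>positive_cone k (weights (int_lattice k) W). equivalent_gradings real_group P real_group
    (push_forward (int_lattice k) (lattice_proj k a) id W)"
proof -
  let ?Z = "int_lattice k" and ?\<Omega> = "weights (int_lattice k) W"
  have P: "is_grading real_group P" using pos by (simp add: is_positive_grading_def)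
  obtain t where max: "is_maximal_split_torus t"
    and univ: "is_universal_realization TYPE('u) (dual_group t) (torus_grading t) ?Z W"
    using W_max unfolding is_maximal_grading_def by blast
  have real: "is_realization (dual_group t) (torus_grading t) ?Z W"
    using univ by (simp add: is_universal_realization_def)
  then have W: "is_grading ?Z W" by (simp add: is_realization_def)
  have \<Omega>Z: "?\<Omega> \<subseteq> carrier ?Z" by (auto simp: weights_def)
  have R: "carrier real_group = UNIV" by (simp add: real_group_def)
  have ds: "is_direct_sum UNIV P" using grading_direct_sum[OF P] by (simp add: R)
  obtain \<Phi> r where \<Phi>: "\<Phi> \<in> automorphisms"
    and r: "\<And>n. n \<in> ?\<Omega> \<Longrightarrow> r n \<in> weights real_group P" "\<And>n. n \<in> ?\<Omega> \<Longrightarrow> W n \<subseteq> \<Phi> ` P (r n)"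
    using maximal_grading_refines[OF P max real] by blast
  note D = automorphism_D[OF \<Phi>]
  have Psub: "subspace (P s)" for s using grading_subspace[OF P] by (simp add: R)
  have disj: "x = 0" if ss: "s \<noteq> s'" "x \<in> \<Phi> ` P s" "x \<in> \<Phi> ` P s'" for s s' x
  proof -
    obtain y y' where y: "y \<in> P s" "y' \<in> P s'" "x = \<Phi> y" "x = \<Phi> y'" using ss(2,3) by blast
    then have "y = y'" using D(5) by metis
    then have "y = 0" using direct_sum_disjoint[OF ds UNIV_I UNIV_I ss(1)] y(1,2) by blast
    then show ?thesis using y(3) lin_zero[OF D(1)] by simp
  qed
  obtain \<pi> where \<pi>: "\<pi> \<in> hom ?Z real_group" "\<And>n. n \<in> ?\<Omega> \<Longrightarrow> \<pi> n = r n"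
  proof (rule universal_realization_weight_map[OF inf univ, of r])
    fix m n x y assume *: "m \<in> ?\<Omega>" "n \<in> ?\<Omega>" "x \<in> W m" "y \<in> W n" "bracket x y \<noteq> 0" "m \<otimes>\<^bsub>?Z\<^esub> n \<in> ?\<Omega>"
    obtain x' y' where x': "x' \<in> P (r m)" "x = \<Phi> x'" and y': "y' \<in> P (r n)" "y = \<Phi> y'"
      using r(2)[OF *(1)] r(2)[OF *(2)] *(3,4) by blast
    have "bracket x' y' \<in> P (r m + r n)"
      using grading_bracket[OF P, of "r m" "r n" x' y'] x'(1) y'(1) by (simp add: real_group_def)
    then have 1: "bracket x y \<in> \<Phi> ` P (r m + r n)" by (simp add: x'(2) y'(2) D(3)[symmetric])
    have "bracket x y \<in> W (m \<otimes>\<^bsub>?Z\<^esub> n)"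
      using grading_bracket[OF W, of m n x y] *(1-4) \<Omega>Z by blast
    then have 2: "bracket x y \<in> \<Phi> ` P (r (m \<otimes>\<^bsub>?Z\<^esub> n))" using r(2)[OF *(6)] by blast
    show "r (m \<otimes>\<^bsub>?Z\<^esub> n) = r m + r n" by (rule ccontr) (use disj[OF _ 2 1] *(5) in simp)
  qed (rule that)
  define a where "a = (\<lambda>i\<in>{..<k}. \<pi> (unit_vec k i))"
  have proj: "lattice_proj k a n = r n" if "n \<in> ?\<Omega>" for n
    unfolding a_def hom_int_lattice_eq_lattice_proj[OF \<pi>(1) subsetD[OF \<Omega>Z that], symmetric]
    by (rule \<pi>(2)[OF that])
  have a: "a \<in> positive_cone k ?\<Omega>"
    using r(1) pos proj by (auto simp: positive_cone_def is_positive_grading_def a_def)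
  let ?L = "coarsening ?Z W (lattice_proj k a)"
  have PhiP: "subspace (\<Phi> ` P s)" for s by (rule subspace_lin_image[OF D(1) Psub])
  have L_sub: "?L s \<subseteq> \<Phi> ` P s" for s
    unfolding coarsening_def
  proof (rule span_minimal[OF UN_least PhiP])
    fix n assume "n \<in> {n \<in> ?\<Omega>. lattice_proj k a n = s}"
    then have "n \<in> ?\<Omega>" "r n = s" using proj by auto
    then show "W n \<subseteq> \<Phi> ` P s" using r(2)[of n] by simp
  qed
  \<comment> \<open>Two direct sums with layerwise inclusion coincide: the components of
    \<open>x\<close> in \<open>?L\<close>, minus \<open>x\<close> placed at \<open>s\<close>, add up
    to 0 in the direct sum of the larger layers, so the one at \<open>s\<close> vanishes.\<close>
  have "\<Phi> ` P s \<subseteq> ?L s" for s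
  proof
    fix x assume x: "x \<in> \<Phi> ` P s"
    let ?c = "component (carrier ?Z) W x"
    let ?y = "\<lambda>s. \<Sum>n\<in>{n \<in> ?\<Omega>. r n = s}. ?c n"
    have fin: "finite ?\<Omega>" by (rule finite_weights[OF W])
    have cW: "?c n \<in> W n" if "n \<in> ?\<Omega>" for n
      using component_mem[OF grading_direct_sum[OF W]] that \<Omega>Z by blast
    have yL: "?y s \<in> ?L s" for s
    proof -
      have "{n \<in> ?\<Omega>. lattice_proj k a n = s} = {n \<in> ?\<Omega>. r n = s}" using proj by auto
      then show ?thesis
        unfolding coarsening_decomposition[OF W] using cW by (intro exI[of _ ?c]) auto
    qed
    let ?S = "insert s (r ` ?\<Omega>)"
    have "(\<Sum>s\<in>?S. ?y s) = (\<Sum>n\<in>?\<Omega>. ?c n)" by (rule sum.group) (use fin in auto)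
    also have "\<dots> = x"
      using sum_components[OF grading_direct_sum[OF W], of x] by (simp only: weights_def)
    finally have sum_y: "(\<Sum>s\<in>?S. ?y s) = x" .
    define z where "z s' = inv_into UNIV \<Phi> (?y s' - (if s' = s then x else 0))" for s'
    have z: "z s' \<in> P s'" for s'
    proof -
      have "?y s' - (if s' = s then x else 0) \<in> \<Phi> ` P s'"
        by (rule subspace_diff[OF PhiP]) (use yL[of s'] L_sub[of s'] x subspace_0[OF PhiP] in auto)
      then obtain u where u: "?y s' - (if s' = s then x else 0) = \<Phi> u" "u \<in> P s'" by blast
      show ?thesis unfolding z_def u(1) D(5) by (rule u(2))
    qed
    have linI: "lin (inv_into UNIV \<Phi>)" using automorphism_D(1)[OF automorphism_inv[OF \<Phi>]] .
    have "(\<Sum>s'\<in>?S. z s') = inv_into UNIV \<Phi> ((\<Sum>s'\<in>?S. ?y s') - (\<Sum>s'\<in>?S. if s' = s then x else 0))"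
      by (simp only: z_def lin_sum[OF linI, symmetric] sum_subtractf)
    also have "(\<Sum>s'\<in>?S. if s' = s then x else 0) = x" using fin by simp
    finally have sum_z: "(\<Sum>s'\<in>?S. z s') = 0" unfolding sum_y diff_self lin_zero[OF linI] .
    have "z s = 0"
      by (rule direct_sum_independent[OF ds _ _ z sum_z]) (use fin in auto)
    then have "\<Phi> (z s) = 0" by (simp add: lin_zero[OF D(1)])
    then have "?y s = x" by (simp add: z_def D(4))
    then show "x \<in> ?L s" using yL[of s] by simp
  qed
  then have L: "?L s = \<Phi> ` P s" for s using L_sub by blast
  have "equivalent_gradings real_group P real_group ?L"
    unfolding equivalent_gradings_def
  \<comment> \<open>The automorphism takes the layer of \<open>P\<close> at each real number to the
    layer of \<open>?L\<close> at the same number, so the group isomorphism is the identity.\<close>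
  proof (intro bexI[of _ \<Phi>] bexI[of _ id] ballI)
    show "id \<in> iso real_group real_group" by (simp add: iso_def hom_def)
    fix s
    have "push_forward real_group id \<Phi> P s = span (\<Phi> ` P s)" by (simp add: push_forward_def R)
    also have "\<dots> = \<Phi> ` P s" using PhiP by (simp add: span_eq_iff)
    finally show "?L s = push_forward real_group id \<Phi> P s" by (simp add: L)
  qed (rule \<Phi>)
  then show ?thesis using a by (auto simp: push_forward_eq_coarsening[OF W])
qed

end

theorem mainTheorem3:
  fixes scale :: "'k::field_char_0 \<Rightarrow> 'g::ab_group_add \<Rightarrow> 'g"
    and bracket :: "'g \<Rightarrow> 'g \<Rightarrow> 'g" and Basis :: "'g set"
    and k :: nat and W :: "(nat \<Rightarrow> int) \<Rightarrow> 'g set" and \<Omega> :: "(nat \<Rightarrow> int) set"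
  assumes "finite_dimensional_lie_algebra scale bracket Basis"
    and "infinite (UNIV :: 'u set)"
    and "lie_algebra.is_maximal_grading scale bracket TYPE('u) (int_lattice k) W"
    and "\<Omega> = lie_algebra.weights (int_lattice k) W"
  shows "(\<forall>a\<in>real_vectors k.
            lie_algebra.is_positive_grading scale bracket
              (lie_algebra.push_forward scale (int_lattice k) (lattice_proj k a) id W)
            \<longleftrightarrow> a \<in> positive_cone k \<Omega>) \<and>
         (\<forall>P. lie_algebra.is_positive_grading scale bracket P \<longrightarrow>
            (\<exists>a\<in>positive_cone k \<Omega>.
               lie_algebra.equivalent_gradings scale bracket real_group P real_group
                 (lie_algebra.push_forward scale (int_lattice k) (lattice_proj k a) id W)))"
proof -
  have "vector_space scale"
    using assms(1) by (simp add: finite_dimensional_lie_algebra_def lie_algebra_def)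
  then interpret fd_lie scale bracket Basis
    by (intro fd_lie.intro assms(1) vspace.intro)
  have "is_grading (int_lattice k) W"
    using assms(3)
    by (auto simp: is_maximal_grading_def is_universal_realization_def is_realization_def)
  then show ?thesis
    using positive_push_forward_iff positive_grading_equivalent[OF assms(2,3)]
    unfolding assms(4) by blast
qed

end
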